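(* Let $G$ be a Lie group. Suppose that (i) $G$ admits a bi-invariant Riemannian or pseudo-Riemannian metric, and (ii) $G$ admits a left invariant contact structure. Then $G$ is locally isomorphic to $SL(2,\mathbb R)$ or to $SU(2)$.
   Context: Lie groups are real and finite dimensional. A left invariant contact structure on a Lie group $G$ of dimension $2n+1$ is given by a left invariant differential $1$-form $\eta^+$ on $G$ such that $(d\eta^+)^n\wedge\eta^+\neq 0$ at every point of $G$. A pseudo-Riemannian metric is a smooth field of symmetric non-degenerate real-valued bilinear forms on the tangent spaces. A (pseudo-)Riemannian metric on a Lie group is bi-invariant if it is invariant under both left and right translations. Two Lie groups are locally isomorphic if their Lie algebras are isomorphic.
   Formalization: The dimension 2n+1 of G is taken with n ≥ 1: for n = 0 the claim fails, since G = R with the metric dt² and the left invariant contact form dt satisfies both hypotheses but is one-dimensional. *)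

theory Defs
  imports "HOL-Analysis.Analysis" "HOL-Algebra.Group"
begin

section \<open>Smooth maps between open subsets of Euclidean spaces\<close>

text \<open>In finite dimension, being \<open>k + 1\<close> times continuously differentiable on an open set
  means being differentiable with all directional derivatives \<open>k\<close> times continuously
  differentiable.\<close>

primrec Ck_on ::
  "nat \<Rightarrow> 'a::euclidean_space set \<Rightarrow> ('a \<Rightarrow> 'b::euclidean_space) \<Rightarrow> bool" where
  "Ck_on 0 S f \<longleftrightarrow> continuous_on S f"
| "Ck_on (Suc k) S f \<longleftrightarrow>
     (\<forall>x\<in>S. f differentiable (at x)) \<and>
     (\<forall>v. Ck_on k S (\<lambda>x. frechet_derivative f (at x) v))"

definition smooth_on ::
  "'a::euclidean_space set \<Rightarrow> ('a \<Rightarrow> 'b::euclidean_space) \<Rightarrow> bool" where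
  "smooth_on S f \<longleftrightarrow> open S \<and> (\<forall>k. Ck_on k S f)"


section \<open>Smooth manifolds\<close>

text \<open>A chart is a pair of a domain and a coordinate map into the model space \<open>'e\<close>, so that
  the dimension is \<open>DIM('e)\<close>. The atlas need not be maximal.\<close>

type_synonym ('a, 'e) chart = "'a set \<times> ('a \<Rightarrow> 'e)"

record ('a, 'e) manifold =
  mtop :: "'a topology"
  atlas :: "('a, 'e) chart set"

definition chart_image :: "('a, 'e) chart \<Rightarrow> 'e set" where
  "chart_image c = snd c ` fst c"

definition chart_inv :: "('a, 'e) chart \<Rightarrow> 'e \<Rightarrow> 'a" where
  "chart_inv c = inv_into (fst c) (snd c)"

definition smooth_manifold :: "('a, 'e::euclidean_space) manifold \<Rightarrow> bool" where
  "smooth_manifold M \<longleftrightarrow>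
     Hausdorff_space (mtop M) \<and> second_countable (mtop M) \<and>
     (\<Union>c\<in>atlas M. fst c) = topspace (mtop M) \<and>
     (\<forall>c\<in>atlas M. openin (mtop M) (fst c) \<and> open (chart_image c) \<and>
        homeomorphic_map (subtopology (mtop M) (fst c)) (top_of_set (chart_image c)) (snd c)) \<and>
     (\<forall>c\<in>atlas M. \<forall>d\<in>atlas M. smooth_on (snd c ` (fst c \<inter> fst d)) (snd d \<circ> chart_inv c))"

definition smooth_map ::
  "('a, 'e::euclidean_space) manifold \<Rightarrow> ('b, 'f::euclidean_space) manifold \<Rightarrow> ('a \<Rightarrow> 'b) \<Rightarrow> bool" where
  "smooth_map M N f \<longleftrightarrow>
     continuous_map (mtop M) (mtop N) f \<and>
     (\<forall>c\<in>atlas M. \<forall>d\<in>atlas N.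
        smooth_on (snd c ` (fst c \<inter> f -` fst d)) (snd d \<circ> f \<circ> chart_inv c))"

definition prod_manifold ::
  "('a, 'e) manifold \<Rightarrow> ('b, 'f) manifold \<Rightarrow> ('a \<times> 'b, 'e \<times> 'f) manifold" where
  "prod_manifold M N =
     \<lparr>mtop = prod_topology (mtop M) (mtop N),
      atlas = {(fst c \<times> fst d, map_prod (snd c) (snd d)) | c d. c \<in> atlas M \<and> d \<in> atlas N}\<rparr>"


section \<open>Tangent vectors\<close>

text \<open>Each point \<open>p\<close> gets a preferred chart around it, and a tangent vector at \<open>p\<close> is represented
  by its coordinate vector in that chart. Thus every tangent space is a copy of the model space
  \<open>'e\<close>, and passing between a chart \<open>c\<close> and the preferred charts is by the derivatives
  \<open>from_chart\<close> and \<open>to_chart\<close> of the transition maps.\<close>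

definition chart_at :: "('a, 'e) manifold \<Rightarrow> 'a \<Rightarrow> ('a, 'e) chart" where
  "chart_at M p = (SOME c. c \<in> atlas M \<and> p \<in> fst c)"

text \<open>For a chart \<open>c\<close> and \<open>x\<close> in its image, the tangent vector at the point with
  \<open>c\<close>-coordinates \<open>x\<close> whose components with respect to \<open>c\<close> are \<open>w\<close>.\<close>

definition from_chart ::
  "('a, 'e::euclidean_space) manifold \<Rightarrow> ('a, 'e) chart \<Rightarrow> 'e \<Rightarrow> 'e \<Rightarrow> 'e" where
  "from_chart M c x w =
     frechet_derivative (snd (chart_at M (chart_inv c x)) \<circ> chart_inv c) (at x) w"

text \<open>Conversely, the components with respect to \<open>c\<close> of a tangent vector \<open>v\<close> at \<open>p\<close>.\<close>

definition to_chart ::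
  "('a, 'e::euclidean_space) manifold \<Rightarrow> ('a, 'e) chart \<Rightarrow> 'a \<Rightarrow> 'e \<Rightarrow> 'e" where
  "to_chart M c p v =
     frechet_derivative (snd c \<circ> chart_inv (chart_at M p)) (at (snd (chart_at M p) p)) v"

text \<open>The tangent map of \<open>f\<close> at \<open>p\<close>.\<close>

definition tangent_map ::
  "('a, 'e::euclidean_space) manifold \<Rightarrow> ('b, 'f::euclidean_space) manifold \<Rightarrow>
     ('a \<Rightarrow> 'b) \<Rightarrow> 'a \<Rightarrow> 'e \<Rightarrow> 'f" where
  "tangent_map M N f p v =
     frechet_derivative (snd (chart_at N (f p)) \<circ> f \<circ> chart_inv (chart_at M p))
       (at (snd (chart_at M p) p)) v"

text \<open>The Lie bracket of vector fields at \<open>p\<close>, computed in the preferred chart at \<open>p\<close> as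
  \<open>DY(X) - DX(Y)\<close>.\<close>

definition vf_in_chart ::
  "('a, 'e::euclidean_space) manifold \<Rightarrow> ('a, 'e) chart \<Rightarrow> ('a \<Rightarrow> 'e) \<Rightarrow> 'e \<Rightarrow> 'e" where
  "vf_in_chart M c X x = to_chart M c (chart_inv c x) (X (chart_inv c x))"

definition vf_bracket ::
  "('a, 'e::euclidean_space) manifold \<Rightarrow> ('a \<Rightarrow> 'e) \<Rightarrow> ('a \<Rightarrow> 'e) \<Rightarrow> 'a \<Rightarrow> 'e" where
  "vf_bracket M X Y p =
     (let c = chart_at M p; x = snd c p; X' = vf_in_chart M c X; Y' = vf_in_chart M c Y
      in frechet_derivative Y' (at x) (X' x) - frechet_derivative X' (at x) (Y' x))"


section \<open>Differential forms and metrics\<close>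

definition one_form ::
  "('a, 'e::euclidean_space) manifold \<Rightarrow> ('a \<Rightarrow> 'e \<Rightarrow> real) \<Rightarrow> bool" where
  "one_form M \<eta> \<longleftrightarrow>
     (\<forall>p\<in>topspace (mtop M). linear (\<eta> p)) \<and>
     (\<forall>c\<in>atlas M. \<forall>w. smooth_on (chart_image c) (\<lambda>x. \<eta> (chart_inv c x) (from_chart M c x w)))"

text \<open>The exterior derivative of a 1-form at \<open>p\<close>. In the preferred chart at \<open>p\<close> the form is
  \<open>\<Sum> \<eta>\<^sub>i dx\<^sub>i\<close>, and \<open>d\<eta> = \<Sum> d\<eta>\<^sub>i \<and> dx\<^sub>i\<close>.\<close>

definition ext_deriv ::
  "('a, 'e::euclidean_space) manifold \<Rightarrow> ('a \<Rightarrow> 'e \<Rightarrow> real) \<Rightarrow> 'a \<Rightarrow> 'e \<Rightarrow> 'e \<Rightarrow> real" where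
  "ext_deriv M \<eta> p u v =
     (let c = chart_at M p; x = snd c p;
          \<eta>' = (\<lambda>w y. \<eta> (chart_inv c y) (from_chart M c y w))
      in frechet_derivative (\<eta>' v) (at x) u - frechet_derivative (\<eta>' u) (at x) v)"

text \<open>A \<open>k\<close>-form on a vector space is a function of \<open>v 0, \<dots>, v (k - 1)\<close>.\<close>

definition wedge ::
  "nat \<Rightarrow> nat \<Rightarrow> ((nat \<Rightarrow> 'v) \<Rightarrow> real) \<Rightarrow> ((nat \<Rightarrow> 'v) \<Rightarrow> real) \<Rightarrow> (nat \<Rightarrow> 'v) \<Rightarrow> real" where
  "wedge k l \<alpha> \<beta> v =
     (\<Sum>\<sigma> | \<sigma> permutes {..<k + l}.
        of_int (sign \<sigma>) * \<alpha> (\<lambda>i. v (\<sigma> i)) * \<beta> (\<lambda>i. v (\<sigma> (k + i)))) / (fact k * fact l)"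

primrec two_form_power ::
  "((nat \<Rightarrow> 'v) \<Rightarrow> real) \<Rightarrow> nat \<Rightarrow> (nat \<Rightarrow> 'v) \<Rightarrow> real" where
  "two_form_power \<omega> 0 = (\<lambda>v. 1)"
| "two_form_power \<omega> (Suc m) = wedge 2 (2 * m) \<omega> (two_form_power \<omega> m)"

definition contact_form ::
  "('a, 'e::euclidean_space) manifold \<Rightarrow> nat \<Rightarrow> ('a \<Rightarrow> 'e \<Rightarrow> real) \<Rightarrow> bool" where
  "contact_form M n \<eta> \<longleftrightarrow>
     DIM('e) = 2 * n + 1 \<and> one_form M \<eta> \<and>
     (\<forall>p\<in>topspace (mtop M). \<exists>v.
        wedge (2 * n) 1
          (two_form_power (\<lambda>v. ext_deriv M \<eta> p (v 0) (v 1)) n)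
          (\<lambda>v. \<eta> p (v 0)) v \<noteq> 0)"

text \<open>Positive definiteness is not required, so this covers the Riemannian case as well.\<close>

definition pseudo_riemannian_metric ::
  "('a, 'e::euclidean_space) manifold \<Rightarrow> ('a \<Rightarrow> 'e \<Rightarrow> 'e \<Rightarrow> real) \<Rightarrow> bool" where
  "pseudo_riemannian_metric M B \<longleftrightarrow>
     (\<forall>p\<in>topspace (mtop M).
        bilinear (B p) \<and> (\<forall>u v. B p u v = B p v u) \<and>
        (\<forall>u. (\<forall>v. B p u v = 0) \<longrightarrow> u = 0)) \<and>
     (\<forall>c\<in>atlas M. \<forall>u v. smooth_on (chart_image c)
        (\<lambda>x. B (chart_inv c x) (from_chart M c x u) (from_chart M c x v)))"


section \<open>Lie groups\<close>

definition lie_group ::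
  "('a, 'c) monoid_scheme \<Rightarrow> ('a, 'e::euclidean_space) manifold \<Rightarrow> bool" where
  "lie_group G M \<longleftrightarrow>
     group G \<and> smooth_manifold M \<and> carrier G = topspace (mtop M) \<and>
     smooth_map (prod_manifold M M) M (\<lambda>(x, y). x \<otimes>\<^bsub>G\<^esub> y) \<and>
     smooth_map M M (\<lambda>x. m_inv G x)"

definition left_invariant_form ::
  "('a, 'c) monoid_scheme \<Rightarrow> ('a, 'e::euclidean_space) manifold \<Rightarrow> ('a \<Rightarrow> 'e \<Rightarrow> real) \<Rightarrow> bool" where
  "left_invariant_form G M \<eta> \<longleftrightarrow>
     (\<forall>g\<in>carrier G. \<forall>p\<in>carrier G. \<forall>v.
        \<eta> (g \<otimes>\<^bsub>G\<^esub> p) (tangent_map M M (\<lambda>x. g \<otimes>\<^bsub>G\<^esub> x) p v) = \<eta> p v)"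

definition bi_invariant_metric ::
  "('a, 'c) monoid_scheme \<Rightarrow> ('a, 'e::euclidean_space) manifold \<Rightarrow>
     ('a \<Rightarrow> 'e \<Rightarrow> 'e \<Rightarrow> real) \<Rightarrow> bool" where
  "bi_invariant_metric G M B \<longleftrightarrow>
     pseudo_riemannian_metric M B \<and>
     (\<forall>g\<in>carrier G. \<forall>p\<in>carrier G. \<forall>u v.
        B (g \<otimes>\<^bsub>G\<^esub> p) (tangent_map M M (\<lambda>x. g \<otimes>\<^bsub>G\<^esub> x) p u)
          (tangent_map M M (\<lambda>x. g \<otimes>\<^bsub>G\<^esub> x) p v) = B p u v \<and>
        B (p \<otimes>\<^bsub>G\<^esub> g) (tangent_map M M (\<lambda>x. x \<otimes>\<^bsub>G\<^esub> g) p u)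
          (tangent_map M M (\<lambda>x. x \<otimes>\<^bsub>G\<^esub> g) p v) = B p u v)"

text \<open>The Lie algebra is the tangent space at the identity (represented by \<open>'e\<close>) with the
  bracket of the corresponding left invariant vector fields.\<close>

definition left_invariant_field ::
  "('a, 'c) monoid_scheme \<Rightarrow> ('a, 'e::euclidean_space) manifold \<Rightarrow> 'e \<Rightarrow> 'a \<Rightarrow> 'e" where
  "left_invariant_field G M u p = tangent_map M M (\<lambda>x. p \<otimes>\<^bsub>G\<^esub> x) \<one>\<^bsub>G\<^esub> u"

definition lie_bracket ::
  "('a, 'c) monoid_scheme \<Rightarrow> ('a, 'e::euclidean_space) manifold \<Rightarrow> 'e \<Rightarrow> 'e \<Rightarrow> 'e" where
  "lie_bracket G M u v =
     vf_bracket M (left_invariant_field G M u) (left_invariant_field G M v) \<one>\<^bsub>G\<^esub>"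

definition locally_isomorphic ::
  "('a, 'c) monoid_scheme \<Rightarrow> ('a, 'e::euclidean_space) manifold \<Rightarrow>
   ('b, 'd) monoid_scheme \<Rightarrow> ('b, 'f::euclidean_space) manifold \<Rightarrow> bool" where
  "locally_isomorphic G M H N \<longleftrightarrow>
     (\<exists>\<phi>::'e \<Rightarrow> 'f. linear \<phi> \<and> bij \<phi> \<and>
        (\<forall>u v. \<phi> (lie_bracket G M u v) = lie_bracket H N (\<phi> u) (\<phi> v)))"


section \<open>The groups SL(2,R) and SU(2)\<close>

text \<open>A subset \<open>S\<close> of a Euclidean space, with its subspace topology and all charts that are
  diffeomorphisms from an open subset of \<open>S\<close> to an open subset of \<open>'e\<close>. As usual, a map on a
  subset of a Euclidean space is smooth if it locally extends to a smooth map on an open set.\<close>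

definition submanifold ::
  "'v::euclidean_space set \<Rightarrow> ('v, 'e::euclidean_space) manifold" where
  "submanifold S =
     \<lparr>mtop = top_of_set S,
      atlas = {c. openin (top_of_set S) (fst c) \<and> inj_on (snd c) (fst c) \<and>
        (\<forall>p\<in>fst c. \<exists>W F. p \<in> W \<and> smooth_on W F \<and> (\<forall>q\<in>W \<inter> fst c. F q = snd c q)) \<and>
        smooth_on (chart_image c) (chart_inv c)}\<rparr>"

definition SL2R :: "(real^2^2) monoid" where
  "SL2R = \<lparr>carrier = {A. det A = 1}, mult = (**), one = mat 1\<rparr>"

definition SU2 :: "(complex^2^2) monoid" where
  "SU2 = \<lparr>carrier = {A. (\<chi> i j. cnj (A $ j $ i)) ** A = mat 1 \<and> det A = 1},
          mult = (**), one = mat 1\<rparr>"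

definition SL2R_manifold :: "(real^2^2, real^3) manifold" where
  "SL2R_manifold = submanifold (carrier SL2R)"

definition SU2_manifold :: "(complex^2^2, real^3) manifold" where
  "SU2_manifold = submanifold (carrier SU2)"

end

theory Submission
  imports Defs "HOL-Computational_Algebra.Fundamental_Theorem_Algebra"
begin

text \<open>Let \<open>B\<close> be the metric and \<open>\<eta>\<close> the contact form at the identity, and let \<open>\<xi>\<close> be the vector
  with \<open>\<eta> = B \<xi>\<close>. Invariance of \<open>\<eta>\<close> and \<open>B\<close> gives \<open>d\<eta>(u, v) = - \<eta> [u, v] = - B [\<xi>, u] v\<close>, so the
  contact condition says that the centralizer of \<open>\<xi>\<close> is the line through \<open>\<xi>\<close> and that
  \<open>B \<xi> \<xi> \<noteq> 0\<close>. After complexification, an eigenvalue \<open>\<lambda>\<close> of \<open>ad \<xi>\<close> of maximal modulus yields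
  an \<open>sl\<^sub>2\<close>-triple containing a multiple of \<open>\<xi>\<close>, and the Jacobi identity rules out all eigenvalues
  but \<open>0\<close> and the simple eigenvalues \<open>\<plusminus>\<lambda>\<close>. Hence the dimension is three, and an orthogonal
  basis \<open>\<xi>, x, [\<xi>, x]\<close> brings the bracket into the form of \<open>sl(2,R)\<close> or \<open>su(2)\<close>.\<close>


section \<open>Differential calculus\<close>

text \<open>\<open>B\<close> may be indefinite and nothing is known about radicals, so neither
  compactness nor semisimplicity is available, and ad \<xi> may a priori have Jordan blocks and
  non-real eigenvalues. The complex part therefore works with generalized eigenspaces
  \<open>G a\<close>. Invariance lets \<open>B\<close> pair \<open>G a\<close> only with
  \<open>G (- a)\<close>, while the centralizer condition and
  \<open>B \<xi> \<xi> \<noteq> 0\<close> shrink \<open>G 0\<close> to the line through \<xi>, so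
  brackets of \<open>G a\<close> with \<open>G (- a)\<close> are multiples of \<xi>. Maximal modulus
  makes sums such as 2 \<lambda> leave the spectrum; this does the work of a highest root without an
  ordering of roots. On the analytic side the chart at the identity is an arbitrary choice, both for
  the given group and for the two matrix groups. The former is treated as a local group in that
  chart; for the latter the bracket is carried to the matrix commutator by the derivative of the
  inclusion, and is known only up to a linear isomorphism. The bound n \<ge> 1 excludes dimension
  one, where every nowhere zero form is contact with n = 0.\<close>

lemma second_difference_mean_value:
  fixes f :: "'a::real_normed_vector \<Rightarrow> real"
  assumes S: "ball x r \<subseteq> S"
    and f: "\<And>y. y \<in> S \<Longrightarrow> (f has_derivative f' y) (at y)"
    and f'': "\<And>y. y \<in> S \<Longrightarrow> ((\<lambda>z. f' z u) has_derivative H y) (at y)"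
    and h: "0 < h" "h * (norm u + norm v) < r"
  shows "\<exists>y\<in>ball x r. f (x + h *\<^sub>R u + h *\<^sub>R v) - f (x + h *\<^sub>R u) - f (x + h *\<^sub>R v) + f x = h\<^sup>2 * H y v"
proof -
  have inS: "x + s *\<^sub>R u + t *\<^sub>R v \<in> ball x r" if "0 \<le> s" "s \<le> h" "0 \<le> t" "t \<le> h" for s t
  proof -
    have "norm (s *\<^sub>R u + t *\<^sub>R v) \<le> s * norm u + t * norm v"
      using that by (metis abs_of_nonneg norm_scaleR norm_triangle_ineq)
    also have "\<dots> \<le> h * (norm u + norm v)"
      using that by (simp add: distrib_left add_mono mult_right_mono)
    finally have "norm (s *\<^sub>R u + t *\<^sub>R v) < r" using h by linarith
    moreover have "dist x (x + s *\<^sub>R u + t *\<^sub>R v) = norm (s *\<^sub>R u + t *\<^sub>R v)"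
      by (metis add.assoc add_diff_cancel_left' dist_commute dist_norm)
    ultimately show ?thesis by simp
  qed
  \<comment> \<open>The mean value theorem is applied first along \<open>u\<close> to the increment
    in direction \<open>v\<close>, then along \<open>v\<close> to the
    \<open>u\<close>-derivative.\<close>
  define \<phi> where "\<phi> s = f (x + s *\<^sub>R u + h *\<^sub>R v) - f (x + s *\<^sub>R u + 0 *\<^sub>R v)" for s
  define \<phi>' where "\<phi>' s = f' (x + s *\<^sub>R u + h *\<^sub>R v) u - f' (x + s *\<^sub>R u + 0 *\<^sub>R v) u" for s
  have 1: "((\<lambda>s. f (x + s *\<^sub>R u + t *\<^sub>R v)) has_real_derivative f' (x + s *\<^sub>R u + t *\<^sub>R v) u) (at s)"
    if "0 \<le> s" "s \<le> h" "0 \<le> t" "t \<le> h" for s t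
  proof -
    have D: "(f has_derivative f' (x + s *\<^sub>R u + t *\<^sub>R v)) (at (x + s *\<^sub>R u + t *\<^sub>R v))"
      using f inS that S by blast
    have "((\<lambda>s. x + s *\<^sub>R u + t *\<^sub>R v) has_derivative (\<lambda>k. k *\<^sub>R u)) (at s)"
      by (auto intro!: derivative_eq_intros)
    from has_derivative_compose[OF this D]
    show ?thesis
      unfolding has_field_derivative_def
      by (simp add: linear_scale[OF has_derivative_linear[OF D]] mult.commute[of _ "f' _ u"])
  qed
  have "(\<phi> has_real_derivative \<phi>' s) (at s)" if "0 \<le> s" "s \<le> h" for s
    unfolding \<phi>_def \<phi>'_def using that h by (intro DERIV_diff 1) auto
  from MVT2[OF h(1) this] obtain s where s: "0 < s" "s < h" "\<phi> h - \<phi> 0 = h * \<phi>' s" by auto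
  define \<psi> where "\<psi> t = f' (x + s *\<^sub>R u + t *\<^sub>R v) u" for t
  have "(\<psi> has_real_derivative H (x + s *\<^sub>R u + t *\<^sub>R v) v) (at t)" if "0 \<le> t" "t \<le> h" for t
  proof -
    have D: "((\<lambda>z. f' z u) has_derivative H (x + s *\<^sub>R u + t *\<^sub>R v)) (at (x + s *\<^sub>R u + t *\<^sub>R v))"
      using f'' inS that S s by (meson less_imp_le subsetD)
    have "((\<lambda>t. x + s *\<^sub>R u + t *\<^sub>R v) has_derivative (\<lambda>k. k *\<^sub>R v)) (at t)"
      by (auto intro!: derivative_eq_intros)
    from has_derivative_compose[OF this D]
    show ?thesis
      unfolding has_field_derivative_def \<psi>_def
      by (simp add: linear_scale[OF has_derivative_linear[OF D]] mult.commute[of _ "H _ v"])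
  qed
  from MVT2[OF h(1) this] obtain t where t: "0 < t" "t < h"
    "\<psi> h - \<psi> 0 = h * H (x + s *\<^sub>R u + t *\<^sub>R v) v" by auto
  have "f (x + h *\<^sub>R u + h *\<^sub>R v) - f (x + h *\<^sub>R u) - f (x + h *\<^sub>R v) + f x = \<phi> h - \<phi> 0"
    by (simp add: \<phi>_def)
  also have "\<dots> = h * (\<psi> h - \<psi> 0)" unfolding s(3) by (simp add: \<phi>'_def \<psi>_def)
  also have "\<dots> = h\<^sup>2 * H (x + s *\<^sub>R u + t *\<^sub>R v) v"
    unfolding t(3) by (simp add: power2_eq_square)
  finally show ?thesis using inS s t by (meson less_imp_le)
qed

text \<open>The second difference does not change when \<open>u\<close> and \<open>v\<close> are
  exchanged, and divided by the square of \<open>h\<close> it is a value of either mixed derivative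
  at a point near \<open>x\<close>. By continuity the two mixed derivatives agree at
  \<open>x\<close>.\<close>

lemma symmetric_second_derivative_real:
  fixes f :: "'a::real_normed_vector \<Rightarrow> real"
  assumes S: "open S" "x \<in> S"
    and f: "\<And>y. y \<in> S \<Longrightarrow> (f has_derivative f' y) (at y)"
    and fu: "\<And>y. y \<in> S \<Longrightarrow> ((\<lambda>z. f' z u) has_derivative Hu y) (at y)"
    and fv: "\<And>y. y \<in> S \<Longrightarrow> ((\<lambda>z. f' z v) has_derivative Hv y) (at y)"
    and cu: "continuous_on S (\<lambda>y. Hu y v)" and cv: "continuous_on S (\<lambda>y. Hv y u)"
  shows "Hu x v = Hv x u"
proof (rule ccontr)
  assume ne: "Hu x v \<noteq> Hv x u"
  \<comment> \<open>Half the gap, so that values within \<open>d\<close> of the two limits cannot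
    coincide.\<close>
  define d where "d = \<bar>Hu x v - Hv x u\<bar> / 2"
  have d: "d > 0" using ne by (simp add: d_def)
  have "isCont (\<lambda>y. Hu y v) x" "isCont (\<lambda>y. Hv y u) x"
    using cu cv S by (auto simp: continuous_on_eq_continuous_at)
  then obtain e1 e2 where e: "e1 > 0" "\<And>y. dist y x < e1 \<Longrightarrow> dist (Hu y v) (Hu x v) < d"
    "e2 > 0" "\<And>y. dist y x < e2 \<Longrightarrow> dist (Hv y u) (Hv x u) < d"
    using d unfolding continuous_at_eps_delta by metis
  obtain r0 where r0: "r0 > 0" "ball x r0 \<subseteq> S" using S open_contains_ball by blast
  define r where "r = min r0 (min e1 e2)"
  have r: "r > 0" "ball x r \<subseteq> S" using r0 e unfolding r_def by auto
  define h where "h = r / (norm u + norm v + 1)"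
  have np: "norm u + norm v + 1 > 0" by (simp add: add_nonneg_pos)
  have h: "0 < h" using r np by (simp add: h_def)
  have "h * (norm u + norm v + 1) = r" using np by (simp add: h_def)
  then have hr: "h * (norm u + norm v) < r" "h * (norm v + norm u) < r"
    using h by (auto simp: algebra_simps)
  obtain y where y: "y \<in> ball x r"
    "f (x + h *\<^sub>R u + h *\<^sub>R v) - f (x + h *\<^sub>R u) - f (x + h *\<^sub>R v) + f x = h\<^sup>2 * Hu y v"
    using second_difference_mean_value[OF r(2) f fu h hr(1)] by blast
  obtain z where z: "z \<in> ball x r"
    "f (x + h *\<^sub>R v + h *\<^sub>R u) - f (x + h *\<^sub>R v) - f (x + h *\<^sub>R u) + f x = h\<^sup>2 * Hv z u"
    using second_difference_mean_value[OF r(2) f fv h hr(2)] by blast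
  have "x + h *\<^sub>R v + h *\<^sub>R u = x + h *\<^sub>R u + h *\<^sub>R v" by simp
  then have "h\<^sup>2 * Hu y v = h\<^sup>2 * Hv z u" using y(2) z(2) by (simp only: algebra_simps)
  then have "Hu y v = Hv z u" using h by simp
  moreover have "dist (Hu y v) (Hu x v) < d" "dist (Hv z u) (Hv x u) < d"
    using e(2)[of y] e(4)[of z] y(1) z(1) by (auto simp: r_def dist_commute)
  ultimately show False by (simp add: d_def dist_real_def abs_if split: if_splits)
qed

lemma symmetric_second_derivative:
  fixes f :: "'a::euclidean_space \<Rightarrow> 'b::euclidean_space"
  assumes "Ck_on 2 S f" "open S" "x \<in> S"
  shows "frechet_derivative (\<lambda>y. frechet_derivative f (at y) u) (at x) v =
         frechet_derivative (\<lambda>y. frechet_derivative f (at y) v) (at x) u"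
proof (rule euclidean_eqI)
  fix b :: 'b
  let ?D = "\<lambda>y. frechet_derivative f (at y)"
  let ?H = "\<lambda>u y. frechet_derivative (\<lambda>y. ?D y u) (at y)"
  have C: "\<forall>x\<in>S. f differentiable at x" "\<forall>u. \<forall>x\<in>S. (\<lambda>y. ?D y u) differentiable at x"
    "\<forall>u v. continuous_on S (\<lambda>y. ?H u y v)"
    using assms(1) by (auto simp: numeral_2_eq_2)
  have 1: "((\<lambda>y. f y \<bullet> b) has_derivative (\<lambda>w. ?D y w \<bullet> b)) (at y)" if "y \<in> S" for y
    using C(1) that by (intro has_derivative_inner_left) (simp add: frechet_derivative_works[symmetric])
  have 2: "((\<lambda>z. ?D z w \<bullet> b) has_derivative (\<lambda>k. ?H w y k \<bullet> b)) (at y)" if "y \<in> S" for y w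
    using C(2) that by (intro has_derivative_inner_left) (simp add: frechet_derivative_works[symmetric])
  have 3: "continuous_on S (\<lambda>y. ?H w y k \<bullet> b)" for w k
    using C(3) by (intro continuous_intros) auto
  show "?H u x v \<bullet> b = ?H v x u \<bullet> b"
    using symmetric_second_derivative_real[OF assms(2,3) 1 2 2 3 3] by blast
qed

section \<open>Locality of derivatives and closure properties of the classes
  \<open>Ck_on\<close>\<close>

lemma frechet_derivative_cong:
  assumes "open S" "x \<in> S" "\<And>y. y \<in> S \<Longrightarrow> f y = g y"
  shows "frechet_derivative f (at x) = frechet_derivative g (at x)"
proof -
  have "(f has_derivative D) (at x) \<longleftrightarrow> (g has_derivative D) (at x)" for D
    using has_derivative_transform_within_open[OF _ assms(1,2)] assms(3) by metis
  then show ?thesis by (simp add: frechet_derivative_def)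
qed

lemma frechet_derivative_eventually_cong:
  assumes "eventually (\<lambda>y. f y = g y) (nhds x)"
  shows "frechet_derivative f (at x) = frechet_derivative g (at x)"
  using assms frechet_derivative_cong unfolding eventually_nhds by metis

lemma Ck_on_cong:
  assumes "open S" "\<And>y. y \<in> S \<Longrightarrow> f y = g y"
  shows "Ck_on k S f \<longleftrightarrow> Ck_on k S g"
  using assms(2)
proof (induction k arbitrary: f g)
  case 0
  then show ?case by (simp cong: continuous_on_cong)
next
  case (Suc k)
  have "f differentiable at x \<longleftrightarrow> g differentiable at x" if "x \<in> S" for x
    unfolding differentiable_def
    using has_derivative_transform_within_open[OF _ assms(1) that] Suc.prems by metis
  moreover have "Ck_on k S (\<lambda>x. frechet_derivative f (at x) v) \<longleftrightarrow>
      Ck_on k S (\<lambda>x. frechet_derivative g (at x) v)" for v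
    using frechet_derivative_cong[OF assms(1) _ Suc.prems] by (intro Suc.IH) auto
  ultimately show ?case by auto
qed

lemma Ck_on_subset: "Ck_on k S f \<Longrightarrow> T \<subseteq> S \<Longrightarrow> Ck_on k T f"
  by (induction k arbitrary: f) (auto intro: continuous_on_subset)

lemma Ck_on_Suc_imp: "Ck_on (Suc k) S f \<Longrightarrow> Ck_on k S f"
proof (induction k arbitrary: f)
  case 0
  then show ?case
    by (auto intro!: continuous_at_imp_continuous_on differentiable_imp_continuous_within)
next
  case (Suc k)
  then show ?case by (metis Ck_on.simps(2))
qed

text \<open>\<open>Ck_on\<close> speaks only of \<open>frechet_derivative\<close>; this rule lets
  the derivative be supplied by an explicit formula on \<open>S\<close>.\<close>

lemma Ck_on_SucI:
  assumes "open S" "\<And>x. x \<in> S \<Longrightarrow> (f has_derivative f' x) (at x)"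
    and "\<And>v. Ck_on k S (\<lambda>x. f' x v)"
  shows "Ck_on (Suc k) S f"
proof -
  have "Ck_on k S (\<lambda>x. frechet_derivative f (at x) v)" for v
    using Ck_on_cong[OF assms(1), of "\<lambda>x. frechet_derivative f (at x) v" "\<lambda>x. f' x v"]
      assms(2,3) frechet_derivative_at by metis
  then show ?thesis using assms(2) by (auto simp: differentiable_def)
qed

lemma Ck_on_SucD:
  assumes "Ck_on (Suc k) S f"
  shows "x \<in> S \<Longrightarrow> (f has_derivative frechet_derivative f (at x)) (at x)"
    and "Ck_on k S (\<lambda>x. frechet_derivative f (at x) v)"
  using assms frechet_derivative_works by auto

lemma Ck_on_const: "Ck_on k S (\<lambda>x. c)"
  by (induction k arbitrary: c) auto

lemma Ck_on_bounded_linear: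
  assumes "open S" "bounded_linear f"
  shows "Ck_on k S f"
proof (cases k)
  case 0
  then show ?thesis using assms linear_continuous_on by auto
next
  case (Suc j)
  show ?thesis unfolding Suc
    by (rule Ck_on_SucI[where f' = "\<lambda>x. f"]) (auto intro: assms bounded_linear_imp_has_derivative Ck_on_const)
qed

lemma Ck_on_add: "open S \<Longrightarrow> Ck_on k S f \<Longrightarrow> Ck_on k S g \<Longrightarrow> Ck_on k S (\<lambda>x. f x + g x)"
proof (induction k arbitrary: f g)
  case 0
  then show ?case by (auto intro: continuous_on_add)
next
  case (Suc k)
  show ?case
    by (rule Ck_on_SucI[OF Suc.prems(1) has_derivative_add[OF Ck_on_SucD(1) Ck_on_SucD(1)]])
      (use Suc Ck_on_SucD in blast)+
qed

lemma Ck_on_scaleR: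
  "open S \<Longrightarrow> Ck_on k S f \<Longrightarrow> Ck_on k S g \<Longrightarrow> Ck_on k S (\<lambda>x. f x *\<^sub>R g x)"
proof (induction k arbitrary: f g)
  case 0
  then show ?case by (auto intro: continuous_on_scaleR)
next
  case (Suc k)
  show ?case
  proof (rule Ck_on_SucI[OF Suc.prems(1) has_derivative_scaleR[OF Ck_on_SucD(1) Ck_on_SucD(1)]])
    show "Ck_on k S (\<lambda>x. f x *\<^sub>R frechet_derivative g (at x) v +
         frechet_derivative f (at x) v *\<^sub>R g x)" for v
      by (intro Ck_on_add Suc.IH Suc.prems Ck_on_SucD(2)) (use Suc.prems Ck_on_Suc_imp in blast)+
  qed (use Suc.prems in auto)
qed

lemma Ck_on_mult: "open S \<Longrightarrow> Ck_on k S f \<Longrightarrow> Ck_on k S g \<Longrightarrow> Ck_on k S (\<lambda>x. f x * g x :: real)"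
  using Ck_on_scaleR[of S k f g] by simp

text \<open>The derivative of 1/f is a product of the derivative of f and two copies of 1/f itself,
  so the induction on \<open>k\<close> closes up. The square root is treated in the same
  way.\<close>

lemma Ck_on_inverse:
  fixes f :: "'a::euclidean_space \<Rightarrow> real"
  assumes "open S" "Ck_on k S f" "\<And>x. x \<in> S \<Longrightarrow> f x \<noteq> 0"
  shows "Ck_on k S (\<lambda>x. inverse (f x))"
  using assms(2)
proof (induction k)
  case 0
  then show ?case using assms by (auto intro: continuous_on_inverse)
next
  case (Suc k)
  have IH: "Ck_on k S (\<lambda>x. inverse (f x))" using Suc Ck_on_Suc_imp by blast
  show ?case
  proof (rule Ck_on_SucI[OF assms(1)])
    show "((\<lambda>x. inverse (f x)) has_derivative
        (\<lambda>v. (- 1 * frechet_derivative f (at x) v) * (inverse (f x) * inverse (f x)))) (at x)" if "x \<in> S" for x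
      using Deriv.has_derivative_inverse[OF assms(3)[OF that] Ck_on_SucD(1)[OF Suc.prems that]]
      by (simp add: algebra_simps)
    show "Ck_on k S (\<lambda>x. (- 1 * frechet_derivative f (at x) v) * (inverse (f x) * inverse (f x)))" for v
      by (intro Ck_on_mult assms(1) Ck_on_const IH Ck_on_SucD(2)[OF Suc.prems])
  qed
qed

lemma Ck_on_sqrt:
  fixes f :: "'a::euclidean_space \<Rightarrow> real"
  assumes "open S" "Ck_on k S f" "\<And>x. x \<in> S \<Longrightarrow> f x > 0"
  shows "Ck_on k S (\<lambda>x. sqrt (f x))"
  using assms(2)
proof (induction k)
  case 0
  then show ?case using assms by (auto intro: continuous_on_real_sqrt)
next
  case (Suc k)
  have IH: "Ck_on k S (\<lambda>x. sqrt (f x))" using Suc Ck_on_Suc_imp by blast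
  show ?case
  proof (rule Ck_on_SucI[OF assms(1)])
    show "((\<lambda>x. sqrt (f x)) has_derivative
        (\<lambda>v. frechet_derivative f (at x) v * (inverse (sqrt (f x)) * (1 / 2)))) (at x)" if "x \<in> S" for x
      using has_derivative_real_sqrt[OF assms(3)[OF that] Ck_on_SucD(1)[OF Suc.prems that]]
      by simp
    have ne: "sqrt (f x) \<noteq> 0" if "x \<in> S" for x using assms(3)[OF that] by simp
    show "Ck_on k S (\<lambda>x. frechet_derivative f (at x) v * (inverse (sqrt (f x)) * (1 / 2)))" for v
      by (intro Ck_on_mult assms(1) Ck_on_const Ck_on_inverse[OF _ IH] ne Ck_on_SucD(2)[OF Suc.prems])
  qed
qed

text \<open>With a constant derivative \<open>g'\<close> the chain rule produces no new factor, so
  the induction needs no product rule. The maps in question are slices such as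
  \<open>x \<mapsto> (x, x0)\<close>.\<close>

lemma Ck_on_compose_affine:
  fixes f :: "'a::euclidean_space \<Rightarrow> 'b::euclidean_space" and g :: "'c::euclidean_space \<Rightarrow> 'a"
  assumes T: "open T" "g ` T \<subseteq> S" and g: "\<And>x. x \<in> T \<Longrightarrow> (g has_derivative g') (at x)"
    and f: "Ck_on k S f"
  shows "Ck_on k T (\<lambda>x. f (g x))"
  using f
proof (induction k arbitrary: f)
  case 0
  have "continuous_on T g" using g has_derivative_continuous continuous_at_imp_continuous_on by blast
  then show ?case using 0 continuous_on_compose2[of S f T g] T by simp
next
  case (Suc k)
  show ?case
  proof (rule Ck_on_SucI[OF T(1)])
    show "((\<lambda>x. f (g x)) has_derivative (\<lambda>v. frechet_derivative f (at (g x)) (g' v))) (at x)"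
      if "x \<in> T" for x
      using has_derivative_compose[OF g[OF that] Ck_on_SucD(1)[OF Suc.prems]] that T by blast
    show "Ck_on k T (\<lambda>x. frechet_derivative f (at (g x)) (g' v))" for v
      by (rule Suc.IH[OF Ck_on_SucD(2)[OF Suc.prems]])
  qed
qed

lemma smooth_onD:
  assumes "smooth_on S f"
  shows "open S" "Ck_on k S f" "x \<in> S \<Longrightarrow> f differentiable (at x)"
  using assms unfolding smooth_on_def by (auto dest!: spec[of _ "Suc 0"])

text \<open>The product rule for a field of linear maps applied to a vector field, when the maps are
  known to be differentiable only for each fixed argument. Expanding \<open>g y\<close> in the
  standard basis reduces it to finitely many scalar products.\<close>

lemma has_derivative_linear_family:
  fixes A :: "'a::real_normed_vector \<Rightarrow> 'b::euclidean_space \<Rightarrow> 'c::real_normed_vector"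
  assumes lin: "eventually (\<lambda>y. linear (A y)) (nhds x)"
    and A: "\<And>w. ((\<lambda>y. A y w) has_derivative (\<lambda>h. A' h w)) (at x)"
    and g: "(g has_derivative g') (at x)"
  shows "((\<lambda>y. A y (g y)) has_derivative (\<lambda>h. A' h (g x) + A x (g' h))) (at x)"
proof -
  have expand: "L w = (\<Sum>b\<in>Basis. (w \<bullet> b) *\<^sub>R L b)" if "linear L" for L :: "'b \<Rightarrow> 'c" and w
    by (subst euclidean_representation[of w, symmetric])
      (simp add: linear_sum[OF that] linear_scale[OF that] del: euclidean_representation)
  have linx: "linear (A x)" using lin eventually_nhds_x_imp_x by blast
  have ev: "eventually (\<lambda>y. A y w = (\<Sum>b\<in>Basis. (w \<bullet> b) *\<^sub>R A y b)) (nhds x)" for w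
    using lin by eventually_elim (rule expand)
  \<comment> \<open>Linearity of \<open>A' h\<close> in \<open>w\<close> is not assumed; it follows
    from uniqueness of the derivative.\<close>
  have A'w: "A' h w = (\<Sum>b\<in>Basis. (w \<bullet> b) *\<^sub>R A' h b)" for h w
  proof -
    have "((\<lambda>y. \<Sum>b\<in>Basis. (w \<bullet> b) *\<^sub>R A y b) has_derivative
        (\<lambda>h. \<Sum>b\<in>Basis. (w \<bullet> b) *\<^sub>R A' h b)) (at x)"
      by (intro has_derivative_sum has_derivative_scaleR_right A)
    moreover obtain U where "open U" "x \<in> U" "\<forall>y\<in>U. A y w = (\<Sum>b\<in>Basis. (w \<bullet> b) *\<^sub>R A y b)"
      using ev unfolding eventually_nhds by blast
    ultimately have "((\<lambda>y. A y w) has_derivative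
        (\<lambda>h. \<Sum>b\<in>Basis. (w \<bullet> b) *\<^sub>R A' h b)) (at x)"
      by (elim has_derivative_transform_within_open) auto
    then show ?thesis using has_derivative_unique[OF A[of w]] by metis
  qed
  have "((\<lambda>y. \<Sum>b\<in>Basis. (g y \<bullet> b) *\<^sub>R A y b) has_derivative
      (\<lambda>h. \<Sum>b\<in>Basis. (g x \<bullet> b) *\<^sub>R A' h b + (g' h \<bullet> b) *\<^sub>R A x b)) (at x)"
    by (intro has_derivative_sum has_derivative_scaleR has_derivative_inner_left A g)
  moreover have "(\<Sum>b\<in>Basis. (g x \<bullet> b) *\<^sub>R A' h b + (g' h \<bullet> b) *\<^sub>R A x b) = A' h (g x) + A x (g' h)" for h
    unfolding sum.distrib A'w[symmetric] expand[OF linx, symmetric] ..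
  ultimately have D: "((\<lambda>y. \<Sum>b\<in>Basis. (g y \<bullet> b) *\<^sub>R A y b) has_derivative
      (\<lambda>h. A' h (g x) + A x (g' h))) (at x)" by simp
  obtain U where U: "open U" "x \<in> U" "\<forall>y\<in>U. linear (A y)"
    using lin unfolding eventually_nhds by blast
  show ?thesis
    by (rule has_derivative_transform_within_open[OF D U(1,2)]) (rule expand[symmetric], use U in blast)
qed


section \<open>Wedge products of contact type\<close>

text \<open>Forms are functions of infinite sequences, hence the second clause: entries from index
  \<open>k\<close> on must not matter.\<close>

definition multilinear :: "nat \<Rightarrow> ((nat \<Rightarrow> 'v::real_vector) \<Rightarrow> real) \<Rightarrow> bool" where
  "multilinear k \<alpha> \<longleftrightarrow> (\<forall>j<k. \<forall>v. linear (\<lambda>x. \<alpha> (v(j := x)))) \<and>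
     (\<forall>v w. (\<forall>i<k. v i = w i) \<longrightarrow> \<alpha> v = \<alpha> w)"

lemma multilinear_cong: "multilinear k \<alpha> \<Longrightarrow> (\<And>i. i < k \<Longrightarrow> v i = w i) \<Longrightarrow> \<alpha> v = \<alpha> w"
  by (simp add: multilinear_def)

text \<open>In the summand of a permutation \<sigma> the slot \<open>j\<close> is read at exactly
  one position \<open>m\<close>, which belongs either to \<alpha> or to \<beta>; the other factor is
  constant in that slot.\<close>

lemma multilinear_wedge:
  assumes \<alpha>: "multilinear k \<alpha>" and \<beta>: "multilinear l \<beta>"
  shows "multilinear (k + l) (wedge k l \<alpha> \<beta>)"
  unfolding multilinear_def
proof (intro conjI allI impI)
  fix j and v :: "nat \<Rightarrow> 'a"
  assume j: "j < k + l"
  have "linear (\<lambda>x. of_int (sign \<sigma>) * \<alpha> (\<lambda>i. (v(j := x)) (\<sigma> i)) * \<beta> (\<lambda>i. (v(j := x)) (\<sigma> (k + i))))"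
    if \<sigma>: "\<sigma> permutes {..<k + l}" for \<sigma>
  proof -
    obtain m where m: "\<sigma> m = j" using permutes_surj[OF \<sigma>] by (metis surjD)
    have mlt: "m < k + l" using m j permutes_in_image[OF \<sigma>] by (metis lessThan_iff)
    have eq: "\<sigma> i = j \<longleftrightarrow> i = m" for i using m permutes_inj[OF \<sigma>] by (metis injD)
    show ?thesis
    proof (cases "m < k")
      case True
      have 1: "(\<lambda>i. (v(j := x)) (\<sigma> i)) = (\<lambda>i. v (\<sigma> i))(m := x)" for x
        by (auto simp: eq fun_eq_iff)
      have 2: "(\<lambda>i. (v(j := x)) (\<sigma> (k + i))) = (\<lambda>i. v (\<sigma> (k + i)))" for x
        using True by (auto simp: eq fun_eq_iff)
      have "linear (\<lambda>x. \<alpha> ((\<lambda>i. v (\<sigma> i))(m := x)))" using \<alpha> True by (simp add: multilinear_def)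
      then show ?thesis unfolding 1 2
        by (auto simp: linear_iff algebra_simps)
    next
      case False
      have 1: "\<alpha> (\<lambda>i. (v(j := x)) (\<sigma> i)) = \<alpha> (\<lambda>i. v (\<sigma> i))" for x
        using False by (intro multilinear_cong[OF \<alpha>]) (auto simp: eq)
      have 2: "(\<lambda>i. (v(j := x)) (\<sigma> (k + i))) = (\<lambda>i. v (\<sigma> (k + i)))(m - k := x)" for x
        using False by (auto simp: eq fun_eq_iff)
      have "linear (\<lambda>x. \<beta> ((\<lambda>i. v (\<sigma> (k + i)))(m - k := x)))"
        using \<beta> False mlt by (simp add: multilinear_def)
      then show ?thesis unfolding 1 2
        by (auto simp: linear_iff algebra_simps)
    qed
  qed
  then have "linear (\<lambda>x. \<Sum>\<sigma> | \<sigma> permutes {..<k + l}.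
      of_int (sign \<sigma>) * \<alpha> (\<lambda>i. (v(j := x)) (\<sigma> i)) * \<beta> (\<lambda>i. (v(j := x)) (\<sigma> (k + i))))"
    by (intro linear_compose_sum) auto
  then show "linear (\<lambda>x. wedge k l \<alpha> \<beta> (v(j := x)))"
    unfolding wedge_def by (auto simp: linear_iff add_divide_distrib)
next
  fix v w :: "nat \<Rightarrow> 'a"
  assume vw: "\<forall>i<k + l. v i = w i"
  have *: "v (\<sigma> i) = w (\<sigma> i)" if "\<sigma> permutes {..<k + l}" "i < k + l" for \<sigma> i
    using that vw permutes_in_image[OF that(1), of i] by auto
  have "\<alpha> (\<lambda>i. v (\<sigma> i)) = \<alpha> (\<lambda>i. w (\<sigma> i))" "\<beta> (\<lambda>i. v (\<sigma> (k + i))) = \<beta> (\<lambda>i. w (\<sigma> (k + i)))"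
    if "\<sigma> permutes {..<k + l}" for \<sigma>
    using *[OF that] by (auto intro!: multilinear_cong[OF \<alpha>] multilinear_cong[OF \<beta>])
  then show "wedge k l \<alpha> \<beta> v = wedge k l \<alpha> \<beta> w"
    unfolding wedge_def by (intro arg_cong2[where f = "(/)"] sum.cong) auto
qed

lemma multilinear_two_form_power:
  "multilinear 2 \<omega> \<Longrightarrow> multilinear (2 * m) (two_form_power \<omega> m)"
proof (induction m)
  case 0
  then show ?case by (simp add: multilinear_def)
next
  case (Suc m)
  show ?case using multilinear_wedge[OF Suc.prems Suc.IH[OF Suc.prems]] by simp
qed

text \<open>The sum over all permutations antisymmetrizes by itself: reindexing it by composition
  with \<tau> brings out the sign.\<close>

lemma wedge_permute:
  assumes \<tau>: "\<tau> permutes {..<k + l}"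
  shows "wedge k l \<alpha> \<beta> (\<lambda>i. v (\<tau> i)) = of_int (sign \<tau>) * wedge k l \<alpha> \<beta> v"
proof -
  let ?F = "\<lambda>\<sigma>. of_int (sign \<sigma>) * \<alpha> (\<lambda>i. v (\<sigma> i)) * \<beta> (\<lambda>i. v (\<sigma> (k + i)))"
  let ?P = "{\<sigma>. \<sigma> permutes {..<k + l}}"
  have "sum ?F ?P = sum (\<lambda>\<sigma>. ?F (\<tau> \<circ> \<sigma>)) ?P"
    by (rule setum_permutations_compose_left[OF \<tau>])
  also have "\<dots> = (\<Sum>\<sigma>\<in>?P. of_int (sign \<tau>) *
      (of_int (sign \<sigma>) * \<alpha> (\<lambda>i. v (\<tau> (\<sigma> i))) * \<beta> (\<lambda>i. v (\<tau> (\<sigma> (k + i))))))"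
  proof (intro sum.cong refl)
    fix \<sigma> assume "\<sigma> \<in> ?P"
    then have "sign (\<tau> \<circ> \<sigma>) = sign \<tau> * sign \<sigma>"
      using \<tau> by (intro sign_compose permutation_permutes[THEN iffD2]) auto
    then show "?F (\<tau> \<circ> \<sigma>) = of_int (sign \<tau>) *
      (of_int (sign \<sigma>) * \<alpha> (\<lambda>i. v (\<tau> (\<sigma> i))) * \<beta> (\<lambda>i. v (\<tau> (\<sigma> (k + i)))))"
      by simp
  qed
  finally have "wedge k l \<alpha> \<beta> v = of_int (sign \<tau>) * wedge k l \<alpha> \<beta> (\<lambda>i. v (\<tau> i))"
    unfolding wedge_def by (simp add: sum_distrib_left)
  moreover have "of_int (sign \<tau>) * of_int (sign \<tau>) = (1::real)"
    by (simp add: sign_def)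
  ultimately show ?thesis by (metis mult.assoc mult_1)
qed

text \<open>Transposing the two equal arguments leaves \<open>v\<close> fixed but changes the
  sign.\<close>

lemma wedge_eq_0_if_repeated:
  assumes "i < k + l" "j < k + l" "i \<noteq> j" "v i = v j"
  shows "wedge k l \<alpha> \<beta> v = 0"
proof -
  let ?\<tau> = "Transposition.transpose i j"
  have "(\<lambda>m. v (?\<tau> m)) = v" using assms(4) by (auto simp: Transposition.transpose_def fun_eq_iff)
  moreover have "?\<tau> permutes {..<k + l}" using assms by (intro permutes_swap_id) auto
  ultimately have "wedge k l \<alpha> \<beta> v = of_int (sign ?\<tau>) * wedge k l \<alpha> \<beta> v"
    using wedge_permute[of ?\<tau> k l \<alpha> \<beta> v] by simp
  then show ?thesis using assms(3) by (simp add: sign_swap_id)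
qed

text \<open>Too many vectors in \<open>S\<close> are dependent, so one argument lies in the span of
  the others; by linearity in that slot the value is a combination of values with a repeated
  argument.\<close>

lemma wedge_eq_0_if_low_rank:
  assumes ml: "multilinear (k + l) (wedge k l \<alpha> \<beta>)"
    and dep: "\<And>i. i < k + l \<Longrightarrow> v i \<in> S" "subspace S" "dim S < k + l"
  shows "wedge k l \<alpha> \<beta> (v :: nat \<Rightarrow> 'v::euclidean_space) = 0"
proof (cases "inj_on v {..<k + l}")
  case False
  then show ?thesis using wedge_eq_0_if_repeated[of _ k l _ v] by (auto simp: inj_on_def)
next
  case True
  have "dependent (v ` {..<k + l})"
  proof (rule ccontr)
    assume "\<not> ?thesis"
    then have "card (v ` {..<k + l}) \<le> dim S" using dep by (intro independent_card_le_dim) auto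
    then show False using dep card_image[OF True] by simp
  qed
  then obtain a where a: "a \<in> v ` {..<k + l}" "a \<in> span (v ` {..<k + l} - {a})"
    unfolding dependent_def by blast
  then obtain j where j: "j < k + l" "a = v j" by auto
  have "w \<in> span (v ` {..<k + l} - {a}) \<Longrightarrow> wedge k l \<alpha> \<beta> (v(j := w)) = 0" for w
  proof (induction w rule: span_induct)
    case base
    have lin: "linear (\<lambda>x. wedge k l \<alpha> \<beta> (v(j := x)))" using ml j by (simp add: multilinear_def)
    show ?case
      using linear_subspace_kernel[OF lin] by (simp only: mem_Collect_eq)
  next
    case (step w)
    then obtain i where "i < k + l" "w = v i" "i \<noteq> j" using j by auto
    then show ?case using j by (intro wedge_eq_0_if_repeated[of j k l i]) auto
  qed
  from this[OF a(2)] j show ?thesis by simp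
qed

text \<open>The volume form is unchanged when its arguments are projected along a common null vector,
  and the projected arguments span too small a space.\<close>

lemma contact_nondegenerate:
  fixes \<omega> :: "'v::euclidean_space \<Rightarrow> 'v \<Rightarrow> real"
  assumes nz: "wedge (2 * n) 1 (two_form_power (\<lambda>v. \<omega> (v 0) (v 1)) n) (\<lambda>v. \<theta> (v 0)) v \<noteq> 0"
    and dim: "DIM('v) = 2 * n + 1" and lin\<omega>: "bilinear \<omega>" and lin\<theta>: "linear \<theta>"
  shows "\<exists>x. \<theta> x \<noteq> 0"
    and "\<omega> u = (\<lambda>x. 0) \<Longrightarrow> (\<And>x. \<omega> x u = 0) \<Longrightarrow> \<theta> u = 0 \<Longrightarrow> u = 0"
proof -
  let ?\<omega> = "\<lambda>v. \<omega> (v 0) (v 1)" and ?\<theta> = "\<lambda>v. \<theta> (v 0)"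
  let ?\<Omega> = "wedge (2 * n) 1 (two_form_power ?\<omega> n) ?\<theta>"
  show "\<exists>x. \<theta> x \<noteq> 0"
  proof (rule ccontr)
    assume "\<not> ?thesis"
    then have "\<theta> = (\<lambda>x. 0)" by auto
    then show False using nz by (simp add: wedge_def)
  qed
  have lin: "linear (\<omega> x)" "linear (\<lambda>x. \<omega> x y)" for x y
    using lin\<omega> unfolding bilinear_def by auto
  have m\<omega>: "multilinear 2 ?\<omega>"
  proof -
    have "linear (\<lambda>x. ?\<omega> (v(j := x)))" if "j < 2" for j :: nat and v
    proof -
      have "j = 0 \<or> j = 1" using that by auto
      then show ?thesis using lin(1)[of "v 0"] lin(2)[of "v 1"] by auto
    qed
    then show ?thesis by (auto simp: multilinear_def)
  qed
  have m\<theta>: "multilinear 1 ?\<theta>" using lin\<theta> by (auto simp: multilinear_def)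
  have m\<Omega>: "multilinear (2 * n + 1) ?\<Omega>"
    by (intro multilinear_wedge multilinear_two_form_power m\<omega> m\<theta>)
  assume u: "\<omega> u = (\<lambda>x. 0)" "\<And>x. \<omega> x u = 0" "\<theta> u = 0"
  show "u = 0"
  proof (rule ccontr)
    assume u0: "u \<noteq> 0"
    \<comment> \<open>An auxiliary complement of the line through \<open>u\<close>, Euclidean
      orthogonality being unrelated to \<omega> and \<theta>.\<close>
    define S where "S = {x. u \<bullet> x = 0}"
    define \<pi> where "\<pi> x = x - ((u \<bullet> x) / (u \<bullet> u)) *\<^sub>R u" for x
    have \<pi>S: "\<pi> x \<in> S" for x using u0 by (simp add: S_def \<pi>_def inner_diff_right)
    have \<pi>\<theta>: "\<theta> (\<pi> x) = \<theta> x" for x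
      by (simp add: \<pi>_def linear_diff[OF lin\<theta>] linear_scale[OF lin\<theta>] u)
    have \<pi>\<omega>: "\<omega> (\<pi> x) (\<pi> y) = \<omega> x y" for x y
      by (simp add: \<pi>_def linear_diff[OF lin(1)] linear_diff[OF lin(2)]
          linear_scale[OF lin(1)] linear_scale[OF lin(2)] u)
    have power: "two_form_power ?\<omega> m (\<lambda>i. \<pi> (w i)) = two_form_power ?\<omega> m w" for m w
    proof (induction m arbitrary: w)
      case (Suc m)
      have "two_form_power ?\<omega> m (\<lambda>i. \<pi> (w (s i))) = two_form_power ?\<omega> m (\<lambda>i. w (s i))" for s
        using Suc[of "\<lambda>i. w (s i)"] by simp
      then show ?case by (simp add: wedge_def \<pi>\<omega>)
    qed simp
    have "?\<Omega> v = ?\<Omega> (\<lambda>i. \<pi> (v i))"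
    proof -
      have "two_form_power ?\<omega> n (\<lambda>i. \<pi> (v (s i))) = two_form_power ?\<omega> n (\<lambda>i. v (s i))" for s
        using power[of n "\<lambda>i. v (s i)"] by simp
      then show ?thesis by (simp add: wedge_def \<pi>\<theta>)
    qed
    also have "\<dots> = 0"
    proof (rule wedge_eq_0_if_low_rank[OF m\<Omega>])
      show "subspace S" unfolding S_def by (rule subspace_hyperplane)
      show "dim S < 2 * n + 1" unfolding S_def using dim_hyperplane[OF u0] dim by simp
    qed (rule \<pi>S)
    finally show False using nz by simp
  qed
qed


section \<open>Local Lie groups\<close>

lemma frechet_derivative_eq: "(f has_derivative f') (at x) \<Longrightarrow> frechet_derivative f (at x) = f'"
  by (simp add: frechet_derivative_at[symmetric])

lemma differentiable_has_derivative:
  "f differentiable at x \<Longrightarrow> (f has_derivative frechet_derivative f (at x)) (at x)"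
  by (simp add: frechet_derivative_works[symmetric])

lemma eventually_nhds_compose:
  assumes "eventually P (nhds (g x))" "isCont g x"
  shows "eventually (\<lambda>y. P (g y)) (nhds x)"
  using assms eventually_compose_filterlim tendsto_at_iff_tendsto_nhds isCont_def by metis

text \<open>The multiplication of a Lie group read in a chart at the identity. It is defined for
  pairs in the open set \<open>W\<close> only, the unit sits at an arbitrary point
  \<open>x0\<close>, and associativity is required only where all four products are defined.\<close>

locale local_lie_group =
  fixes m :: "'e::euclidean_space \<times> 'e \<Rightarrow> 'e" and W :: "('e \<times> 'e) set" and x0 :: 'e
  assumes smooth: "smooth_on W m"
    and unit_in: "(x0, x0) \<in> W"
    and unit_right: "(x, x0) \<in> W \<Longrightarrow> m (x, x0) = x"
    and unit_left: "(x0, x) \<in> W \<Longrightarrow> m (x0, x) = x"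
    and assoc: "(g, x) \<in> W \<Longrightarrow> (x, y) \<in> W \<Longrightarrow> (m (g, x), y) \<in> W \<Longrightarrow> (g, m (x, y)) \<in> W \<Longrightarrow>
      m (g, m (x, y)) = m (m (g, x), y)"
begin

text \<open>\<open>X u\<close> is the left invariant field and \<open>R u\<close> the right
  invariant field with value \<open>u\<close> at the unit.\<close>

definition X :: "'e \<Rightarrow> 'e \<Rightarrow> 'e" where
  "X u x = frechet_derivative (\<lambda>y. m (x, y)) (at x0) u"

definition R :: "'e \<Rightarrow> 'e \<Rightarrow> 'e" where
  "R u x = frechet_derivative (\<lambda>y. m (y, x)) (at x0) u"

text \<open>The mixed second-order term of the multiplication at the unit; the Lie bracket is its
  antisymmetrization.\<close>

definition b :: "'e \<Rightarrow> 'e \<Rightarrow> 'e" where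
  "b u v = frechet_derivative (X v) (at x0) u"

definition bracket :: "'e \<Rightarrow> 'e \<Rightarrow> 'e" where
  "bracket u v = b u v - b v u"

abbreviation U :: "'e set" where "U \<equiv> {x. (x, x0) \<in> W}"

lemma open_W: "open W" and C: "Ck_on k W m"
  using smooth smooth_onD by blast+

lemma open_slice: "open {x. (x, y) \<in> W}" "open {x. (y, x) \<in> W}"
proof -
  have "{x. (x, y) \<in> W} = (\<lambda>x. (x, y)) -` W" "{x. (y, x) \<in> W} = (\<lambda>x. (y, x)) -` W" by auto
  moreover have "continuous_on UNIV (\<lambda>x. (x, y))" "continuous_on UNIV (\<lambda>x. (y, x))"
    by (intro continuous_intros)+
  ultimately show "open {x. (x, y) \<in> W}" "open {x. (y, x) \<in> W}"
    using open_vimage[OF open_W] by metis+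
qed

lemma m_derivative: "z \<in> W \<Longrightarrow> (m has_derivative frechet_derivative m (at z)) (at z)"
  using Ck_on_SucD(1)[OF C] by blast

lemma left_derivative:
  "(g, x) \<in> W \<Longrightarrow> ((\<lambda>y. m (g, y)) has_derivative (\<lambda>u. frechet_derivative m (at (g, x)) (0, u))) (at x)"
  by (rule has_derivative_compose[OF _ m_derivative]) (auto intro!: derivative_eq_intros)

lemma right_derivative:
  "(x, g) \<in> W \<Longrightarrow> ((\<lambda>y. m (y, g)) has_derivative (\<lambda>u. frechet_derivative m (at (x, g)) (u, 0))) (at x)"
  by (rule has_derivative_compose[OF _ m_derivative]) (auto intro!: derivative_eq_intros)

lemma X_eq: "x \<in> U \<Longrightarrow> X u x = frechet_derivative m (at (x, x0)) (0, u)"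
  unfolding X_def using frechet_derivative_eq[OF left_derivative] by simp

lemma R_eq: "(x0, x) \<in> W \<Longrightarrow> R u x = frechet_derivative m (at (x0, x)) (u, 0)"
  unfolding R_def using frechet_derivative_eq[OF right_derivative] by simp

lemma X_unit: "X u x0 = u"
proof -
  have "frechet_derivative (\<lambda>y. m (x0, y)) (at x0) = frechet_derivative (\<lambda>y. y) (at x0)"
    by (rule frechet_derivative_cong[OF open_slice(2)[of x0]]) (auto simp: unit_in unit_left)
  then show ?thesis by (simp add: X_def)
qed

lemma R_unit: "R u x0 = u"
proof -
  have "frechet_derivative (\<lambda>y. m (y, x0)) (at x0) = frechet_derivative (\<lambda>y. y) (at x0)"
    by (rule frechet_derivative_cong[OF open_slice(1)[of x0]]) (auto simp: unit_in unit_right)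
  then show ?thesis by (simp add: R_def)
qed

lemma linear_X: "x \<in> U \<Longrightarrow> linear (\<lambda>u. X u x)"
  using has_derivative_linear[OF left_derivative] by (simp add: X_eq)

lemma Ck_X: "Ck_on k U (X u)"
proof -
  have "Ck_on k U (\<lambda>x. frechet_derivative m (at (x, x0)) (0, u))"
    by (rule Ck_on_compose_affine[OF open_slice(1) _ _ Ck_on_SucD(2)[OF C], where g' = "\<lambda>h. (h, 0)"])
      (auto intro!: derivative_eq_intros)
  then show ?thesis using Ck_on_cong[OF open_slice(1), of x0 "X u"] X_eq by simp
qed

lemma Ck_translation: "Ck_on k {x. (g, x) \<in> W} (\<lambda>x. m (g, x))"
  by (rule Ck_on_compose_affine[OF open_slice(2) _ _ C, where g' = "\<lambda>h. (0, h)"])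
    (auto intro!: derivative_eq_intros)

lemma X_derivative: "x \<in> U \<Longrightarrow> (X u has_derivative frechet_derivative (X u) (at x)) (at x)"
  using Ck_on_SucD(1)[OF Ck_X] by blast

lemma X_derivative_unit: "(X v has_derivative (\<lambda>u. b u v)) (at x0)"
  using X_derivative[of x0 v] unit_in by (simp add: b_def)

lemma linear_b_left: "linear (\<lambda>u. b u v)"
  using X_derivative_unit has_derivative_linear by blast

lemma linear_b_right: "linear (b u)"
proof (rule linearI)
  have ev: "eventually (\<lambda>x. x \<in> U) (nhds x0)"
    using eventually_nhds_in_open[OF open_slice(1)[of x0]] unit_in by auto
  fix v w and c :: real
  have "eventually (\<lambda>x. X (v + w) x = X v x + X w x) (nhds x0)"
    using ev by eventually_elim (simp add: linear_add[OF linear_X])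
  then have "b u (v + w) = frechet_derivative (\<lambda>x. X v x + X w x) (at x0) u"
    unfolding b_def by (simp add: frechet_derivative_eventually_cong)
  also have "\<dots> = b u v + b u w"
    by (simp add: frechet_derivative_eq[OF has_derivative_add[OF X_derivative_unit X_derivative_unit]])
  finally show "b u (v + w) = b u v + b u w" .
  have "eventually (\<lambda>x. X (c *\<^sub>R v) x = c *\<^sub>R X v x) (nhds x0)"
    using ev by eventually_elim (simp add: linear_scale[OF linear_X])
  then have "b u (c *\<^sub>R v) = frechet_derivative (\<lambda>x. c *\<^sub>R X v x) (at x0) u"
    unfolding b_def by (simp add: frechet_derivative_eventually_cong)
  also have "\<dots> = c *\<^sub>R b u v"
    by (simp add: frechet_derivative_eq[OF has_derivative_scaleR_right[OF X_derivative_unit]])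
  finally show "b u (c *\<^sub>R v) = c *\<^sub>R b u v" .
qed

lemma bilinear_bracket: "bilinear bracket"
  unfolding bilinear_def bracket_def
  using linear_b_left linear_b_right by (auto intro!: linear_compose_sub)

lemma b_eq_mixed: "b u v = frechet_derivative (\<lambda>z. frechet_derivative m (at z) (0, v)) (at (x0, x0)) (u, 0)"
proof -
  have "((\<lambda>x. frechet_derivative m (at (x, x0)) (0, v)) has_derivative
    (\<lambda>h. frechet_derivative (\<lambda>z. frechet_derivative m (at z) (0, v)) (at (x0, x0)) (h, 0))) (at x0)"
    by (rule has_derivative_compose[where g = "\<lambda>z. frechet_derivative m (at z) (0, v)" and f = "\<lambda>x. (x, x0)" and x = x0,
          OF _ Ck_on_SucD(1)[OF Ck_on_SucD(2)[OF C] unit_in]])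
      (auto intro!: derivative_eq_intros)
  then have "(X v has_derivative
    (\<lambda>h. frechet_derivative (\<lambda>z. frechet_derivative m (at z) (0, v)) (at (x0, x0)) (h, 0))) (at x0)"
    by (rule has_derivative_transform_within_open[OF _ open_slice(1)[of x0]]) (auto simp: unit_in X_eq)
  then show ?thesis unfolding b_def by (simp add: frechet_derivative_eq)
qed

text \<open>By symmetry of second derivatives the same mixed derivative of \<open>m\<close> also
  governs the right invariant fields, with the two arguments of \<open>b\<close> exchanged in
  comparison with \<open>X\<close>.\<close>

lemma R_derivative_unit: "(R v has_derivative b v) (at x0)"
proof -
  let ?H = "frechet_derivative (\<lambda>z. frechet_derivative m (at z) (v, 0)) (at (x0, x0))"
  have "((\<lambda>x. frechet_derivative m (at (x0, x)) (v, 0)) has_derivative (\<lambda>h. ?H (0, h))) (at x0)"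
    by (rule has_derivative_compose[where g = "\<lambda>z. frechet_derivative m (at z) (v, 0)" and f = "\<lambda>x. (x0, x)" and x = x0,
          OF _ Ck_on_SucD(1)[OF Ck_on_SucD(2)[OF C] unit_in]])
      (auto intro!: derivative_eq_intros)
  moreover have "?H (0, h) = b v h" for h
    unfolding b_eq_mixed by (rule symmetric_second_derivative[OF C open_W unit_in])
  ultimately have "((\<lambda>x. frechet_derivative m (at (x0, x)) (v, 0)) has_derivative b v) (at x0)" by simp
  then show ?thesis
    by (rule has_derivative_transform_within_open[OF _ open_slice(2)[of x0]]) (auto simp: unit_in R_eq)
qed

text \<open>This is \<open>g (x y) = (g x) y\<close> differentiated in \<open>y\<close> at the unit;
  it holds near \<open>x0\<close>, where all products involved stay in \<open>W\<close>.\<close>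

lemma X_left_invariant:
  assumes g: "g \<in> U"
  shows "eventually (\<lambda>x. frechet_derivative (\<lambda>x. m (g, x)) (at x) (X u x) = X u (m (g, x))) (nhds x0)"
proof -
  have evW: "eventually (\<lambda>z. z \<in> W) (nhds z)" if "z \<in> W" for z
    using open_W that eventually_nhds_in_open by blast
  have 1: "eventually (\<lambda>x. (g, x) \<in> W) (nhds x0)" "eventually (\<lambda>x. (x, x0) \<in> W) (nhds x0)"
    using eventually_nhds_compose[OF evW, of "\<lambda>x. (g, x)" x0]
      eventually_nhds_compose[OF evW, of "\<lambda>x. (x, x0)" x0] g unit_in by auto
  have "eventually (\<lambda>x. (m (g, x), x0) \<in> W) (nhds x0)"
  proof (rule eventually_nhds_compose[where g = "\<lambda>x. (m (g, x), x0)", OF evW])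
    show "isCont (\<lambda>x. (m (g, x), x0)) x0"
      using has_derivative_continuous[OF left_derivative[of g x0]] g by (auto intro!: continuous_intros)
  qed (use g unit_right in auto)
  with 1 show ?thesis
  proof eventually_elim
    case (elim x)
    have cont: "isCont (\<lambda>y. m (x, y)) x0"
      using has_derivative_continuous[OF left_derivative] elim by blast
    have "eventually (\<lambda>y. (g, m (x, y)) \<in> W) (nhds x0)"
      by (rule eventually_nhds_compose[where g = "\<lambda>y. (g, m (x, y))", OF evW])
        (use elim cont unit_right in \<open>auto intro!: continuous_intros\<close>)
    moreover have "eventually (\<lambda>y. (x, y) \<in> W) (nhds x0)" "eventually (\<lambda>y. (m (g, x), y) \<in> W) (nhds x0)"
      using eventually_nhds_compose[OF evW, of "\<lambda>y. (x, y)" x0]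
        eventually_nhds_compose[OF evW, of "\<lambda>y. (m (g, x), y)" x0] elim by auto
    ultimately have ev: "eventually (\<lambda>y. m (g, m (x, y)) = m (m (g, x), y)) (nhds x0)"
      by eventually_elim (use assoc elim in blast)
    have "((\<lambda>y. m (g, y)) has_derivative frechet_derivative (\<lambda>y. m (g, y)) (at x)) (at (m (x, x0)))"
      using left_derivative[of g x] elim unit_right by (simp add: frechet_derivative_eq)
    from has_derivative_compose[OF left_derivative this] elim
    have "((\<lambda>y. m (g, m (x, y))) has_derivative
        (\<lambda>u. frechet_derivative (\<lambda>y. m (g, y)) (at x) (X u x))) (at x0)"
      by (simp add: X_eq)
    then have "frechet_derivative (\<lambda>y. m (g, m (x, y))) (at x0) u =
        frechet_derivative (\<lambda>y. m (g, y)) (at x) (X u x)"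
      by (simp add: frechet_derivative_eq)
    moreover have "frechet_derivative (\<lambda>y. m (g, m (x, y))) (at x0) u = X u (m (g, x))"
      unfolding X_def frechet_derivative_eventually_cong[OF ev] ..
    ultimately show ?case by simp
  qed
qed

text \<open>Differentiating left invariance of \<open>X u\<close> along \<open>w\<close> at the unit
  gives the second derivative of the translation by \<open>g\<close> plus the field with value
  \<open>b w u\<close>. The former is symmetric in \<open>u\<close> and \<open>w\<close> and cancels
  on antisymmetrizing, so the bracket of left invariant fields is left invariant.\<close>

lemma bracket_field:
  assumes g: "g \<in> U"
  shows "X (bracket w u) g =
    frechet_derivative (X u) (at g) (X w g) - frechet_derivative (X w) (at g) (X u g)"
proof -
  let ?l = "\<lambda>x. m (g, x)"
  let ?H = "\<lambda>u w. frechet_derivative (\<lambda>x. frechet_derivative ?l (at x) u) (at x0) w"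
  have x0: "x0 \<in> {x. (g, x) \<in> W}" using g by simp
  have mg: "m (g, x0) = g" using g unit_right by simp
  have lX: "frechet_derivative ?l (at x0) u = X u g" for u by (simp add: X_def)
  have *: "?H u w + X (b w u) g = frechet_derivative (X u) (at g) (X w g)" for u w
  proof -
    have "eventually (\<lambda>x. x \<in> {x. (g, x) \<in> W}) (nhds x0)"
      using open_slice(2) x0 eventually_nhds_in_open by blast
    then have lin: "eventually (\<lambda>x. linear (frechet_derivative ?l (at x))) (nhds x0)"
      by eventually_elim (use left_derivative frechet_derivative_eq has_derivative_linear in fastforce)
    have A: "((\<lambda>x. frechet_derivative ?l (at x) v) has_derivative ?H v) (at x0)" for v
      using Ck_on_SucD(1)[OF Ck_on_SucD(2)[OF Ck_translation] x0] .
    have 1: "((\<lambda>x. frechet_derivative ?l (at x) (X u x)) has_derivative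
        (\<lambda>w. ?H (X u x0) w + frechet_derivative ?l (at x0) (b w u))) (at x0)"
      by (rule has_derivative_linear_family[OF lin A X_derivative_unit])
    have 2: "((\<lambda>x. X u (m (g, x))) has_derivative
        (\<lambda>w. frechet_derivative (X u) (at g) (X w g))) (at x0)"
      using has_derivative_compose[OF left_derivative[of g x0], of "X u" "frechet_derivative (X u) (at g)"]
        X_derivative[OF g, of u] g by (simp add: X_eq mg)
    have "frechet_derivative (\<lambda>x. frechet_derivative ?l (at x) (X u x)) (at x0) w =
        frechet_derivative (\<lambda>x. X u (m (g, x))) (at x0) w"
      using frechet_derivative_eventually_cong[OF X_left_invariant[OF g]] by simp
    then show ?thesis
      unfolding frechet_derivative_eq[OF 1] frechet_derivative_eq[OF 2] by (simp add: X_unit lX)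
  qed
  have "?H u w = ?H w u"
    by (rule symmetric_second_derivative[OF Ck_translation open_slice(2) x0])
  then show ?thesis
    unfolding bracket_def linear_diff[OF linear_X[OF g]]
    using *[of u w, symmetric] *[of w u, symmetric] by simp
qed

text \<open>The formula for the bracket of fields is differentiated once more at the unit. The
  second derivatives \<open>?K\<close> of the fields are symmetric in their directions and cancel in
  the cyclic sum, as do the iterated terms in \<open>b\<close>.\<close>

lemma bracket_jacobi: "bracket z (bracket w u) + bracket w (bracket u z) + bracket u (bracket z w) = 0"
proof -
  let ?K = "\<lambda>u w z. frechet_derivative (\<lambda>x. frechet_derivative (X u) (at x) w) (at x0) z"
  have sym: "?K u w z = ?K u z w" for u w z
    by (rule symmetric_second_derivative[OF Ck_X open_slice(1)]) (simp add: unit_in)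
  have x0: "x0 \<in> U" by (simp add: unit_in)
  have ev: "eventually (\<lambda>x. x \<in> U) (nhds x0)"
    using open_slice(1) x0 eventually_nhds_in_open by blast
  have *: "((\<lambda>x. frechet_derivative (X u) (at x) (X w x)) has_derivative
      (\<lambda>z. ?K u w z + b (b z w) u)) (at x0)" for u w
  proof -
    have lin: "eventually (\<lambda>x. linear (frechet_derivative (X u) (at x))) (nhds x0)"
      using ev by eventually_elim (use X_derivative has_derivative_linear in blast)
    have A: "((\<lambda>x. frechet_derivative (X u) (at x) v) has_derivative ?K u v) (at x0)" for v
      using Ck_on_SucD(1)[OF Ck_on_SucD(2)[OF Ck_X] x0] .
    show ?thesis
      using has_derivative_linear_family[OF lin A X_derivative_unit] by (simp add: X_unit b_def)
  qed
  have **: "b z (bracket w u) = ?K u w z + b (b z w) u - (?K w u z + b (b z u) w)" for z w u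
  proof -
    have "eventually (\<lambda>g. X (bracket w u) g =
        frechet_derivative (X u) (at g) (X w g) - frechet_derivative (X w) (at g) (X u g)) (nhds x0)"
      using ev by eventually_elim (rule bracket_field)
    from frechet_derivative_eventually_cong[OF this] show ?thesis
      unfolding b_def[of z "bracket w u"] frechet_derivative_eq[OF has_derivative_diff[OF * *]]
      by simp
  qed
  have b_diff: "b (v - w) z = b v z - b w z" for v w z
    using linear_diff[OF linear_b_left] .
  have expand: "bracket z (bracket w u) = ?K u w z + b (b z w) u - (?K w u z + b (b z u) w)
      - (b (b w u) z - b (b u w) z)" for z w u
    unfolding bracket_def[of z "bracket w u"] ** by (simp add: bracket_def b_diff)
  show ?thesis
    unfolding expand using sym[of u w z] sym[of w u z] sym[of z u w] by (simp add: algebra_simps)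
qed

text \<open>The Maurer-Cartan formula. An invariant form is constant on invariant fields, so
  differentiating \<open>\<theta> x (X u x)\<close> expresses the derivative of \<theta> through
  \<open>b\<close>, and antisymmetrizing turns \<open>b\<close> into the bracket.\<close>

lemma invariant_form_derivative:
  assumes lin: "eventually (\<lambda>x. linear (\<theta> x)) (nhds x0)"
    and d: "\<And>w. ((\<lambda>x. \<theta> x w) has_derivative (\<lambda>h. \<theta>' h w)) (at x0)"
    and inv: "\<And>u. eventually (\<lambda>x. \<theta> x (X u x) = \<theta> x0 u) (nhds x0)"
  shows "\<theta>' u v - \<theta>' v u = - (\<theta> x0 (bracket u v) :: real)"
proof -
  have "\<theta>' h u + \<theta> x0 (b h u) = 0" for h u
  proof -
    have "((\<lambda>x. \<theta> x (X u x)) has_derivative (\<lambda>h. \<theta>' h (X u x0) + \<theta> x0 (b h u))) (at x0)"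
      by (rule has_derivative_linear_family[OF lin d X_derivative_unit])
    from frechet_derivative_eq[OF this] show ?thesis
      using frechet_derivative_eventually_cong[OF inv[of u]] by (simp add: X_unit fun_eq_iff)
  qed
  from this[of u v] this[of v u] show ?thesis
    using linear_diff[OF eventually_nhds_x_imp_x[OF lin]] by (simp add: bracket_def)
qed

text \<open>The derivatives at the unit of the left and right invariant fields are \<open>b h u\<close> and \<open>b u h\<close>,
  so the derivative of \<open>\<beta>\<close> cancels when the two invariance identities are subtracted.\<close>

lemma invariant_metric_ad:
  assumes bil: "eventually (\<lambda>x. bilinear (\<beta> x)) (nhds x0)"
    and d: "\<And>v w. ((\<lambda>x. \<beta> x v w) has_derivative (\<lambda>h. \<beta>' h v w)) (at x0)"
    and invL: "\<And>u v. eventually (\<lambda>x. \<beta> x (X u x) (X v x) = \<beta> x0 u v) (nhds x0)"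
    and invR: "\<And>u v. eventually (\<lambda>x. \<beta> x (R u x) (R v x) = \<beta> x0 u v) (nhds x0)"
  shows "\<beta> x0 (bracket h u) v + \<beta> x0 u (bracket h v) = (0 :: real)"
proof -
  have lin1: "eventually (\<lambda>x. linear (\<lambda>w. \<beta> x w (g x))) (nhds x0)" for g
    using bil by eventually_elim (simp add: bilinear_def)
  have lin2: "eventually (\<lambda>x. linear (\<beta> x w)) (nhds x0)" for w
    using bil by eventually_elim (simp add: bilinear_def)
  have *: "((\<lambda>x. \<beta> x (f x) (g x)) has_derivative
      (\<lambda>h. \<beta>' h (f x0) (g x0) + \<beta> x0 (f x0) (g' h) + \<beta> x0 (f' h) (g x0))) (at x0)"
    if f: "(f has_derivative f') (at x0)" and g: "(g has_derivative g') (at x0)" for f g f' g'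
    by (rule has_derivative_linear_family[OF lin1
          has_derivative_linear_family[OF lin2 d g] f])
  have "\<beta>' h u v + \<beta> x0 u (b h v) + \<beta> x0 (b h u) v = 0"
    using frechet_derivative_eventually_cong[OF invL[of u v]]
    unfolding frechet_derivative_eq[OF *[OF X_derivative_unit X_derivative_unit]]
    by (simp add: X_unit fun_eq_iff)
  moreover have "\<beta>' h u v + \<beta> x0 u (b v h) + \<beta> x0 (b u h) v = 0"
    using frechet_derivative_eventually_cong[OF invR[of u v]]
    unfolding frechet_derivative_eq[OF *[OF R_derivative_unit R_derivative_unit]]
    by (simp add: R_unit fun_eq_iff)
  moreover have "bilinear (\<beta> x0)" using bil eventually_nhds_x_imp_x by blast
  ultimately show ?thesis
    by (simp add: bracket_def bilinear_lsub bilinear_rsub)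
qed

end


section \<open>Lie groups in the chart at the identity\<close>

lemma chart_inv_left: "inj_on (snd c) (fst c) \<Longrightarrow> p \<in> fst c \<Longrightarrow> chart_inv c (snd c p) = p"
  by (simp add: chart_inv_def)

lemma chart_inv_right:
  assumes "x \<in> chart_image c"
  shows "snd c (chart_inv c x) = x" "chart_inv c x \<in> fst c"
  using assms unfolding chart_inv_def chart_image_def by (auto intro: f_inv_into_f inv_into_into)

lemma chart_imageI: "p \<in> fst c \<Longrightarrow> snd c p \<in> chart_image c"
  by (simp add: chart_image_def)

text \<open>Tangent vectors are stored in the preferred chart of their base point, so every passage
  to the chart at the identity is an instance of this chain rule.\<close>

lemma frechet_derivative_coordinate_change:
  assumes inj: "inj_on (snd d) (fst d)" and ev: "eventually (\<lambda>y. f y \<in> fst d) (nhds x)"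
    and f: "(\<lambda>y. snd d (f y)) differentiable at x"
    and t: "(snd c \<circ> chart_inv d) differentiable at (snd d (f x))"
  shows "frechet_derivative (snd c \<circ> chart_inv d) (at (snd d (f x)))
      (frechet_derivative (\<lambda>y. snd d (f y)) (at x) u) = frechet_derivative (\<lambda>y. snd c (f y)) (at x) u"
proof -
  let ?g = "\<lambda>y. (snd c \<circ> chart_inv d) (snd d (f y))"
  have 1: "(?g has_derivative (\<lambda>u. frechet_derivative (snd c \<circ> chart_inv d) (at (snd d (f x)))
      (frechet_derivative (\<lambda>y. snd d (f y)) (at x) u))) (at x)"
    using has_derivative_compose[OF differentiable_has_derivative[OF f] differentiable_has_derivative[OF t]] .
  have 2: "eventually (\<lambda>y. ?g y = snd c (f y)) (nhds x)"
    using ev by eventually_elim (simp add: chart_inv_left[OF inj])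
  show ?thesis
    unfolding frechet_derivative_eventually_cong[OF 2, symmetric] frechet_derivative_eq[OF 1] ..
qed

text \<open>Only local differentiability is assumed, since the formula serves abstract Lie groups as
  well as the matrix groups, whose bracket is computed without going through
  \<open>lie_group\<close>.\<close>

lemma vf_in_chart_left_invariant_field:
  fixes G (structure) and M :: "('a, 'e::euclidean_space) manifold"
  defines "c \<equiv> chart_at M \<one>" and "x0 \<equiv> snd (chart_at M \<one>) \<one>"
  assumes p: "p = chart_inv c x" "chart_inv c x0 = \<one>" "p \<otimes> \<one> = p"
    and inj: "inj_on (snd (chart_at M p)) (fst (chart_at M p))"
    and ev: "eventually (\<lambda>y. p \<otimes> chart_inv c y \<in> fst (chart_at M p)) (nhds x0)"
    and d: "(\<lambda>y. snd (chart_at M p) (p \<otimes> chart_inv c y)) differentiable at x0"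
    and t: "(snd c \<circ> chart_inv (chart_at M p)) differentiable at (snd (chart_at M p) p)"
  shows "vf_in_chart M c (left_invariant_field G M u) x =
    frechet_derivative (\<lambda>y. snd c (chart_inv c x \<otimes> chart_inv c y)) (at x0) u"
proof -
  have "vf_in_chart M c (left_invariant_field G M u) x =
      frechet_derivative (snd c \<circ> chart_inv (chart_at M p)) (at (snd (chart_at M p) p))
        (frechet_derivative (\<lambda>y. snd (chart_at M p) (p \<otimes> chart_inv c y)) (at x0) u)"
    unfolding vf_in_chart_def to_chart_def left_invariant_field_def tangent_map_def
    using p by (simp add: c_def x0_def o_def)
  then show ?thesis
    using frechet_derivative_coordinate_change[OF inj ev d, of c u] t p by simp
qed

lemma lie_bracket_eq:
  fixes G (structure) and M :: "('a, 'e::euclidean_space) manifold"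
  defines "c \<equiv> chart_at M \<one>" and "x0 \<equiv> snd (chart_at M \<one>) \<one>"
  assumes ev: "\<And>u. eventually (\<lambda>x. vf_in_chart M c (left_invariant_field G M u) x = X u x) (nhds x0)"
    and unit: "\<And>u. X u x0 = u"
  shows "lie_bracket G M u v =
    frechet_derivative (X v) (at x0) u - frechet_derivative (X u) (at x0) v"
proof -
  have "vf_in_chart M c (left_invariant_field G M u) x0 = u" for u
    using eventually_nhds_x_imp_x[OF ev] unit by simp
  then show ?thesis
    using frechet_derivative_eventually_cong[OF ev]
    by (simp add: lie_bracket_def vf_bracket_def Let_def c_def x0_def)
qed

section \<open>The abstract Lie group as a local Lie group in its chart at the identity\<close>

locale smooth_lie_group =
  fixes G (structure) and M :: "('a, 'e::euclidean_space) manifold"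
  assumes lie_group: "lie_group G M"
begin

lemma group: "group G" and manifold: "smooth_manifold M" and carrier: "carrier G = topspace (mtop M)"
  and smooth_mult: "smooth_map (prod_manifold M M) M (\<lambda>(x, y). x \<otimes> y)"
  using lie_group by (auto simp: lie_group_def)

sublocale group G by (rule group)

lemma chart_subset: "c \<in> atlas M \<Longrightarrow> fst c \<subseteq> carrier G"
  using manifold by (auto simp: smooth_manifold_def carrier)

lemma inj_chart: "c \<in> atlas M \<Longrightarrow> inj_on (snd c) (fst c)"
proof -
  assume c: "c \<in> atlas M"
  then have "fst c \<subseteq> topspace (mtop M)" using chart_subset carrier by simp
  moreover have "homeomorphic_map (subtopology (mtop M) (fst c)) (top_of_set (chart_image c)) (snd c)"
    using manifold c by (simp add: smooth_manifold_def)
  ultimately show ?thesis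
    using homeomorphic_imp_injective_map by (metis topspace_subtopology_subset)
qed

lemma open_chart_image: "c \<in> atlas M \<Longrightarrow> open (chart_image c)"
  using manifold by (auto simp: smooth_manifold_def)

lemma chart_at: "p \<in> carrier G \<Longrightarrow> chart_at M p \<in> atlas M" "p \<in> carrier G \<Longrightarrow> p \<in> fst (chart_at M p)"
proof -
  assume "p \<in> carrier G"
  then have "p \<in> (\<Union>c\<in>atlas M. fst c)"
    using manifold by (simp add: smooth_manifold_def carrier)
  then have "\<exists>c. c \<in> atlas M \<and> p \<in> fst c" by blast
  then show "chart_at M p \<in> atlas M" "p \<in> fst (chart_at M p)"
    unfolding chart_at_def by (metis (mono_tags, lifting) someI_ex)+
qed

lemma transition_differentiable:
  "c \<in> atlas M \<Longrightarrow> d \<in> atlas M \<Longrightarrow> p \<in> fst c \<Longrightarrow> p \<in> fst d \<Longrightarrow>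
    (snd d \<circ> chart_inv c) differentiable at (snd c p)"
  using manifold smooth_onD(3) unfolding smooth_manifold_def by blast

definition mult_domain :: "('a, 'e) chart \<Rightarrow> ('a, 'e) chart \<Rightarrow> ('a, 'e) chart \<Rightarrow> ('e \<times> 'e) set" where
  "mult_domain c d e =
    {(x, y). x \<in> chart_image c \<and> y \<in> chart_image d \<and> chart_inv c x \<otimes> chart_inv d y \<in> fst e}"

definition coord_mult :: "('a, 'e) chart \<Rightarrow> ('a, 'e) chart \<Rightarrow> ('a, 'e) chart \<Rightarrow> 'e \<times> 'e \<Rightarrow> 'e" where
  "coord_mult c d e = (\<lambda>(x, y). snd e (chart_inv c x \<otimes> chart_inv d y))"

text \<open>Smoothness of the multiplication is given in product charts, whose
  \<open>chart_inv\<close> is a choice of preimages; on the image of the chart it agrees with the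
  pair of the two inverses.\<close>

lemma smooth_coord_mult:
  assumes c: "c \<in> atlas M" and d: "d \<in> atlas M" and e: "e \<in> atlas M"
  shows "smooth_on (mult_domain c d e) (coord_mult c d e)"
proof -
  let ?cd = "(fst c \<times> fst d, map_prod (snd c) (snd d))"
  let ?S = "snd ?cd ` (fst ?cd \<inter> (\<lambda>(x, y). x \<otimes> y) -` fst e)"
  have "?cd \<in> atlas (prod_manifold M M)" unfolding prod_manifold_def manifold.simps mem_Collect_eq by (intro exI[of _ c] exI[of _ d] conjI refl c d)
  then have sm: "smooth_on ?S (snd e \<circ> (\<lambda>(x, y). x \<otimes> y) \<circ> chart_inv ?cd)"
    using smooth_mult e unfolding smooth_map_def by blast
  have S: "?S = mult_domain c d e"
  proof (intro equalityI subsetI)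
    fix z assume "z \<in> ?S"
    then show "z \<in> mult_domain c d e"
      using inj_chart c d by (auto simp: mult_domain_def chart_inv_left chart_imageI)
  next
    fix z assume "z \<in> mult_domain c d e"
    then obtain x y where z: "z = (x, y)" "x \<in> chart_image c" "y \<in> chart_image d"
      "chart_inv c x \<otimes> chart_inv d y \<in> fst e" by (auto simp: mult_domain_def)
    then show "z \<in> ?S"
      using chart_inv_right[of x c] chart_inv_right[of y d]
      by (intro image_eqI[of _ _ "(chart_inv c x, chart_inv d y)"]) auto
  qed
  have inj: "inj_on (snd ?cd) (fst ?cd)" using inj_chart c d by (auto intro: map_prod_inj_on)
  have eq: "(snd e \<circ> (\<lambda>(x, y). x \<otimes> y) \<circ> chart_inv ?cd) z = coord_mult c d e z"
    if "z \<in> mult_domain c d e" for z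
  proof -
    obtain x y where z: "z = (x, y)" "x \<in> chart_image c" "y \<in> chart_image d"
      using \<open>z \<in> mult_domain c d e\<close> by (auto simp: mult_domain_def)
    have "chart_inv ?cd z = (chart_inv c x, chart_inv d y)"
      using chart_inv_left[OF inj, of "(chart_inv c x, chart_inv d y)"]
        chart_inv_right[OF z(2)] chart_inv_right[OF z(3)] z by simp
    then show ?thesis by (simp add: coord_mult_def z)
  qed
  note sm' = sm[unfolded S]
  have "Ck_on k (mult_domain c d e) (coord_mult c d e)" for k
    by (rule iffD1[OF Ck_on_cong[OF smooth_onD(1)[OF sm'] eq] smooth_onD(2)[OF sm']])
  then show ?thesis using smooth_onD(1)[OF sm'] by (simp add: smooth_on_def)
qed

definition c0 :: "('a, 'e) chart" where "c0 = chart_at M \<one>"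
definition x0 :: 'e where "x0 = snd c0 \<one>"

lemma c0: "c0 \<in> atlas M" "\<one> \<in> fst c0"
  using chart_at[OF one_closed] by (auto simp: c0_def)

lemma x0: "x0 \<in> chart_image c0" "chart_inv c0 x0 = \<one>"
  using c0 inj_chart by (auto simp: x0_def chart_imageI chart_inv_left)

lemma chart_inv_carrier: "c \<in> atlas M \<Longrightarrow> x \<in> chart_image c \<Longrightarrow> chart_inv c x \<in> carrier G"
  using chart_inv_right(2)[of x c] chart_subset[of c] by auto

sublocale local_lie_group "coord_mult c0 c0 c0" "mult_domain c0 c0 c0" x0
proof
  show "smooth_on (mult_domain c0 c0 c0) (coord_mult c0 c0 c0)"
    using smooth_coord_mult c0 by blast
  show "(x0, x0) \<in> mult_domain c0 c0 c0"
    by (simp add: mult_domain_def x0 c0)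
  show "coord_mult c0 c0 c0 (x, x0) = x" if "(x, x0) \<in> mult_domain c0 c0 c0" for x
    using that chart_inv_carrier[OF c0(1)] by (simp add: mult_domain_def coord_mult_def x0 chart_inv_right)
  show "coord_mult c0 c0 c0 (x0, x) = x" if "(x0, x) \<in> mult_domain c0 c0 c0" for x
    using that chart_inv_carrier[OF c0(1)] by (simp add: mult_domain_def coord_mult_def x0 chart_inv_right)
  show "coord_mult c0 c0 c0 (g, coord_mult c0 c0 c0 (x, y)) = coord_mult c0 c0 c0 (coord_mult c0 c0 c0 (g, x), y)"
    if "(g, x) \<in> mult_domain c0 c0 c0" "(x, y) \<in> mult_domain c0 c0 c0" for g x y
  proof -
    let ?\<psi> = "chart_inv c0"
    have gx: "?\<psi> (snd c0 (?\<psi> g \<otimes> ?\<psi> x)) = ?\<psi> g \<otimes> ?\<psi> x"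
      and xy: "?\<psi> (snd c0 (?\<psi> x \<otimes> ?\<psi> y)) = ?\<psi> x \<otimes> ?\<psi> y"
      using that by (auto simp: mult_domain_def intro!: chart_inv_left[OF inj_chart[OF c0(1)]])
    have "?\<psi> g \<in> carrier G" "?\<psi> x \<in> carrier G" "?\<psi> y \<in> carrier G"
      using that chart_inv_carrier[OF c0(1)] by (auto simp: mult_domain_def)
    then show ?thesis unfolding coord_mult_def prod.case gx xy by (simp only: m_assoc)
  qed
qed

text \<open>The fixed factor is read in its own preferred chart and the moving one in
  \<open>c0\<close>. The chart \<open>e\<close> for the product is left free because it is later
  taken to be the preferred chart at \<open>p\<close> as well as \<open>c0\<close>.\<close>

lemma translation:
  assumes p: "p \<in> carrier G" and e: "e \<in> atlas M" "p \<in> fst e"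
  shows "eventually (\<lambda>y. p \<otimes> chart_inv c0 y \<in> fst e) (nhds x0)"
    and "(\<lambda>y. snd e (p \<otimes> chart_inv c0 y)) differentiable at x0"
    and "eventually (\<lambda>y. chart_inv c0 y \<otimes> p \<in> fst e) (nhds x0)"
    and "(\<lambda>y. snd e (chart_inv c0 y \<otimes> p)) differentiable at x0"
proof -
  let ?c = "chart_at M p" let ?x = "snd ?c p"
  have c: "?c \<in> atlas M" "p \<in> fst ?c" using chart_at p by auto
  have cx: "chart_inv ?c ?x = p" using chart_inv_left[OF inj_chart] c by simp
  have in1: "(?x, x0) \<in> mult_domain ?c c0 e"
    using p e c by (simp add: mult_domain_def x0 cx chart_imageI)
  have in2: "(x0, ?x) \<in> mult_domain c0 ?c e"
    using p e c by (simp add: mult_domain_def x0 cx chart_imageI)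
  note sm1 = smooth_coord_mult[OF c(1) c0(1) e(1)] and sm2 = smooth_coord_mult[OF c0(1) c(1) e(1)]
  have "eventually (\<lambda>z. z \<in> mult_domain ?c c0 e) (nhds (?x, x0))"
    using eventually_nhds_in_open[OF smooth_onD(1)[OF sm1] in1] .
  then have ev1: "eventually (\<lambda>y. (?x, y) \<in> mult_domain ?c c0 e) (nhds x0)"
    by (rule eventually_nhds_compose) (intro continuous_intros)
  have "eventually (\<lambda>z. z \<in> mult_domain c0 ?c e) (nhds (x0, ?x))"
    using eventually_nhds_in_open[OF smooth_onD(1)[OF sm2] in2] .
  then have ev2: "eventually (\<lambda>y. (y, ?x) \<in> mult_domain c0 ?c e) (nhds x0)"
    by (rule eventually_nhds_compose[where g = "\<lambda>y. (y, ?x)"]) (intro continuous_intros)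
  show "eventually (\<lambda>y. p \<otimes> chart_inv c0 y \<in> fst e) (nhds x0)"
    using ev1 by eventually_elim (simp add: mult_domain_def cx)
  show "eventually (\<lambda>y. chart_inv c0 y \<otimes> p \<in> fst e) (nhds x0)"
    using ev2 by eventually_elim (simp add: mult_domain_def cx)
  have "((\<lambda>y. (?x, y)) has_derivative (\<lambda>h. (0, h))) (at x0)"
    by (auto intro!: derivative_eq_intros)
  from has_derivative_compose[OF this differentiable_has_derivative[OF smooth_onD(3)[OF sm1 in1]]]
  show "(\<lambda>y. snd e (p \<otimes> chart_inv c0 y)) differentiable at x0"
    by (auto simp: coord_mult_def cx differentiable_def)
  have "((\<lambda>y. (y, ?x)) has_derivative (\<lambda>h. (h, 0))) (at x0)"
    by (auto intro!: derivative_eq_intros)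
  from has_derivative_compose[OF this differentiable_has_derivative[OF smooth_onD(3)[OF sm2 in2]]]
  show "(\<lambda>y. snd e (chart_inv c0 y \<otimes> p)) differentiable at x0"
    by (auto simp: coord_mult_def cx differentiable_def)
qed

lemma eventually_chart_image: "eventually (\<lambda>x. x \<in> chart_image c0) (nhds x0)"
  using eventually_nhds_in_open[OF open_chart_image[OF c0(1)] x0(1)] .

lemma X_coord: "X u x = frechet_derivative (\<lambda>y. snd c0 (chart_inv c0 x \<otimes> chart_inv c0 y)) (at x0) u"
  and R_coord: "R u x = frechet_derivative (\<lambda>y. snd c0 (chart_inv c0 y \<otimes> chart_inv c0 x)) (at x0) u"
  unfolding X_def R_def by (simp_all add: coord_mult_def)

lemma lie_bracket_eq_bracket: "lie_bracket G M = bracket"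
proof -
  have "eventually (\<lambda>x. vf_in_chart M c0 (left_invariant_field G M u) x = X u x) (nhds x0)" for u
    using eventually_chart_image
  proof eventually_elim
    case (elim x)
    let ?p = "chart_inv c0 x" let ?d = "chart_at M ?p"
    have p: "?p \<in> carrier G" using chart_inv_carrier[OF c0(1) elim] .
    have d: "?d \<in> atlas M" "?p \<in> fst ?d" using chart_at[OF p] by auto
    show ?case
      using vf_in_chart_left_invariant_field[of ?p M G x u] x0 p d inj_chart[OF d(1)]
        translation[OF p d] transition_differentiable[OF d(1) c0(1) d(2)] chart_inv_right[OF elim]
      by (simp add: c0_def[symmetric] x0_def[symmetric] X_coord)
  qed
  then show ?thesis
    using lie_bracket_eq[of M G X] X_unit
    by (auto simp: c0_def[symmetric] x0_def[symmetric] bracket_def b_def fun_eq_iff)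
qed

text \<open>The link between the coordinate fields \<open>X\<close> and \<open>R\<close> and the
  tangent maps in which invariance of forms and metrics is phrased.\<close>

lemma from_chart_c0:
  assumes x: "x \<in> chart_image c0"
  shows "linear (from_chart M c0 x)"
    and "from_chart M c0 x (X u x) =
      tangent_map M M (\<lambda>y. chart_inv c0 x \<otimes> y) \<one> u"
    and "from_chart M c0 x (R u x) =
      tangent_map M M (\<lambda>y. y \<otimes> chart_inv c0 x) \<one> u"
proof -
  let ?p = "chart_inv c0 x" let ?d = "chart_at M ?p"
  have p: "?p \<in> carrier G" using chart_inv_carrier[OF c0(1) x] .
  have d: "?d \<in> atlas M" "?p \<in> fst ?d" using chart_at[OF p] by auto
  have pc: "?p \<in> fst c0" "snd c0 ?p = x" using chart_inv_right[OF x] by auto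
  have t: "(snd ?d \<circ> chart_inv c0) differentiable at x"
    using transition_differentiable[OF c0(1) d(1) pc(1) d(2)] pc(2) by simp
  show "linear (from_chart M c0 x)"
    unfolding from_chart_def using linear_frechet_derivative[OF t] by simp
  note tr = translation[OF p c0(1) pc(1)]
  show "from_chart M c0 x (X u x) = tangent_map M M (\<lambda>y. ?p \<otimes> y) \<one> u"
    using frechet_derivative_coordinate_change[OF inj_chart[OF c0(1)] tr(1,2), of ?d u] t p
    by (simp add: tangent_map_def from_chart_def X_coord x0 pc
        c0_def[symmetric] x0_def[symmetric] o_def)
  show "from_chart M c0 x (R u x) = tangent_map M M (\<lambda>y. y \<otimes> ?p) \<one> u"
    using frechet_derivative_coordinate_change[OF inj_chart[OF c0(1)] tr(3,4), of ?d u] t p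
    by (simp add: tangent_map_def from_chart_def R_coord x0 pc
        c0_def[symmetric] x0_def[symmetric] o_def)
qed

lemma from_chart_x0: "from_chart M c0 x0 u = u"
proof -
  have "eventually (\<lambda>x. (snd c0 \<circ> chart_inv c0) x = x) (nhds x0)"
    using eventually_chart_image by eventually_elim (simp add: chart_inv_right)
  from frechet_derivative_eventually_cong[OF this] show ?thesis
    by (simp add: from_chart_def x0 c0_def[symmetric] o_def)
qed

lemma ext_deriv_one:
  assumes \<eta>: "one_form M \<eta>" "left_invariant_form G M \<eta>"
  shows "ext_deriv M \<eta> \<one> u v = - \<eta> \<one> (lie_bracket G M u v)"
proof -
  define \<theta> where "\<theta> x w = \<eta> (chart_inv c0 x) (from_chart M c0 x w)" for x w
  have \<theta>x0: "\<theta> x0 w = \<eta> \<one> w" for w by (simp add: \<theta>_def from_chart_x0 x0)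
  have lin: "eventually (\<lambda>x. linear (\<theta> x)) (nhds x0)"
    using eventually_chart_image
  proof eventually_elim
    case (elim x)
    have "linear (\<eta> (chart_inv c0 x))"
      using \<eta>(1) chart_inv_carrier[OF c0(1) elim] by (simp add: one_form_def carrier)
    from linear_compose[OF from_chart_c0(1)[OF elim] this] show ?case by (simp add: \<theta>_def[abs_def] o_def)
  qed
  have d: "((\<lambda>x. \<theta> x w) has_derivative (\<lambda>h. frechet_derivative (\<lambda>x. \<theta> x w) (at x0) h)) (at x0)" for w
  proof -
    have "smooth_on (chart_image c0) (\<lambda>x. \<theta> x w)"
      using \<eta>(1) c0 by (simp add: one_form_def \<theta>_def)
    from smooth_onD(3)[OF this x0(1)] show ?thesis by (rule differentiable_has_derivative)
  qed
  have inv: "eventually (\<lambda>x. \<theta> x (X u x) = \<theta> x0 u) (nhds x0)" for u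
    using eventually_chart_image
  proof eventually_elim
    case (elim x)
    have "chart_inv c0 x \<in> carrier G" using chart_inv_carrier[OF c0(1) elim] .
    moreover from this have "\<eta> (chart_inv c0 x \<otimes> \<one>) (tangent_map M M (\<lambda>y. chart_inv c0 x \<otimes> y) \<one> u) = \<eta> \<one> u"
      using \<eta>(2) unfolding left_invariant_form_def by blast
    ultimately show ?case by (simp add: \<theta>_def from_chart_c0(2)[OF elim] from_chart_x0 x0)
  qed
  have "ext_deriv M \<eta> \<one> u v =
      frechet_derivative (\<lambda>x. \<theta> x v) (at x0) u - frechet_derivative (\<lambda>x. \<theta> x u) (at x0) v"
    by (simp add: ext_deriv_def Let_def \<theta>_def c0_def[symmetric] x0_def[symmetric])
  also have "\<dots> = - \<theta> x0 (bracket u v)"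
    by (rule invariant_form_derivative[OF lin d inv])
  finally show ?thesis by (simp add: lie_bracket_eq_bracket \<theta>x0)
qed

lemma bi_invariant_metric_ad:
  assumes B: "bi_invariant_metric G M B"
  shows "B \<one> (lie_bracket G M h u) v + B \<one> u (lie_bracket G M h v) = 0"
proof -
  define \<beta> where "\<beta> x u v = B (chart_inv c0 x) (from_chart M c0 x u) (from_chart M c0 x v)" for x u v
  have Bm: "pseudo_riemannian_metric M B" using B by (simp add: bi_invariant_metric_def)
  have \<beta>x0: "\<beta> x0 u v = B \<one> u v" for u v by (simp add: \<beta>_def from_chart_x0 x0)
  have bil: "eventually (\<lambda>x. bilinear (\<beta> x)) (nhds x0)"
    using eventually_chart_image
  proof eventually_elim
    case (elim x)
    have "bilinear (B (chart_inv c0 x))"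
      using Bm chart_inv_carrier[OF c0(1) elim] by (simp add: pseudo_riemannian_metric_def carrier)
    moreover have "bilinear (\<lambda>u v. f (L u) (L v))" if "bilinear f" "linear L"
      for f :: "'e \<Rightarrow> 'e \<Rightarrow> real" and L
      using that linear_compose[of L] unfolding bilinear_def by (auto simp: linear_iff)
    ultimately show ?case using from_chart_c0(1)[OF elim] by (simp add: \<beta>_def[abs_def])
  qed
  have d: "((\<lambda>x. \<beta> x v w) has_derivative (\<lambda>h. frechet_derivative (\<lambda>x. \<beta> x v w) (at x0) h)) (at x0)" for v w
  proof -
    have "smooth_on (chart_image c0) (\<lambda>x. \<beta> x v w)"
      using Bm c0 by (simp add: pseudo_riemannian_metric_def \<beta>_def)
    from smooth_onD(3)[OF this x0(1)] show ?thesis by (rule differentiable_has_derivative)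
  qed
  have inv: "\<beta> x (X u x) (X v x) = \<beta> x0 u v" "\<beta> x (R u x) (R v x) = \<beta> x0 u v"
    if x: "x \<in> chart_image c0" for x u v
  proof -
    let ?p = "chart_inv c0 x"
    have p: "?p \<in> carrier G" using chart_inv_carrier[OF c0(1) x] .
    then have "B (?p \<otimes> \<one>) (tangent_map M M (\<lambda>y. ?p \<otimes> y) \<one> u) (tangent_map M M (\<lambda>y. ?p \<otimes> y) \<one> v) = B \<one> u v"
      "B (\<one> \<otimes> ?p) (tangent_map M M (\<lambda>y. y \<otimes> ?p) \<one> u) (tangent_map M M (\<lambda>y. y \<otimes> ?p) \<one> v) = B \<one> u v"
      using B unfolding bi_invariant_metric_def by blast+
    then show "\<beta> x (X u x) (X v x) = \<beta> x0 u v" "\<beta> x (R u x) (R v x) = \<beta> x0 u v"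
      using p by (simp_all add: \<beta>_def from_chart_c0(2,3)[OF x] from_chart_x0 x0)
  qed
  have "\<beta> x0 (bracket h u) v + \<beta> x0 u (bracket h v) = 0"
    by (rule invariant_metric_ad[OF bil d])
      (use eventually_chart_image in \<open>eventually_elim; simp add: inv\<close>)+
  then show ?thesis by (simp add: lie_bracket_eq_bracket \<beta>x0)
qed

text \<open>\<open>\<xi>\<close> is the vector dual to the contact form with respect to the metric.\<close>

lemma contact_vector:
  assumes B: "bi_invariant_metric G M B"
    and \<eta>: "contact_form M n \<eta>" "left_invariant_form G M \<eta>"
  obtains \<xi> where "B \<one> \<xi> \<xi> \<noteq> 0"
    and "\<And>x. lie_bracket G M \<xi> x = 0 \<Longrightarrow> \<exists>c. x = c *\<^sub>R \<xi>"
proof -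
  let ?br = "lie_bracket G M" and ?B = "B \<one>" and ?\<eta> = "\<eta> \<one>"
  have one: "\<one> \<in> topspace (mtop M)" using one_closed carrier by simp
  have bil: "bilinear ?B" and sym: "\<And>u v. ?B u v = ?B v u"
    and nondeg: "\<And>u. (\<And>v. ?B u v = 0) \<Longrightarrow> u = 0"
    using B one by (auto simp: bi_invariant_metric_def pseudo_riemannian_metric_def)
  have of\<eta>: "one_form M \<eta>" and dim: "DIM('e) = 2 * n + 1" and lin\<eta>: "linear ?\<eta>"
    using \<eta>(1) one by (auto simp: contact_form_def one_form_def)
  have bbr: "bilinear ?br" using bilinear_bracket lie_bracket_eq_bracket by simp
  have anti: "?br u v = - ?br v u" for u v by (simp add: lie_bracket_eq_bracket bracket_def)
  have ad: "?B (?br h u) v + ?B u (?br h v) = 0" for h u v by (rule bi_invariant_metric_ad[OF B])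
  obtain v where v: "wedge (2 * n) 1 (two_form_power (\<lambda>v. ext_deriv M \<eta> \<one> (v 0) (v 1)) n)
      (\<lambda>v. \<eta> \<one> (v 0)) v \<noteq> 0"
    using \<eta>(1) one unfolding contact_form_def by blast
  have \<omega>: "ext_deriv M \<eta> \<one> = (\<lambda>u v. - ?\<eta> (?br u v))"
    by (auto simp: fun_eq_iff ext_deriv_one[OF of\<eta> \<eta>(2)])
  have "bilinear (\<lambda>u v. - ?\<eta> (?br u v))"
    using bbr lin\<eta> unfolding bilinear_def by (auto simp: linear_iff)
  then have bil\<omega>: "bilinear (ext_deriv M \<eta> \<one>)" by (simp only: \<omega>)
  note nd = contact_nondegenerate[OF v dim bil\<omega> lin\<eta>]
  have "\<exists>\<xi>. \<forall>x. ?\<eta> x = ?B \<xi> x"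
  proof -
    \<comment> \<open>\<open>T\<close> represents \<open>B\<close> through the Euclidean inner
      product. Nondegeneracy makes it injective, hence surjective, and a preimage of the Euclidean
      dual of \<eta> is the wanted \<xi>.\<close>
    define T where "T x = (\<Sum>b\<in>Basis. ?B x b *\<^sub>R b)" for x
    have linT: "linear T"
      unfolding T_def using bil
      by (auto simp: linear_iff bilinear_def scaleR_add_left sum.distrib scaleR_sum_right)
    have TB: "T x \<bullet> y = ?B x y" for x y
    proof -
      have "T x \<bullet> y = (\<Sum>b\<in>Basis. ?B x b * (y \<bullet> b))"
        by (simp add: T_def inner_sum_left inner_commute[of y])
      also have "\<dots> = ?B x (\<Sum>b\<in>Basis. (y \<bullet> b) *\<^sub>R b)"
        using bil linear_sum[of "?B x" "\<lambda>b. (y \<bullet> b) *\<^sub>R b" Basis]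
        by (simp add: bilinear_def linear_scale mult.commute del: euclidean_representation)
      finally show ?thesis by (simp add: euclidean_representation)
    qed
    have "inj T"
      using linear_injective_0[OF linT] nondeg TB by (metis inner_zero_left)
    then have "surj T" using linT linear_injective_imp_surjective by blast
    then obtain \<xi> where \<xi>: "T \<xi> = (\<Sum>b\<in>Basis. ?\<eta> b *\<^sub>R b)" by (metis surjD)
    have "?\<eta> x = ?B \<xi> x" for x
    proof -
      have "?\<eta> x = ?\<eta> (\<Sum>b\<in>Basis. (x \<bullet> b) *\<^sub>R b)" by (simp add: euclidean_representation)
      also have "\<dots> = (\<Sum>b\<in>Basis. ?\<eta> b *\<^sub>R b) \<bullet> x"
        using linear_sum[OF lin\<eta>, of "\<lambda>b. (x \<bullet> b) *\<^sub>R b" Basis]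
        by (simp add: linear_scale[OF lin\<eta>] inner_sum_left inner_commute[of x] mult.commute del: euclidean_representation)
      finally show ?thesis using TB[of \<xi> x] unfolding \<xi> by simp
    qed
    then show ?thesis by blast
  qed
  then obtain \<xi> where \<xi>: "\<And>x. ?\<eta> x = ?B \<xi> x" by blast
  have \<omega>B: "ext_deriv M \<eta> \<one> u v = - ?B (?br \<xi> u) v" for u v
    using ad[of u \<xi> v] anti[of u \<xi>] bil by (simp add: \<omega> \<xi> bilinear_lneg)
  have \<omega>anti: "ext_deriv M \<eta> \<one> u v = - ext_deriv M \<eta> \<one> v u" for u v
    using anti[of u v] linear_neg[OF lin\<eta>] by (simp add: \<omega>)
  \<comment> \<open>Such a \<open>u\<close> is a null vector of both the derivative of \<eta> and
    \<eta>. Applied to \<xi> itself this yields \<open>B \<xi> \<xi> \<noteq> 0\<close>, and applied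
    to \<open>x\<close> minus its \<xi>-component it bounds the centralizer.\<close>
  have ker: "u = 0" if "?br \<xi> u = 0" "?\<eta> u = 0" for u
  proof (rule nd(2))
    show "ext_deriv M \<eta> \<one> u = (\<lambda>x. 0)" using that bil by (simp add: fun_eq_iff \<omega>B bilinear_lzero)
    then show "ext_deriv M \<eta> \<one> x u = 0" for x using \<omega>anti[of x u] by simp
  qed (use that in simp)
  have br\<xi>: "?br \<xi> \<xi> = 0" by (simp add: lie_bracket_eq_bracket bracket_def)
  have \<xi>0: "\<xi> \<noteq> 0" using nd(1) bil by (auto simp: \<xi> bilinear_lzero)
  then have nz: "?B \<xi> \<xi> \<noteq> 0" using ker[OF br\<xi>] \<xi> by auto
  moreover have "\<exists>c. x = c *\<^sub>R \<xi>" if x: "?br \<xi> x = 0" for x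
  proof -
    have "x - (?\<eta> x / ?\<eta> \<xi>) *\<^sub>R \<xi> = 0"
    proof (rule ker)
      show "?br \<xi> (x - (?\<eta> x / ?\<eta> \<xi>) *\<^sub>R \<xi>) = 0"
        using bbr x br\<xi> by (simp add: bilinear_rsub bilinear_rmul)
      show "?\<eta> (x - (?\<eta> x / ?\<eta> \<xi>) *\<^sub>R \<xi>) = 0"
        using nz by (simp add: \<xi> bilinear_rsub[OF bil] bilinear_rmul[OF bil])
    qed
    then show ?thesis by auto
  qed
  ultimately show ?thesis using that by blast
qed

end


section \<open>Groups of matrices given by a quadric\<close>

lemma differentiable_eventually_cong:
  assumes "eventually (\<lambda>y. f y = g y) (nhds x)" "g differentiable at x"
  shows "f differentiable at x"
proof -
  obtain S where S: "open S" "x \<in> S" "\<And>y. y \<in> S \<Longrightarrow> g y = f y"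
    using assms(1) unfolding eventually_nhds by metis
  show ?thesis
    using has_derivative_transform_within_open[OF differentiable_has_derivative[OF assms(2)] S]
    by (auto simp: differentiable_def)
qed

text \<open>Coordinates of a submanifold extend locally to smooth maps \<open>F\<close> of the
  ambient space, so differentiability can be tested on the ambient map \<open>f\<close>.\<close>

lemma submanifold_coordinate:
  fixes S :: "'v::euclidean_space set" and f :: "'b::real_normed_vector \<Rightarrow> 'v"
    and d :: "('v, 'e::euclidean_space) chart"
  assumes d: "d \<in> atlas (submanifold S)" and fx: "f x \<in> fst d"
    and f: "f differentiable at x" and S: "eventually (\<lambda>y. f y \<in> S) (nhds x)"
  shows "eventually (\<lambda>y. f y \<in> fst d) (nhds x)" and "(\<lambda>y. snd d (f y)) differentiable at x"
proof -
  have op: "openin (top_of_set S) (fst d)"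
    and ext: "\<forall>p\<in>fst d. \<exists>W F. p \<in> W \<and> smooth_on W F \<and> (\<forall>q\<in>W \<inter> fst d. F q = snd d q)"
    using d by (simp_all add: submanifold_def)
  obtain T where T: "open T" "fst d = S \<inter> T" using op by (auto simp: openin_open)
  have cont: "isCont f x" using f by (rule differentiable_imp_continuous_within)
  have near: "eventually (\<lambda>y. f y \<in> V) (nhds x)" if "open V" "f x \<in> V" for V
    by (rule eventually_nhds_compose[OF _ cont]) (rule eventually_nhds_in_open[OF that])
  have "eventually (\<lambda>y. f y \<in> T) (nhds x)" using near T fx by simp
  with S show ev: "eventually (\<lambda>y. f y \<in> fst d) (nhds x)"
    by eventually_elim (simp add: T)
  obtain W F where W: "f x \<in> W" "smooth_on W F" "\<forall>q\<in>W \<inter> fst d. F q = snd d q"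
    using ext fx by blast
  have "eventually (\<lambda>y. snd d (f y) = F (f y)) (nhds x)"
    using ev near[OF smooth_onD(1)[OF W(2)] W(1)] by eventually_elim (use W(3) in simp)
  moreover have "(\<lambda>y. F (f y)) differentiable at x"
    using differentiable_chain_at[OF f smooth_onD(3)[OF W(2,1)]] by (simp add: o_def)
  ultimately show "(\<lambda>y. snd d (f y)) differentiable at x"
    by (rule differentiable_eventually_cong)
qed

text \<open>The groups \<open>SL(2,R)\<close> and \<open>SU(2)\<close> are the quadrics \<open>t\<^sup>2 = 1 + Q x\<close> in the four-dimensional
  real spaces of matrices \<open>t E + j x\<close>.\<close>

locale quadric_group = group G
  for G :: "'v::euclidean_space monoid" (structure) +
  fixes t :: "'v \<Rightarrow> real" and pr :: "'v \<Rightarrow> real^3" and j :: "real^3 \<Rightarrow> 'v" and Q :: "real^3 \<Rightarrow> real"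
  assumes bilinear_mult: "bilinear (\<lambda>x y. x \<otimes> y)"
    and t: "linear t" "t \<one> = 1"
    and pr: "linear pr" "pr \<one> = 0" "\<And>x. pr (j x) = x" and j: "linear j" "\<And>x. t (j x) = 0"
    and decompose: "A \<in> carrier G \<Longrightarrow> A = t A *\<^sub>R \<one> + j (pr A)"
    and quadric: "A \<in> carrier G \<Longrightarrow> (t A)\<^sup>2 = 1 + Q (pr A)"
    and in_carrier: "1 + Q x > 0 \<Longrightarrow> sqrt (1 + Q x) *\<^sub>R \<one> + j x \<in> carrier G"
    and CQ: "Ck_on k UNIV Q" and Q0: "(Q has_derivative (\<lambda>_. 0)) (at 0)"
begin

definition M :: "('v, real^3) manifold" where "M = submanifold (carrier G)"

text \<open>The half \<open>t > 0\<close> of the quadric is a graph over the coordinates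
  \<open>pr\<close>. This chart only ensures that \<open>chart_at\<close> finds a chart at the
  identity; the one it picks may be a different one.\<close>

lemma std_chart: "({A \<in> carrier G. t A > 0}, pr) \<in> atlas M"
proof -
  let ?c = "({A \<in> carrier G. t A > 0}, pr)"
  let ?U = "{x. 1 + Q x > 0}"
  let ?f = "\<lambda>x. sqrt (1 + Q x) *\<^sub>R \<one> + j x"
  have contQ: "continuous_on UNIV Q" using CQ[of 0] by simp
  have open_U: "open ?U"
    by (rule open_Collect_less) (use contQ in \<open>auto intro!: continuous_intros\<close>)
  have cont_t: "continuous_on UNIV t"
    using t(1) linear_continuous_on linear_conv_bounded_linear by blast
  have "openin (top_of_set (carrier G)) (fst ?c)"
  proof -
    have "open {A. t A > 0}" by (rule open_Collect_less) (use cont_t in \<open>auto intro!: continuous_intros\<close>)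
    moreover have "fst ?c = carrier G \<inter> {A. t A > 0}" by auto
    ultimately show ?thesis unfolding openin_open by blast
  qed
  moreover have inj: "inj_on (snd ?c) (fst ?c)"
  proof (rule inj_onI)
    fix A B assume AB: "A \<in> fst ?c" "B \<in> fst ?c" "snd ?c A = snd ?c B"
    then have "(t A)\<^sup>2 = (t B)\<^sup>2" using quadric[of A] quadric[of B] by simp
    then have "t A = t B" using AB by (simp add: power2_eq_iff)
    then show "A = B" using AB decompose[of A] decompose[of B] by simp
  qed
  have f: "?f x \<in> fst ?c \<and> pr (?f x) = x" if "x \<in> ?U" for x
    using that in_carrier t pr j by (simp add: linear_add linear_scale)
  have image: "chart_image ?c = ?U"
  proof
    show "?U \<subseteq> chart_image ?c"
      using f by (metis (no_types, lifting) chart_imageI snd_conv subsetI)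
    show "chart_image ?c \<subseteq> ?U"
      using quadric by (auto simp: chart_image_def) (metis zero_less_power)
  qed
  have "Ck_on k ?U (chart_inv ?c)" for k
  proof (rule Ck_on_cong[THEN iffD1, OF open_U])
    show "?f x = chart_inv ?c x" if "x \<in> ?U" for x
      using chart_inv_left[OF inj, of "?f x"] f[OF that] by simp
    have j': "Ck_on k ?U j" using j linear_conv_bounded_linear by (intro Ck_on_bounded_linear open_U) blast
    show "Ck_on k ?U ?f"
      by (intro Ck_on_add Ck_on_scaleR Ck_on_sqrt Ck_on_const open_U j' Ck_on_subset[OF CQ]) auto
  qed
  then have "smooth_on (chart_image ?c) (chart_inv ?c)"
    unfolding image smooth_on_def using open_U by blast
  moreover have "smooth_on UNIV pr"
    unfolding smooth_on_def
    using Ck_on_bounded_linear[OF open_UNIV] pr(1) linear_conv_bounded_linear by blast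
  then have "\<forall>p\<in>fst ?c. \<exists>W F. p \<in> W \<and> smooth_on W F \<and> (\<forall>q\<in>W \<inter> fst ?c. F q = snd ?c q)"
    by (auto intro!: exI[of _ UNIV] exI[of _ pr])
  ultimately show ?thesis using inj by (simp add: M_def submanifold_def)
qed

lemma chart_at_M:
  assumes "p \<in> fst d" "d \<in> atlas M"
  shows "chart_at M p \<in> atlas M" "p \<in> fst (chart_at M p)"
  using assms unfolding chart_at_def by (metis (mono_tags, lifting) someI_ex)+

definition c :: "('v, real^3) chart" where "c = chart_at M \<one>"
definition x0 :: "real^3" where "x0 = snd c \<one>"
definition \<psi> where "\<psi> = chart_inv c"
text \<open>The derivative at the identity of the inclusion into the space of matrices, expressed in
  the chosen chart.\<close>

definition \<iota> where "\<iota> = frechet_derivative \<psi> (at x0)"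
definition X where "X u x = frechet_derivative (\<lambda>y. snd c (\<psi> x \<otimes> \<psi> y)) (at x0) u"

lemma c: "c \<in> atlas M" "\<one> \<in> fst c"
  using chart_at_M[OF _ std_chart, of \<one>] t by (auto simp: c_def)

lemma atlas_M:
  assumes "d \<in> atlas M"
  shows "fst d \<subseteq> carrier G" "inj_on (snd d) (fst d)" "smooth_on (chart_image d) (chart_inv d)"
  using assms openin_imp_subset by (auto simp: M_def submanifold_def)

lemma x0: "x0 \<in> chart_image c" "\<psi> x0 = \<one>"
  using c atlas_M by (auto simp: x0_def \<psi>_def chart_imageI chart_inv_left)

lemma open_image: "open (chart_image c)"
  using smooth_onD(1)[OF atlas_M(3)[OF c(1)]] .

lemma ev_image: "x \<in> chart_image c \<Longrightarrow> eventually (\<lambda>x. x \<in> chart_image c) (nhds x)"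
  using eventually_nhds_in_open[OF open_image] .

lemma \<psi>_in: "x \<in> chart_image c \<Longrightarrow> \<psi> x \<in> fst c" "x \<in> chart_image c \<Longrightarrow> snd c (\<psi> x) = x"
  by (simp_all add: \<psi>_def chart_inv_right)

lemma \<psi>_carrier: "x \<in> chart_image c \<Longrightarrow> \<psi> x \<in> carrier G"
  using \<psi>_in(1) atlas_M(1)[OF c(1)] by blast

lemma C\<psi>: "Ck_on k (chart_image c) \<psi>"
  using smooth_onD(2)[OF atlas_M(3)[OF c(1)]] by (simp add: \<psi>_def)

lemma \<psi>_derivative: "x \<in> chart_image c \<Longrightarrow> (\<psi> has_derivative frechet_derivative \<psi> (at x)) (at x)"
  using Ck_on_SucD(1)[OF C\<psi>] .

lemma mult_derivative: "(f has_derivative f') F \<Longrightarrow> ((\<lambda>y. p \<otimes> f y) has_derivative (\<lambda>h. p \<otimes> f' h)) F"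
  using bilinear_mult bounded_linear.has_derivative
  unfolding bilinear_def linear_conv_bounded_linear by blast

lemma mult_derivative': "(f has_derivative f') F \<Longrightarrow> ((\<lambda>y. f y \<otimes> p) has_derivative (\<lambda>h. f' h \<otimes> p)) F"
  using bilinear_mult bounded_linear.has_derivative[of "\<lambda>x. x \<otimes> p"]
  unfolding bilinear_def linear_conv_bounded_linear by blast

lemma \<iota>: "(\<psi> has_derivative \<iota>) (at x0)" "linear \<iota>"
  using \<psi>_derivative[OF x0(1)] has_derivative_linear by (auto simp: \<iota>_def)

lemma translate:
  assumes p: "p \<in> fst d" "d \<in> atlas M"
  shows "eventually (\<lambda>y. p \<otimes> \<psi> y \<in> fst d) (nhds x0)"
    and "(\<lambda>y. snd d (p \<otimes> \<psi> y)) differentiable at x0"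
proof -
  have pG: "p \<in> carrier G" using p atlas_M(1) by blast
  have "(\<lambda>y. p \<otimes> \<psi> y) differentiable at x0"
    using mult_derivative[OF \<iota>(1)] by (auto simp: differentiable_def)
  moreover have "eventually (\<lambda>y. p \<otimes> \<psi> y \<in> carrier G) (nhds x0)"
    using ev_image[OF x0(1)] by eventually_elim (simp add: pG \<psi>_carrier)
  moreover have "p \<otimes> \<psi> x0 \<in> fst d" using p pG by (simp add: x0)
  ultimately show "eventually (\<lambda>y. p \<otimes> \<psi> y \<in> fst d) (nhds x0)"
    and "(\<lambda>y. snd d (p \<otimes> \<psi> y)) differentiable at x0"
    using submanifold_coordinate[of d "carrier G" "\<lambda>y. p \<otimes> \<psi> y" x0] p by (auto simp: M_def)
qed

lemma transition:
  assumes p: "p \<in> fst d" "d \<in> atlas M" "p \<in> fst e" "e \<in> atlas M"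
  shows "(snd e \<circ> chart_inv d) differentiable at (snd d p)"
proof -
  note sm = atlas_M(3)[OF p(2)]
  have x: "snd d p \<in> chart_image d" by (rule chart_imageI[OF p(1)])
  have "eventually (\<lambda>y. y \<in> chart_image d) (nhds (snd d p))"
    using eventually_nhds_in_open[OF smooth_onD(1)[OF sm] x] .
  then have "eventually (\<lambda>y. chart_inv d y \<in> carrier G) (nhds (snd d p))"
    by eventually_elim (rule subsetD[OF atlas_M(1)[OF p(2)] chart_inv_right(2)])
  then show ?thesis
    using submanifold_coordinate(2)[of e "carrier G" "chart_inv d" "snd d p"]
      smooth_onD(3)[OF sm x] p chart_inv_left[OF atlas_M(2)[OF p(2)] p(1)]
    by (simp add: M_def o_def)
qed

lemma vf_eq_X:
  assumes x: "x \<in> chart_image c"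
  shows "vf_in_chart M c (left_invariant_field G M u) x = X u x"
proof -
  let ?p = "\<psi> x"
  note pc = \<psi>_in(1)[OF x]
  note d = chart_at_M[OF pc c(1)]
  show ?thesis
    using vf_in_chart_left_invariant_field[of ?p M G x u] x0 \<psi>_carrier[OF x] atlas_M(2)[OF d(1)]
      translate[OF d(2,1)] transition[OF d(2,1) pc c(1)]
    by (simp add: c_def[symmetric] x0_def[symmetric] \<psi>_def[symmetric] X_def)
qed

lemma X_unit: "X u x0 = u"
proof -
  have "eventually (\<lambda>y. snd c (\<psi> x0 \<otimes> \<psi> y) = y) (nhds x0)"
    using ev_image[OF x0(1)] by eventually_elim (simp add: x0 \<psi>_in \<psi>_carrier)
  from frechet_derivative_eventually_cong[OF this] show ?thesis by (simp add: X_def)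
qed

lemma lie_bracket_X:
  "lie_bracket G M u v = frechet_derivative (X v) (at x0) u - frechet_derivative (X u) (at x0) v"
proof -
  have "eventually (\<lambda>x. vf_in_chart M c (left_invariant_field G M u) x = X u x) (nhds x0)" for u
    using ev_image[OF x0(1)] by eventually_elim (rule vf_eq_X)
  then show ?thesis
    using lie_bracket_eq[of M G X u v] X_unit by (simp add: c_def[symmetric] x0_def[symmetric])
qed

text \<open>In the matrix space a left invariant field is simply right multiplication by the fixed
  matrix \<open>\<iota> u\<close>.\<close>

lemma \<psi>_X:
  assumes x: "x \<in> chart_image c"
  shows "frechet_derivative \<psi> (at x) (X u x) = \<psi> x \<otimes> \<iota> u"
proof -
  note pc = \<psi>_in(1)[OF x]
  note tr = translate[OF pc c(1)]
  have 1: "((\<lambda>y. \<psi> (snd c (\<psi> x \<otimes> \<psi> y))) has_derivative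
      (\<lambda>u. frechet_derivative \<psi> (at x) (X u x))) (at x0)"
    unfolding X_def
    by (rule has_derivative_compose[OF differentiable_has_derivative[OF tr(2)]])
      (simp add: x0 \<psi>_carrier[OF x] \<psi>_in[OF x] \<psi>_derivative[OF x])
  have 2: "eventually (\<lambda>y. \<psi> (snd c (\<psi> x \<otimes> \<psi> y)) = \<psi> x \<otimes> \<psi> y) (nhds x0)"
    using tr(1) by eventually_elim (simp add: \<psi>_def chart_inv_left[OF atlas_M(2)[OF c(1)]])
  show ?thesis
    using frechet_derivative_eventually_cong[OF 2]
    unfolding frechet_derivative_eq[OF 1] frechet_derivative_eq[OF mult_derivative[OF \<iota>(1)]]
    by (rule fun_cong)
qed

lemma extension:
  obtains W F where "\<one> \<in> W" "smooth_on W F" "\<forall>q\<in>W \<inter> fst c. F q = snd c q"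
proof -
  have "\<exists>W F. \<one> \<in> W \<and> smooth_on W F \<and> (\<forall>q\<in>W \<inter> fst c. F q = snd c q)"
    using c unfolding M_def submanifold_def by simp
  then show ?thesis using that by blast
qed

text \<open>The definition of \<open>X\<close> involves derivatives in a different chart expression
  for each \<open>x\<close>. Replacing the coordinates by an ambient extension \<open>F\<close>
  gives one formula near the unit, the derivative of \<open>F\<close> at \<open>\<psi> x\<close>
  applied to \<open>\<psi> x \<otimes> \<iota> u\<close>, which is visibly differentiable.\<close>

lemma X_differentiable: "X u differentiable at x0"
proof -
  obtain W F where W: "\<one> \<in> W" "smooth_on W F" "\<forall>q\<in>W \<inter> fst c. F q = snd c q"
    by (rule extension)
  note oW = smooth_onD(1)[OF W(2)]
  have evW: "eventually (\<lambda>x. f x \<in> W) (nhds x0)" if "f x0 \<in> W" "isCont f x0" for f :: "real^3 \<Rightarrow> 'v"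
    using eventually_nhds_compose[OF eventually_nhds_in_open[OF oW that(1)] that(2)] .
  have cont: "isCont \<psi> x0" using \<iota>(1) has_derivative_continuous by blast
  have F: "(F has_derivative frechet_derivative F (at q)) (at q)" if "q \<in> W" for q
    using differentiable_has_derivative[OF smooth_onD(3)[OF W(2) that]] .
  have ev\<psi>: "eventually (\<lambda>x. \<psi> x \<in> W) (nhds x0)" using evW[OF _ cont] W(1) x0 by simp
  have eq: "eventually (\<lambda>x. X u x = frechet_derivative F (at (\<psi> x)) (\<psi> x \<otimes> \<iota> u)) (nhds x0)"
    using ev_image[OF x0(1)] ev\<psi>
  proof eventually_elim
    case (elim x)
    note d = mult_derivative[OF \<iota>(1), of "\<psi> x"]
    have px: "\<psi> x \<otimes> \<psi> x0 = \<psi> x" using \<psi>_carrier[OF elim(1)] by (simp add: x0)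
    have "eventually (\<lambda>y. \<psi> x \<otimes> \<psi> y \<in> W) (nhds x0)"
      by (rule evW) (use px elim has_derivative_continuous[OF d] in auto)
    then have *: "eventually (\<lambda>y. snd c (\<psi> x \<otimes> \<psi> y) = F (\<psi> x \<otimes> \<psi> y)) (nhds x0)"
      using translate(1)[OF \<psi>_in(1)[OF elim(1)] c(1)] by eventually_elim (use W(3) in simp)
    have "X u x = frechet_derivative (\<lambda>y. F (\<psi> x \<otimes> \<psi> y)) (at x0) u"
      unfolding X_def frechet_derivative_eventually_cong[OF *] ..
    also have "\<dots> = frechet_derivative F (at (\<psi> x)) (\<psi> x \<otimes> \<iota> u)"
      using frechet_derivative_eq[OF has_derivative_compose[OF d, of F "frechet_derivative F (at (\<psi> x))"]]
        F[OF elim(2)] px by simp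
    finally show ?case .
  qed
  have lin: "eventually (\<lambda>x. linear (frechet_derivative F (at (\<psi> x)))) (nhds x0)"
    using ev\<psi> by eventually_elim (use F has_derivative_linear in blast)
  have A: "((\<lambda>x. frechet_derivative F (at (\<psi> x)) w) has_derivative
      (\<lambda>h. frechet_derivative (\<lambda>q. frechet_derivative F (at q) w) (at \<one>) (\<iota> h))) (at x0)" for w
    using has_derivative_compose[OF \<iota>(1), of "\<lambda>q. frechet_derivative F (at q) w"]
      Ck_on_SucD(1)[OF Ck_on_SucD(2)[OF smooth_onD(2)[OF W(2)]] W(1)] by (simp add: x0)
  have "(\<lambda>x. frechet_derivative F (at (\<psi> x)) (\<psi> x \<otimes> \<iota> u)) differentiable at x0"
    using has_derivative_linear_family[OF lin A mult_derivative'[OF \<iota>(1), of "\<iota> u"]]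
    by (auto simp: differentiable_def)
  then show ?thesis by (rule differentiable_eventually_cong[OF eq])
qed

text \<open>\<open>\<psi>_X\<close> is differentiated at the unit: the second derivative of \<psi>
  is symmetric and drops out of the difference, leaving the commutator of matrices.\<close>

lemma \<iota>_bracket: "\<iota> (lie_bracket G M w u) = \<iota> w \<otimes> \<iota> u - \<iota> u \<otimes> \<iota> w"
proof -
  let ?H = "\<lambda>u w. frechet_derivative (\<lambda>x. frechet_derivative \<psi> (at x) u) (at x0) w"
  have *: "?H u w + \<iota> (frechet_derivative (X u) (at x0) w) = \<iota> w \<otimes> \<iota> u" for u w
  proof -
    have lin: "eventually (\<lambda>x. linear (frechet_derivative \<psi> (at x))) (nhds x0)"
      using ev_image[OF x0(1)] by eventually_elim (use \<psi>_derivative has_derivative_linear in blast)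
    have A: "((\<lambda>x. frechet_derivative \<psi> (at x) v) has_derivative ?H v) (at x0)" for v
      using Ck_on_SucD(1)[OF Ck_on_SucD(2)[OF C\<psi>] x0(1)] .
    have 1: "((\<lambda>x. frechet_derivative \<psi> (at x) (X u x)) has_derivative
        (\<lambda>w. ?H (X u x0) w + frechet_derivative \<psi> (at x0) (frechet_derivative (X u) (at x0) w))) (at x0)"
      by (rule has_derivative_linear_family[OF lin A differentiable_has_derivative[OF X_differentiable]])
    have "eventually (\<lambda>x. frechet_derivative \<psi> (at x) (X u x) = \<psi> x \<otimes> \<iota> u) (nhds x0)"
      using ev_image[OF x0(1)] by eventually_elim (rule \<psi>_X)
    from frechet_derivative_eventually_cong[OF this] show ?thesis
      unfolding frechet_derivative_eq[OF 1] frechet_derivative_eq[OF mult_derivative'[OF \<iota>(1)]]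
      by (simp add: fun_eq_iff X_unit \<iota>_def[symmetric])
  qed
  have "?H u w = ?H w u" by (rule symmetric_second_derivative[OF C\<psi> open_image x0(1)])
  then show ?thesis
    unfolding lie_bracket_X linear_diff[OF \<iota>(2)] using *[of u w, symmetric] *[of w u, symmetric] by simp
qed

text \<open>At the identity \<open>t\<close> is 1 and the derivative of \<open>Q\<close> vanishes,
  so the derivative of the quadric equation reads \<open>2 * t (\<iota> u) = 0\<close>: tangent
  vectors have no component along the unit matrix.\<close>

lemma \<iota>_j: "\<iota> u = j (pr (\<iota> u))"
proof -
  have bt: "bounded_linear t" "bounded_linear pr" "bounded_linear j"
    using t pr j linear_conv_bounded_linear by blast+
  have 1: "((\<lambda>x. t (\<psi> x)) has_derivative (\<lambda>u. t (\<iota> u))) (at x0)"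
    by (rule bounded_linear.has_derivative[OF bt(1) \<iota>(1)])
  have 2: "((\<lambda>x. pr (\<psi> x)) has_derivative (\<lambda>u. pr (\<iota> u))) (at x0)"
    by (rule bounded_linear.has_derivative[OF bt(2) \<iota>(1)])
  have 3: "((\<lambda>x. t (\<psi> x) *\<^sub>R \<one> + j (pr (\<psi> x))) has_derivative (\<lambda>u. t (\<iota> u) *\<^sub>R \<one> + j (pr (\<iota> u)))) (at x0)"
    by (intro has_derivative_add has_derivative_scaleR_left 1 bounded_linear.has_derivative[OF bt(3) 2])
  have "eventually (\<lambda>x. \<psi> x = t (\<psi> x) *\<^sub>R \<one> + j (pr (\<psi> x))) (nhds x0)"
    using ev_image[OF x0(1)] by eventually_elim (rule decompose[OF \<psi>_carrier])
  from frechet_derivative_eventually_cong[OF this]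
  have "\<iota> u = t (\<iota> u) *\<^sub>R \<one> + j (pr (\<iota> u))"
    unfolding frechet_derivative_eq[OF 3] by (simp add: \<iota>_def fun_eq_iff)
  moreover have "t (\<iota> u) = 0"
  proof -
    have 4: "((\<lambda>x. t (\<psi> x) * t (\<psi> x)) has_derivative (\<lambda>u. t (\<psi> x0) * t (\<iota> u) + t (\<iota> u) * t (\<psi> x0))) (at x0)"
      by (rule has_derivative_mult[OF 1 1])
    have "((\<lambda>x. Q (pr (\<psi> x))) has_derivative (\<lambda>u. 0)) (at x0)"
      using has_derivative_compose[OF 2, of Q "\<lambda>_. 0"] Q0 by (simp add: x0 pr)
    then have 5: "((\<lambda>x. 1 + Q (pr (\<psi> x))) has_derivative (\<lambda>u. 0)) (at x0)"
      using has_derivative_add[OF has_derivative_const[of 1]] by fastforce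
    have "eventually (\<lambda>x. t (\<psi> x) * t (\<psi> x) = 1 + Q (pr (\<psi> x))) (nhds x0)"
      using ev_image[OF x0(1)]
      by eventually_elim (use quadric \<psi>_carrier in \<open>simp add: power2_eq_square\<close>)
    from frechet_derivative_eventually_cong[OF this] show ?thesis
      unfolding frechet_derivative_eq[OF 4] frechet_derivative_eq[OF 5]
      by (simp add: x0 t fun_eq_iff)
  qed
  ultimately show ?thesis by simp
qed

text \<open>A smooth extension of the chart is a left inverse of \<psi>, so its derivative is a left
  inverse of \<iota>.\<close>

lemma inj_\<iota>: "inj \<iota>"
proof -
  obtain W F where W: "\<one> \<in> W" "smooth_on W F" "\<forall>q\<in>W \<inter> fst c. F q = snd c q"
    by (rule extension)
  have cont: "isCont \<psi> x0" using \<iota>(1) has_derivative_continuous by blast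
  have W1: "\<psi> x0 \<in> W" using W(1) x0 by simp
  have "eventually (\<lambda>x. \<psi> x \<in> W) (nhds x0)"
    by (rule eventually_nhds_compose[OF eventually_nhds_in_open[OF smooth_onD(1)[OF W(2)] W1] cont])
  then have "eventually (\<lambda>x. F (\<psi> x) = x) (nhds x0)"
    using ev_image[OF x0(1)] by eventually_elim (use W(3) \<psi>_in in simp)
  moreover have "((\<lambda>x. F (\<psi> x)) has_derivative (\<lambda>u. frechet_derivative F (at (\<psi> x0)) (\<iota> u))) (at x0)"
    by (rule has_derivative_compose[OF \<iota>(1) differentiable_has_derivative[OF smooth_onD(3)[OF W(2) W1]]])
  ultimately have "frechet_derivative F (at (\<psi> x0)) (\<iota> u) = u" for u
    using frechet_derivative_eventually_cong[of "\<lambda>x. F (\<psi> x)" "\<lambda>x. x" x0]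
      frechet_derivative_eq[of "\<lambda>x. F (\<psi> x)" "\<lambda>u. frechet_derivative F (at (\<psi> x0)) (\<iota> u)" x0]
    by (simp add: fun_eq_iff)
  then show ?thesis by (metis injI)
qed

text \<open>As the chart at the identity is an unknown choice, the bracket on the model space can be
  determined only up to a linear change of coordinates \<open>P\<close>.\<close>

theorem lie_algebra:
  obtains P :: "real^3 \<Rightarrow> real^3" where "linear P" "bij P"
    "\<And>u v. j (P (lie_bracket G M u v)) = j (P u) \<otimes> j (P v) - j (P v) \<otimes> j (P u)"
proof
  show lin: "linear (\<lambda>u. pr (\<iota> u))" using linear_compose[OF \<iota>(2) pr(1)] by (simp add: o_def)
  have "inj (\<lambda>u. pr (\<iota> u))"
  proof (rule injI)
    fix u v assume "pr (\<iota> u) = pr (\<iota> v)"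
    then have "\<iota> u = \<iota> v" using \<iota>_j[of u] \<iota>_j[of v] by simp
    then show "u = v" using inj_\<iota> by (rule injD[rotated])
  qed
  then show "bij (\<lambda>u. pr (\<iota> u))"
    using lin linear_injective_imp_surjective by (auto simp: bij_def)
  show "j (pr (\<iota> (lie_bracket G M u v))) =
      j (pr (\<iota> u)) \<otimes> j (pr (\<iota> v)) - j (pr (\<iota> v)) \<otimes> j (pr (\<iota> u))" for u v
    unfolding \<iota>_j[symmetric] by (rule \<iota>_bracket)
qed

end


section \<open>The Lie algebras of SL(2,R) and SU(2)\<close>

text \<open>The three-dimensional bracket in which the unit vectors satisfy
  \<open>[e1, e2] = \<gamma> e3\<close> and, cyclically, \<open>[e2, e3] = \<alpha> e1\<close> and
  \<open>[e3, e1] = \<beta> e2\<close>.\<close>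

definition scaled_cross :: "real \<Rightarrow> real \<Rightarrow> real \<Rightarrow> real^3 \<Rightarrow> real^3 \<Rightarrow> real^3" where
  "scaled_cross \<alpha> \<beta> \<gamma> x y =
     vector [\<alpha> * (x$2 * y$3 - x$3 * y$2), \<beta> * (x$3 * y$1 - x$1 * y$3), \<gamma> * (x$1 * y$2 - x$2 * y$1)]"

text \<open>The form is kept as a sum of coefficients times products so that the quadratic forms of
  both matrix groups are literal instances.\<close>

lemma Ck_on_diagonal_form: "Ck_on k UNIV (\<lambda>x::real^3. a * (x$1 * x$1) + b * (x$2 * x$2) + c * (x$3 * x$3))"
  by (intro Ck_on_add Ck_on_mult Ck_on_const open_UNIV Ck_on_bounded_linear bounded_linear_vec_nth)

lemma diagonal_form_derivative:
  "((\<lambda>x::real^3. a * (x$1 * x$1) + b * (x$2 * x$2) + c * (x$3 * x$3)) has_derivative (\<lambda>_. 0)) (at 0)"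
  by (auto intro!: derivative_eq_intros bounded_linear.has_derivative[OF bounded_linear_vec_nth])

lemma bilinear_matrix_mult: "bilinear (\<lambda>A B :: 'a::real_normed_algebra_1^'n^'n. A ** B)"
  unfolding bilinear_def linear_iff
  by (auto simp: matrix_matrix_mult_def vec_eq_iff sum.distrib distrib_left distrib_right scaleR_sum_right)

text \<open>Half the trace, together with coordinates splitting the trace-free part into diagonal,
  symmetric and antisymmetric pieces: the determinant becomes
  \<open>t * t - x$1 * x$1 - x$2 * x$2 + x$3 * x$3\<close>, so the group is a quadric.\<close>

definition sl_trace :: "real^2^2 \<Rightarrow> real" where "sl_trace A = (A$1$1 + A$2$2) / 2"
definition sl_coords :: "real^2^2 \<Rightarrow> real^3" where
  "sl_coords A = vector [(A$1$1 - A$2$2) / 2, (A$1$2 + A$2$1) / 2, (A$1$2 - A$2$1) / 2]"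
definition sl_matrix :: "real^3 \<Rightarrow> real^2^2" where
  "sl_matrix x = vector [vector [x$1, x$2 + x$3], vector [x$2 - x$3, - x$1]]"

lemma group_SL2R: "group SL2R"
proof (rule groupI)
  fix A assume "A \<in> carrier SL2R"
  then have det: "det A = 1" by (simp add: SL2R_def)
  then have "invertible A" by (simp add: invertible_det_nz)
  then obtain A' where A': "A' ** A = mat 1" by (auto simp: invertible_def)
  then have "det A' * det A = 1" by (metis det_mul det_I)
  then show "\<exists>y\<in>carrier SL2R. y \<otimes>\<^bsub>SL2R\<^esub> A = \<one>\<^bsub>SL2R\<^esub>" using A' det by (auto simp: SL2R_def)
qed (auto simp: SL2R_def det_mul matrix_mul_assoc)

interpretation SL2: quadric_group SL2R sl_trace sl_coords sl_matrix
  "\<lambda>x. 1 * (x$1 * x$1) + 1 * (x$2 * x$2) + (- 1) * (x$3 * x$3)"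
proof (intro quadric_group.intro quadric_group_axioms.intro group_SL2R Ck_on_diagonal_form
    diagonal_form_derivative)
  show "bilinear (\<lambda>x y. x \<otimes>\<^bsub>SL2R\<^esub> y)" using bilinear_matrix_mult by (simp add: SL2R_def)
  show "linear sl_trace" by (auto simp: linear_iff sl_trace_def field_simps)
  show "linear sl_coords"
    by (auto simp: linear_iff sl_coords_def vec_eq_iff forall_3 field_simps)
  show "linear sl_matrix"
    by (auto simp: linear_iff sl_matrix_def vec_eq_iff forall_2 field_simps)
  show "sl_trace \<one>\<^bsub>SL2R\<^esub> = 1" by (simp add: sl_trace_def SL2R_def mat_def)
  show "sl_coords \<one>\<^bsub>SL2R\<^esub> = 0" by (simp add: sl_coords_def SL2R_def mat_def vec_eq_iff forall_3)
  show "sl_coords (sl_matrix x) = x" for x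
    by (simp add: sl_coords_def sl_matrix_def vec_eq_iff forall_3)
  show "sl_trace (sl_matrix x) = 0" for x by (simp add: sl_trace_def sl_matrix_def)
  show "A = sl_trace A *\<^sub>R \<one>\<^bsub>SL2R\<^esub> + sl_matrix (sl_coords A)" for A
    by (simp add: sl_trace_def sl_matrix_def sl_coords_def SL2R_def mat_def vec_eq_iff forall_2 field_simps)
  show "(sl_trace A)\<^sup>2 = 1 + (1 * (sl_coords A$1 * sl_coords A$1) + 1 * (sl_coords A$2 * sl_coords A$2)
      + (- 1) * (sl_coords A$3 * sl_coords A$3))" if "A \<in> carrier SL2R" for A
    using that by (simp add: sl_trace_def sl_coords_def SL2R_def det_2 power2_eq_square field_simps)
  show "sqrt (1 + (1 * (x$1 * x$1) + 1 * (x$2 * x$2) + (- 1) * (x$3 * x$3))) *\<^sub>R \<one>\<^bsub>SL2R\<^esub> + sl_matrix x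
      \<in> carrier SL2R"
    if "1 + (1 * (x$1 * x$1) + 1 * (x$2 * x$2) + (- 1) * (x$3 * x$3)) > 0" for x
  proof -
    let ?s = "sqrt (1 + (1 * (x$1 * x$1) + 1 * (x$2 * x$2) + (- 1) * (x$3 * x$3)))"
    have "?s * ?s = 1 + (1 * (x$1 * x$1) + 1 * (x$2 * x$2) + (- 1) * (x$3 * x$3))"
      using that by (intro real_sqrt_mult_self[THEN trans]) simp
    then show ?thesis by (simp add: SL2R_def det_2 sl_matrix_def mat_def algebra_simps)
  qed
qed

lemma SL2R_lie_algebra:
  obtains P :: "real^3 \<Rightarrow> real^3" where "linear P" "bij P"
    "\<And>u v. P (lie_bracket SL2R SL2R_manifold u v) = scaled_cross (- 2) (- 2) 2 (P u) (P v)"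
proof -
  obtain P :: "real^3 \<Rightarrow> real^3" where P: "linear P" "bij P"
    "\<And>u v. sl_matrix (P (lie_bracket SL2R SL2.M u v)) =
      sl_matrix (P u) \<otimes>\<^bsub>SL2R\<^esub> sl_matrix (P v) - sl_matrix (P v) \<otimes>\<^bsub>SL2R\<^esub> sl_matrix (P u)"
    by (rule SL2.lie_algebra) blast
  \<comment> \<open>The constants are commutators of the images \<open>h\<close>, \<open>s\<close>,
    \<open>a\<close> of the unit vectors: \<open>[h, s] = 2 a\<close>,
    \<open>[s, a] = - 2 h\<close>, \<open>[a, h] = - 2 s\<close>.\<close>
  have "sl_matrix x \<otimes>\<^bsub>SL2R\<^esub> sl_matrix y - sl_matrix y \<otimes>\<^bsub>SL2R\<^esub> sl_matrix x =
      sl_matrix (scaled_cross (- 2) (- 2) 2 x y)" for x y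
    by (simp add: SL2R_def sl_matrix_def scaled_cross_def vec_eq_iff forall_2 matrix_matrix_mult_def
        sum_2 algebra_simps)
  then have "P (lie_bracket SL2R SL2R_manifold u v) = scaled_cross (- 2) (- 2) 2 (P u) (P v)" for u v
    using P(3)[of u v] SL2.pr(3) unfolding SL2.M_def SL2R_manifold_def by metis
  then show ?thesis using that P by blast
qed

text \<open>Real and imaginary parts of a unit quaternion: \<open>su_matrix\<close> sends the unit
  vectors to matrices multiplying like i, j, k, whose commutators account for the constants 2, 2,
  2.\<close>

definition su_trace :: "complex^2^2 \<Rightarrow> real" where "su_trace A = Re (A$1$1)"
definition su_coords :: "complex^2^2 \<Rightarrow> real^3" where
  "su_coords A = vector [Im (A$1$1), Re (A$1$2), Im (A$1$2)]"
definition su_matrix :: "real^3 \<Rightarrow> complex^2^2" where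
  "su_matrix x = vector [vector [Complex 0 (x$1), Complex (x$2) (x$3)],
     vector [Complex (- x$2) (x$3), Complex 0 (- x$1)]]"

lemma SU2_iff:
  "A \<in> carrier SU2 \<longleftrightarrow> A$2$2 = cnj (A$1$1) \<and> A$2$1 = - cnj (A$1$2) \<and>
     (cmod (A$1$1))\<^sup>2 + (cmod (A$1$2))\<^sup>2 = 1"
proof -
  define a b c d where abcd: "a = A$1$1" "b = A$1$2" "c = A$2$1" "d = A$2$2"
  have mem: "A \<in> carrier SU2 \<longleftrightarrow>
      (cnj a * a + cnj c * c = 1 \<and> cnj a * b + cnj c * d = 0 \<and>
       cnj b * a + cnj d * c = 0 \<and> cnj b * b + cnj d * d = 1) \<and> a * d - b * c = 1"
    unfolding SU2_def
    by (simp add: abcd vec_eq_iff forall_2 matrix_matrix_mult_def sum_2 mat_def det_2)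
  have norm: "(cmod a)\<^sup>2 + (cmod b)\<^sup>2 = 1 \<longleftrightarrow> a * cnj a + b * cnj b = 1"
    by (simp only: complex_norm_square [symmetric] of_real_add [symmetric] of_real_eq_1_iff)
  show ?thesis
    unfolding mem abcd[symmetric] norm
  proof
    assume A: "(cnj a * a + cnj c * c = 1 \<and> cnj a * b + cnj c * d = 0 \<and>
       cnj b * a + cnj d * c = 0 \<and> cnj b * b + cnj d * d = 1) \<and> a * d - b * c = 1"
    \<comment> \<open>Multiplying by the norm 1 of the first column and regrouping brings in the
      determinant and the orthogonality of the columns, which gives the second row in terms of the
      first.\<close>
    have "d = d * (cnj a * a + cnj c * c)" using A by simp
    also have "\<dots> = cnj a * (a * d - b * c) + c * (cnj a * b + cnj c * d)" by (simp add: algebra_simps)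
    finally have d: "d = cnj a" using A by simp
    have "b = b * (cnj a * a + cnj c * c)" using A by simp
    also have "\<dots> = a * (cnj a * b + cnj c * d) - cnj c * (a * d - b * c)" by (simp add: algebra_simps)
    finally have "b = - cnj c" using A by simp
    then have c: "c = - cnj b" by simp
    show "d = cnj a \<and> c = - cnj b \<and> a * cnj a + b * cnj b = 1"
      using A c d by (simp add: algebra_simps)
  next
    assume "d = cnj a \<and> c = - cnj b \<and> a * cnj a + b * cnj b = 1"
    then show "(cnj a * a + cnj c * c = 1 \<and> cnj a * b + cnj c * d = 0 \<and>
       cnj b * a + cnj d * c = 0 \<and> cnj b * b + cnj d * d = 1) \<and> a * d - b * c = 1"
      by (simp add: algebra_simps)
  qed
qed

lemma group_SU2: "group SU2"
proof (rule groupI)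
  let ?H = "\<lambda>A::complex^2^2. \<chi> i j. cnj (A $ j $ i)"
  have H_mult: "?H (A ** B) = ?H B ** ?H A" for A B
    by (simp add: vec_eq_iff matrix_matrix_mult_def mult.commute)
  have det_H: "det (?H A) = cnj (det A)" for A by (simp add: det_2 mult.commute)
  have HH: "?H (?H A) = A" for A by (simp add: vec_eq_iff)
  show "x \<otimes>\<^bsub>SU2\<^esub> y \<in> carrier SU2" if "x \<in> carrier SU2" "y \<in> carrier SU2" for x y
  proof -
    have "?H x ** x = mat 1" "?H y ** y = mat 1" "det x = 1" "det y = 1"
      using that by (auto simp: SU2_def)
    moreover have "?H (x ** y) ** (x ** y) = ?H y ** ((?H x ** x) ** y)"
      by (simp only: H_mult matrix_mul_assoc)
    ultimately show ?thesis by (simp add: SU2_def det_mul)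
  qed
  show "\<one>\<^bsub>SU2\<^esub> \<in> carrier SU2"
    by (simp add: SU2_iff) (simp add: SU2_def mat_def)
  fix A assume "A \<in> carrier SU2"
  then have A: "?H A ** A = mat 1" "det A = 1" by (auto simp: SU2_def)
  then have "A ** ?H A = mat 1" using matrix_left_right_inverse by blast
  then have "?H A \<in> carrier SU2" using A det_H HH by (simp add: SU2_def)
  moreover have "?H A \<otimes>\<^bsub>SU2\<^esub> A = \<one>\<^bsub>SU2\<^esub>" using A by (simp add: SU2_def)
  ultimately show "\<exists>y\<in>carrier SU2. y \<otimes>\<^bsub>SU2\<^esub> A = \<one>\<^bsub>SU2\<^esub>" by blast
qed (auto simp: SU2_def matrix_mul_assoc)

interpretation SU2: quadric_group SU2 su_trace su_coords su_matrix
  "\<lambda>x. (- 1) * (x$1 * x$1) + (- 1) * (x$2 * x$2) + (- 1) * (x$3 * x$3)"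
proof (intro quadric_group.intro quadric_group_axioms.intro group_SU2 Ck_on_diagonal_form
    diagonal_form_derivative)
  show "bilinear (\<lambda>x y. x \<otimes>\<^bsub>SU2\<^esub> y)" using bilinear_matrix_mult by (simp add: SU2_def)
  show "linear su_trace" by (auto simp: linear_iff su_trace_def)
  show "linear su_coords"
    by (auto simp: linear_iff su_coords_def vec_eq_iff forall_3)
  show "linear su_matrix"
    by (auto simp: linear_iff su_matrix_def vec_eq_iff forall_2 complex_eq_iff)
  show "su_trace \<one>\<^bsub>SU2\<^esub> = 1" by (simp add: su_trace_def SU2_def mat_def)
  show "su_coords \<one>\<^bsub>SU2\<^esub> = 0" by (simp add: su_coords_def SU2_def mat_def vec_eq_iff forall_3)
  show "su_coords (su_matrix x) = x" for x
    by (simp add: su_coords_def su_matrix_def vec_eq_iff forall_3)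
  show "su_trace (su_matrix x) = 0" for x by (simp add: su_trace_def su_matrix_def)
  show "A = su_trace A *\<^sub>R \<one>\<^bsub>SU2\<^esub> + su_matrix (su_coords A)" if "A \<in> carrier SU2" for A
    using that unfolding SU2_iff
    by (simp add: su_trace_def su_matrix_def su_coords_def SU2_def mat_def vec_eq_iff forall_2 complex_eq_iff)
  show "(su_trace A)\<^sup>2 = 1 + ((- 1) * (su_coords A$1 * su_coords A$1) + (- 1) * (su_coords A$2 * su_coords A$2)
      + (- 1) * (su_coords A$3 * su_coords A$3))" if "A \<in> carrier SU2" for A
    using that unfolding SU2_iff cmod_power2
    by (simp add: su_trace_def su_coords_def power2_eq_square)
  show "sqrt (1 + ((- 1) * (x$1 * x$1) + (- 1) * (x$2 * x$2) + (- 1) * (x$3 * x$3))) *\<^sub>R \<one>\<^bsub>SU2\<^esub> + su_matrix x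
      \<in> carrier SU2"
    if "1 + ((- 1) * (x$1 * x$1) + (- 1) * (x$2 * x$2) + (- 1) * (x$3 * x$3)) > 0" for x
  proof -
    let ?s = "sqrt (1 + ((- 1) * (x$1 * x$1) + (- 1) * (x$2 * x$2) + (- 1) * (x$3 * x$3)))"
    have "?s * ?s = 1 + ((- 1) * (x$1 * x$1) + (- 1) * (x$2 * x$2) + (- 1) * (x$3 * x$3))"
      using that by (intro real_sqrt_mult_self[THEN trans]) simp
    then show ?thesis unfolding SU2_iff
      by (simp add: SU2_def su_matrix_def mat_def cmod_power2 complex_eq_iff)
        (simp add: power2_eq_square algebra_simps)
  qed
qed

lemma SU2_lie_algebra:
  obtains P :: "real^3 \<Rightarrow> real^3" where "linear P" "bij P"
    "\<And>u v. P (lie_bracket SU2 SU2_manifold u v) = scaled_cross 2 2 2 (P u) (P v)"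
proof -
  obtain P :: "real^3 \<Rightarrow> real^3" where P: "linear P" "bij P"
    "\<And>u v. su_matrix (P (lie_bracket SU2 SU2.M u v)) =
      su_matrix (P u) \<otimes>\<^bsub>SU2\<^esub> su_matrix (P v) - su_matrix (P v) \<otimes>\<^bsub>SU2\<^esub> su_matrix (P u)"
    by (rule SU2.lie_algebra) blast
  have "su_matrix x \<otimes>\<^bsub>SU2\<^esub> su_matrix y - su_matrix y \<otimes>\<^bsub>SU2\<^esub> su_matrix x =
      su_matrix (scaled_cross 2 2 2 x y)" for x y
    by (simp add: SU2_def su_matrix_def scaled_cross_def vec_eq_iff forall_2 matrix_matrix_mult_def
        sum_2 complex_eq_iff algebra_simps)
  then have "P (lie_bracket SU2 SU2_manifold u v) = scaled_cross 2 2 2 (P u) (P v)" for u v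
    using P(3)[of u v] SU2.pr(3) unfolding SU2.M_def SU2_manifold_def by metis
  then show ?thesis using that P by blast
qed


section \<open>Complex Lie algebras with an invariant form\<close>

text \<open>Made for the complexification. The normalization \<open>B \<xi> \<xi> = 1\<close> lets
  the \<xi>-component be read off by pairing with \<xi>. Finite dimension is left out here; it
  enters later as annihilation by a product of shifts.\<close>

locale quadratic_lie_algebra = vector_space scale
  for scale :: "complex \<Rightarrow> 'v::ab_group_add \<Rightarrow> 'v" (infixr "\<odot>" 75) +
  fixes br :: "'v \<Rightarrow> 'v \<Rightarrow> 'v" and B :: "'v \<Rightarrow> 'v \<Rightarrow> complex" and \<xi> :: 'v
  assumes br_add_left: "br (x + y) z = br x z + br y z"
    and br_scale_left: "br (c \<odot> x) z = c \<odot> br x z"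
    and br_self: "br x x = 0"
    and br_add_right: "br z (x + y) = br z x + br z y"
    and br_scale_right: "br z (c \<odot> x) = c \<odot> br z x"
    and jacobi: "br x (br y z) = br (br x y) z + br y (br x z)"
    and B_add_left: "B (x + y) z = B x z + B y z"
    and B_scale_left: "B (c \<odot> x) z = c * B x z"
    and B_sym: "B x y = B y x"
    and B_inv: "B (br x y) z = B x (br y z)"
    and B_nondeg: "(\<And>y. B x y = 0) \<Longrightarrow> x = 0"
    and B_xi: "B \<xi> \<xi> = 1"
    and centralizer: "br \<xi> x = 0 \<Longrightarrow> \<exists>c. x = c \<odot> \<xi>"
begin

definition D :: "'v \<Rightarrow> 'v" where "D x = br \<xi> x"
definition N :: "complex \<Rightarrow> 'v \<Rightarrow> 'v" where "N a x = D x - a \<odot> x"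
text \<open>The generalized eigenspace of ad \<xi>; below, \<open>shift_prod\<close> is a polynomial
  in ad \<xi> given by the list of its roots.\<close>

definition G :: "complex \<Rightarrow> 'v set" where "G a = {x. \<exists>m. (N a ^^ m) x = 0}"

fun shift_prod :: "complex list \<Rightarrow> 'v \<Rightarrow> 'v" where
  "shift_prod [] x = x"
| "shift_prod (r # rs) x = shift_prod rs (N r x)"

lemma br_anti: "br x y = - br y x"
proof -
  have "0 = br (x + y) (x + y)" by (simp only: br_self)
  also have "\<dots> = br x y + br y x" unfolding br_add_left br_add_right by (simp add: br_self)
  finally show ?thesis using eq_neg_iff_add_eq_0 by metis
qed

lemma B_add_right: "B z (x + y) = B z x + B z y"
  by (metis B_sym B_add_left)
lemma B_scale_right: "B z (c \<odot> x) = c * B z x"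
  by (metis B_sym B_scale_left)
lemma br_zero [simp]: "br 0 x = 0" "br x 0 = 0"
  using br_scale_left[of 0 0 x] br_scale_right[of x 0 0] by auto
lemma B_zero [simp]: "B 0 x = 0" "B x 0 = 0"
  using B_scale_left[of 0 0 x] B_scale_right[of x 0 0] by auto
lemma br_minus: "br (- x) y = - br x y" "br x (- y) = - br x y"
  using br_scale_left[of "-1" x y] br_scale_right[of x "-1" y] by auto
lemma B_minus: "B (- x) y = - B x y" "B x (- y) = - B x y"
  using B_scale_left[of "-1" x y] B_scale_right[of x "-1" y] by auto
lemma br_diff: "br (x - y) z = br x z - br y z" "br z (x - y) = br z x - br z y"
  using br_add_left[of x "- y" z] br_add_right[of z x "- y"] by (auto simp: br_minus)
lemma B_diff: "B (x - y) z = B x z - B y z" "B z (x - y) = B z x - B z y"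
  using B_add_left[of x "- y" z] B_add_right[of z x "- y"] by (auto simp: B_minus)

lemma D_add: "D (x + y) = D x + D y" and D_scale: "D (c \<odot> x) = c \<odot> D x"
  and D_diff: "D (x - y) = D x - D y" and D_zero [simp]: "D 0 = 0"
  by (simp_all add: D_def br_add_right br_scale_right br_diff)

lemma N_add: "N a (x + y) = N a x + N a y" and N_scale: "N a (c \<odot> x) = c \<odot> N a x"
  and N_zero [simp]: "N a 0 = 0"
  by (simp_all add: N_def D_add D_scale algebra_simps scale_right_distrib scale_right_diff_distrib)

lemma N_diff: "N a (x - y) = N a x - N a y"
  by (simp add: N_def D_diff algebra_simps scale_right_diff_distrib)

lemma N_commute: "N a (N b x) = N b (N a x)"
  by (simp add: N_def D_add D_scale D_diff algebra_simps scale_right_diff_distrib)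

lemma Npow_add: "(N a ^^ m) (x + y) = (N a ^^ m) x + (N a ^^ m) y"
  by (induction m) (auto simp: N_add)
lemma Npow_scale: "(N a ^^ m) (c \<odot> x) = c \<odot> (N a ^^ m) x"
  by (induction m) (auto simp: N_scale)
lemma Npow_zero [simp]: "(N a ^^ m) 0 = 0"
  by (induction m) auto

lemma Npow_mono: "(N a ^^ m) x = 0 \<Longrightarrow> m \<le> n \<Longrightarrow> (N a ^^ n) x = 0"
  by (metis (no_types, lifting) Npow_zero comp_apply funpow_add le_add_diff_inverse2)

section \<open>Generalized eigenspaces of ad \<xi>\<close>

lemma subspace_G: "subspace (G a)"
proof (rule subspaceI)
  show "0 \<in> G a" by (auto simp: G_def)
  show "c \<odot> x \<in> G a" if "x \<in> G a" for c x
    using that by (auto simp: G_def Npow_scale)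
  show "x + y \<in> G a" if xy: "x \<in> G a" "y \<in> G a" for x y
  proof -
    obtain m n where "(N a ^^ m) x = 0" "(N a ^^ n) y = 0" using xy by (auto simp: G_def)
    then have "(N a ^^ (max m n)) (x + y) = 0"
      using Npow_mono[of m a x "max m n"] Npow_mono[of n a y "max m n"] by (simp add: Npow_add)
    then show ?thesis by (auto simp: G_def)
  qed
qed

lemma N_in_G_iff: "N a x \<in> G a \<longleftrightarrow> x \<in> G a"
proof
  assume "N a x \<in> G a"
  then obtain m where "(N a ^^ m) (N a x) = 0" by (auto simp: G_def)
  then have "(N a ^^ Suc m) x = 0" by (simp only: funpow_Suc_right o_apply)
  then show "x \<in> G a" unfolding G_def by blast
next
  assume "x \<in> G a"
  then obtain m where "(N a ^^ m) x = 0" by (auto simp: G_def)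
  then have "(N a ^^ Suc m) x = 0" by simp
  then have "(N a ^^ m) (N a x) = 0" by (simp only: funpow_Suc_right o_apply)
  then show "N a x \<in> G a" by (auto simp: G_def)
qed

text \<open>Induction on the number of times \<open>N a\<close> must be applied to reach 0; it
  avoids exponents in the arguments that follow.\<close>

lemma G_induct [consumes 1, case_names zero step]:
  assumes "x \<in> G a" and "P 0" and "\<And>x. x \<in> G a \<Longrightarrow> P (N a x) \<Longrightarrow> P x"
  shows "P x"
proof -
  have "P x" if "(N a ^^ m) x = 0" for m x
    using that
  proof (induction m arbitrary: x)
    case 0
    then show ?case using assms(2) by simp
  next
    case (Suc m)
    have "(N a ^^ m) (N a x) = 0" using Suc.prems by (simp only: funpow_Suc_right o_apply)
    then show ?case using Suc assms(3) unfolding G_def by blast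
  qed
  then show ?thesis using assms(1) by (auto simp: G_def)
qed

text \<open>On \<open>G a\<close> the operator \<open>N r\<close> differs from the locally nilpotent
  \<open>N a\<close> by the nonzero scalar \<open>a - r\<close>. If \<open>N r y = N a x\<close>,
  then \<open>x - y\<close> is mapped to \<open>(a - r) \<odot> x\<close>.\<close>

lemma N_surj_G:
  assumes "x \<in> G a" "a \<noteq> r"
  shows "\<exists>y\<in>G a. N r y = x"
  using assms(1)
proof (induction rule: G_induct)
  case zero
  show ?case using subspace_0[OF subspace_G] by (intro bexI[of _ 0]) auto
next
  case (step x)
  then obtain y where y: "y \<in> G a" "N r y = N a x" by blast
  have "N r (x - y) = N r x - N a x" by (simp add: N_diff y)
  also have "\<dots> = (a - r) \<odot> x" by (simp add: N_def scale_left_diff_distrib)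
  finally have "N r (inverse (a - r) \<odot> (x - y)) = x"
    using assms(2) by (simp add: N_scale)
  moreover have "inverse (a - r) \<odot> (x - y) \<in> G a"
    using step y subspace_G by (simp add: subspace_diff subspace_scale)
  ultimately show ?case by blast
qed

text \<open>The inductive step of the primary decomposition. By \<open>N_surj_G\<close> every
  element of the span is \<open>N r u + g\<close> with \<open>u\<close> in the span and
  \<open>g\<close> in \<open>G r\<close>; for \<open>N r v\<close> this puts \<open>v - u\<close>
  into \<open>G r\<close>.\<close>

lemma N_in_span_G:
  assumes "N r v \<in> span (\<Union>a. G a)"
  shows "v \<in> span (\<Union>a. G a)"
proof -
  let ?W = "span (\<Union>a. G a)"
  have "\<exists>u\<in>?W. \<exists>g\<in>G r. w = N r u + g" if "w \<in> ?W" for w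
    using that
  proof (induction w rule: span_induct_alt)
    case base
    show ?case using subspace_0[OF subspace_G] span_zero by (intro bexI[of _ 0]) auto
  next
    case (step c x y)
    then obtain u g where ug: "u \<in> ?W" "g \<in> G r" "y = N r u + g" by blast
    from step obtain a where a: "x \<in> G a" by blast
    show ?case
    proof (cases "a = r")
      case True
      have "c \<odot> x + y = N r u + (c \<odot> x + g)" using ug by simp
      moreover have "c \<odot> x + g \<in> G r"
        using a True ug subspace_G by (auto intro!: subspace_add subspace_scale)
      ultimately show ?thesis using ug by blast
    next
      case False
      then obtain z where z: "z \<in> G a" "N r z = x" using N_surj_G a by blast
      have "c \<odot> x + y = N r (c \<odot> z + u) + g" using z ug by (simp add: N_add N_scale)
      moreover have "c \<odot> z + u \<in> ?W"
        using z ug by (auto intro!: span_add span_scale intro: span_base)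
      ultimately show ?thesis using ug by blast
    qed
  qed
  then obtain u g where ug: "u \<in> ?W" "g \<in> G r" "N r v = N r u + g" using assms by blast
  then have "N r (v - u) \<in> G r" by (simp add: N_diff)
  then have "v - u \<in> ?W" using N_in_G_iff by (auto intro: span_base)
  then show ?thesis using ug(1) span_add by fastforce
qed

lemma shift_prod_in_span_G: "shift_prod rs x = 0 \<Longrightarrow> x \<in> span (\<Union>a. G a)"
  by (induction rs arbitrary: x) (simp_all add: span_zero, metis N_in_span_G)

text \<open>ad \<xi> is a derivation, so \<open>N (a + b)\<close> of a bracket is the sum of the
  brackets with \<open>N a\<close> applied on the left or \<open>N b\<close> on the right; a double
  induction on nilpotency finishes.\<close>

lemma br_G:
  assumes "x \<in> G a" "y \<in> G b"
  shows "br x y \<in> G (a + b)"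
proof -
  have D: "D (br u v) = br (D u) v + br u (D v)" for u v
    unfolding D_def by (rule jacobi)
  have N: "N (a + b) (br u v) = br (N a u) v + br u (N b v)" for u v
    by (simp add: N_def D br_diff br_scale_left br_scale_right scale_left_distrib)
  have "br x y \<in> G (a + b)" if "y \<in> G b" for y
    using assms(1) that
  proof (induction arbitrary: y rule: G_induct)
    case zero
    then show ?case using subspace_0[OF subspace_G] by simp
  next
    case (step x)
    note IH = step.IH
    from step.prems show ?case
    proof (induction rule: G_induct)
      case zero
      then show ?case using subspace_0[OF subspace_G] by simp
    next
      case (step y)
      have "N (a + b) (br x y) \<in> G (a + b)"
        unfolding N using IH[OF step(1)] step(2) subspace_G subspace_add by blast
      then show ?case by (simp add: N_in_G_iff)
    qed
  qed
  then show ?thesis using assms(2) .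
qed

lemma B_D: "B (D x) y = - B x (D y)"
  unfolding D_def by (metis B_inv B_minus(1) br_anti)

text \<open>By skewness of ad \<xi>, \<open>(a + b) * B u v\<close> is a combination of pairings in
  which one argument has a smaller nilpotency order.\<close>

lemma B_G:
  assumes "x \<in> G a" "y \<in> G b" "a + b \<noteq> 0"
  shows "B x y = 0"
proof -
  have N: "(a + b) * B u v = - B (N a u) v - B u (N b v)" for u v
    by (simp add: N_def B_diff B_scale_left B_scale_right B_D algebra_simps)
  have "B x y = 0" if "y \<in> G b" for y
    using assms(1) that
  proof (induction arbitrary: y rule: G_induct)
    case zero
    then show ?case by simp
  next
    case (step x)
    note IH = step.IH
    from step.prems show ?case
    proof (induction rule: G_induct)
      case zero
      then show ?case by simp
    next
      case (step y)
      show ?case using N[of x y] IH[OF step(1)] step(2) assms(3) by simp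
    qed
  qed
  then show ?thesis using assms(2) .
qed

lemma D_xi [simp]: "D \<xi> = 0"
  by (simp add: D_def br_self)

text \<open>No Jordan block at 0: if \<open>D x\<close> is \<open>c \<odot> \<xi>\<close>, pairing
  with \<xi> gives c = 0 because ad \<xi> is skew and kills \<xi>, and then
  \<open>centralizer\<close> applies.\<close>

lemma G_0: "x \<in> G 0 \<Longrightarrow> \<exists>c. x = c \<odot> \<xi>"
proof (induction rule: G_induct)
  case zero
  show ?case by (intro exI[of _ 0]) simp
next
  case (step x)
  then obtain c where c: "D x = c \<odot> \<xi>" by (auto simp: N_def)
  have "c = B (D x) \<xi>" by (simp add: c B_scale_left B_xi)
  also have "\<dots> = 0" by (simp add: B_D)
  finally have "br \<xi> x = 0" using c by (simp add: D_def)
  then show ?case by (rule centralizer)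
qed

text \<open>The last nonzero iterate of \<open>N a\<close> on \<open>x\<close> is an
  eigenvector.\<close>

lemma eigenvector_of_G:
  assumes "x \<in> G a" "x \<noteq> 0"
  obtains v where "v \<noteq> 0" "D v = a \<odot> v"
proof -
  have "x \<noteq> 0 \<longrightarrow> (\<exists>v. v \<noteq> 0 \<and> D v = a \<odot> v)"
    using assms(1)
  proof (induction rule: G_induct)
    case zero
    then show ?case by simp
  next
    case (step x)
    then show ?case by (cases "N a x = 0") (auto simp: N_def)
  qed
  then show ?thesis using assms that by blast
qed

lemma eigenvector_in_G: "D v = a \<odot> v \<Longrightarrow> v \<in> G a"
  unfolding G_def by (auto simp: N_def intro!: exI[of _ 1])

text \<open>The bracket lies in \<open>G 0\<close>, the line through \<xi>, and its coefficient is
  found by pairing with \<xi>.\<close>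

lemma br_G_opposite:
  assumes "x \<in> G a" "y \<in> G (- a)"
  shows "br x y = B (D x) y \<odot> \<xi>"
proof -
  obtain c where c: "br x y = c \<odot> \<xi>" using br_G[OF assms] G_0[of "br x y"] by (metis add.right_inverse)
  have "c = B \<xi> (br x y)" by (simp add: c B_scale_right B_xi)
  also have "\<dots> = B (D x) y" by (simp add: D_def B_inv)
  finally have "c = B (D x) y" .
  then show ?thesis using c by (simp only:)
qed

lemma shift_prod_eigenvector:
  "D v = a \<odot> v \<Longrightarrow> shift_prod rs v = prod_list (map (\<lambda>r. a - r) rs) \<odot> v"
proof (induction rs arbitrary: v)
  case (Cons r rs)
  have "N r v = (a - r) \<odot> v" by (simp add: N_def Cons.prems scale_left_diff_distrib)
  moreover have "D ((a - r) \<odot> v) = a \<odot> ((a - r) \<odot> v)"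
    by (simp add: D_scale Cons.prems mult.commute)
  ultimately have "shift_prod (r # rs) v = prod_list (map (\<lambda>r. a - r) rs) \<odot> ((a - r) \<odot> v)"
    using Cons.IH[of "(a - r) \<odot> v"] by simp
  then show ?case by (simp add: mult.commute)
qed simp

lemma shift_prod_linear: "shift_prod rs (x + y) = shift_prod rs x + shift_prod rs y"
  "shift_prod rs (c \<odot> x) = c \<odot> shift_prod rs x"
  by (induction rs arbitrary: x y) (auto simp: N_add N_scale)

lemma shift_prod_N: "shift_prod rs (N r x) = N r (shift_prod rs x)"
  by (induction rs arbitrary: x) (simp_all, metis N_commute)

lemma shift_prod_append: "shift_prod (rs @ ss) x = shift_prod ss (shift_prod rs x)"
  by (induction rs arbitrary: x) auto

lemma shift_prod_commute: "shift_prod ss (shift_prod rs x) = shift_prod rs (shift_prod ss x)"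
  by (induction ss arbitrary: x) (simp_all add: shift_prod_N)

lemma shift_prod_0 [simp]: "shift_prod rs 0 = 0"
  by (induction rs) auto

text \<open>Maximality gives \<open>[v, e] = 0\<close>, and then the Jacobi identity for \<open>v, e, f\<close> makes \<open>D v\<close> a
  multiple of \<open>D e\<close>; no diagonalizability of \<open>D\<close> is assumed.\<close>

lemma G_max_line:
  assumes max: "\<forall>a v. v \<noteq> 0 \<longrightarrow> D v = a \<odot> v \<longrightarrow> cmod a \<le> cmod l"
    and l: "l \<noteq> 0" and e: "e \<in> G l" and f: "D f = - l \<odot> f" and ef: "B e f = 1 / l"
  shows "br e f = \<xi>" "v \<in> G l \<Longrightarrow> \<exists>c. v = c \<odot> e" "D e = l \<odot> e"
proof -
  have fG: "f \<in> G (- l)" using eigenvector_in_G f by simp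
  have BD: "B (D x) f = l * B x f" for x
    by (simp add: B_D f B_minus B_scale_right)
  \<comment> \<open>The value 1/l of \<open>B e f\<close> is what makes the coefficient of \<xi>
    equal to 1.\<close>
  show br_ef: "br e f = \<xi>"
    using br_G_opposite[OF e fG] l by (simp add: BD ef)
  have big: "x = 0" if "x \<in> G a" "cmod a > cmod l" for x a
    using that max eigenvector_of_G by (metis not_less)
  have *: "D v = (l * B v f) \<odot> D e" if "v \<in> G l" for v
  proof -
    have "br v e \<in> G (l + l)" using br_G e that by blast
    moreover have "cmod (l + l) > cmod l" using l by (simp add: mult_2 [symmetric] norm_mult)
    ultimately have ve: "br v e = 0" using big by blast
    have "br v \<xi> = br (br v e) f + br e (br v f)" using jacobi[of v e f] br_ef by simp
    also have "\<dots> = B (D v) f \<odot> br e \<xi>"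
      using br_G_opposite[OF that fG] by (simp add: ve br_scale_right)
    finally have "- D v = B (D v) f \<odot> (- D e)" unfolding D_def using br_anti by metis
    then have "D v = B (D v) f \<odot> D e" by simp
    then show ?thesis by (simp only: BD)
  qed
  show line: "\<exists>c. v = c \<odot> e" if v: "v \<in> G l" for v
  proof -
    \<comment> \<open>By the identity just proved \<open>u\<close> is centralized by \<xi>, hence a
      multiple of \<xi>; lying also in \<open>G l\<close> it is orthogonal to \<xi>, so it
      vanishes.\<close>
    define u where "u = v - (l * B v f) \<odot> e"
    have "D u = 0" unfolding u_def using *[OF v] by (simp add: D_diff D_scale)
    then obtain c where c: "u = c \<odot> \<xi>" using centralizer D_def by auto
    have "u \<in> G l" unfolding u_def using v e subspace_G by (auto intro!: subspace_diff subspace_scale)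
    moreover have "\<xi> \<in> G 0" by (rule eigenvector_in_G) simp
    ultimately have "B u \<xi> = 0" using B_G l by auto
    then have "c = 0" by (simp add: c B_scale_left B_xi)
    then have "v = (l * B v f) \<odot> e" using c u_def by simp
    then show ?thesis by blast
  qed
  \<comment> \<open>Since \<open>G l\<close> is a line, \<open>e\<close> is an eigenvector for some
    value \<open>l + c\<close>; pairing with \<open>f\<close> forces c = 0.\<close>
  have "N l e \<in> G l" using e N_in_G_iff by simp
  then obtain c where "N l e = c \<odot> e" using line by blast
  then have De: "D e = (l + c) \<odot> e" by (simp add: N_def scale_left_distrib algebra_simps)
  then have "(l + c) * B e f = l * B e f" using BD[of e] by (simp add: B_scale_left)
  then have "c = 0" using ef l by (simp add: algebra_simps)
  then show "D e = l \<odot> e" using De by simp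
qed

end

text \<open>Finite dimension in the form in which it is used: one split polynomial in ad \<xi>
  annihilates the whole space.\<close>

locale rank_one_quadratic_lie_algebra = quadratic_lie_algebra +
  assumes shift_prod_zero: "\<exists>rs. \<forall>x. shift_prod rs x = 0"
begin

lemma span_G: "span (\<Union>a. G a) = UNIV"
  using shift_prod_zero shift_prod_in_span_G by blast

lemma finite_eigenvalues: "finite {a. \<exists>v. v \<noteq> 0 \<and> D v = a \<odot> v}"
proof -
  obtain rs where rs: "\<And>x. shift_prod rs x = 0" using shift_prod_zero by blast
  have "a \<in> set rs" if "v \<noteq> 0" "D v = a \<odot> v" for a v
    using shift_prod_eigenvector[OF that(2), of rs] rs that(1) by (auto simp: prod_list_zero_iff)
  then have "{a. \<exists>v. v \<noteq> 0 \<and> D v = a \<odot> v} \<subseteq> set rs" by blast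
  then show ?thesis using finite_subset by blast
qed

text \<open>\<open>y\<close> is orthogonal to every generalized eigenspace except
  \<open>G a\<close>, and these span the space. The value \<open>1 / t\<close> is free up to
  scaling; below \<open>t\<close> is 1 or the maximal eigenvalue.\<close>

lemma G_nondeg:
  assumes "y \<in> G b" "a + b = 0" "y \<noteq> 0"
  obtains x where "x \<in> G a" "B x y = 1 / t"
proof -
  have "\<exists>x\<in>G a. B x y \<noteq> 0"
  proof (rule ccontr)
    assume "\<not> ?thesis"
    then have *: "B x y = 0" if "x \<in> G c" for x c
      using that assms B_G by (metis add_right_cancel)
    have "B x y = 0" for x
    proof -
      have "x \<in> span (\<Union>a. G a)" using span_G by blast
      then show ?thesis
        by (induction x rule: span_induct_alt) (auto simp: B_add_left B_scale_left *)
    qed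
    then show False using B_nondeg B_sym assms(3) by metis
  qed
  then obtain x where "x \<in> G a" "B x y \<noteq> 0" by blast
  then have "inverse (t * B x y) \<odot> x \<in> G a" "B (inverse (t * B x y) \<odot> x) y = 1 / t"
    using subspace_G by (auto simp: B_scale_left subspace_scale field_simps)
  then show ?thesis using that by blast
qed

lemma eigenvalue_uminus:
  assumes "v \<noteq> 0" "D v = a \<odot> v"
  obtains w where "w \<noteq> 0" "D w = - a \<odot> w"
proof -
  obtain x where x: "x \<in> G (- a)" "B x v = 1 / 1"
    using G_nondeg[of v a "- a" 1] eigenvector_in_G assms by auto
  then have "x \<noteq> 0" by auto
  then show ?thesis using x eigenvector_of_G that by metis
qed

text \<open>An eigenvector \<open>v\<close> killed by \<open>e\<close> generates a string of length two under \<open>f\<close>, which forces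
  \<open>\<lambda> = 2 a\<close>; then the Jacobi identity for \<open>v\<close>, \<open>[f, v]\<close> and a vector dual to \<open>[f, v]\<close> fails.\<close>

lemma eigenvalue_exclusion:
  assumes max: "\<forall>a v. v \<noteq> 0 \<longrightarrow> D v = a \<odot> v \<longrightarrow> cmod a \<le> cmod l" and l: "l \<noteq> 0"
    and De: "D e = l \<odot> e" and Df: "D f = - l \<odot> f" and ef: "br e f = \<xi>"
    and line: "\<forall>v\<in>G l. \<exists>c. v = c \<odot> e" and Bef: "B e f = 1 / l"
    and v: "v \<noteq> 0" "D v = a \<odot> v" and a: "a \<noteq> 0" "a \<noteq> l" "cmod (a + l) > cmod l"
  shows False
proof -
  have eG: "e \<in> G l" and fG: "f \<in> G (- l)" and vG: "v \<in> G a"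
    using eigenvector_in_G De Df v by auto
  have big: "x = 0" if "x \<in> G b" "cmod b > cmod l" for x b
    using that max eigenvector_of_G by (metis not_less)
  have ev: "br e v = 0" using br_G[OF eG vG] big a by (auto simp: add.commute)
  define w where "w = br f v"
  have wG: "w \<in> G (a - l)" using br_G[OF fG vG] by (simp add: w_def)
  have Dw: "D w = (a - l) \<odot> w"
    unfolding w_def using jacobi[of \<xi> f v] Df v(2)
    by (simp add: D_def br_scale_left br_scale_right br_minus scale_left_diff_distrib)
  have ew: "br e w = a \<odot> v"
    using jacobi[of e f v] ev ef v(2) by (simp add: w_def D_def)
  have w0: "w \<noteq> 0" using ew a v by auto
  have "br f w = 0"
  proof -
    have "br f w \<in> G (a - 2 * l)" using br_G[OF fG wG] by (simp add: algebra_simps)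
    moreover have "cmod (a - 2 * l) > cmod l"
    proof -
      have "cmod a \<le> cmod l" using max v by blast
      have sq: "(cmod z)\<^sup>2 = (Re z)\<^sup>2 + (Im z)\<^sup>2" for z by (simp add: cmod_power2)
      have "(cmod l)\<^sup>2 < (cmod (a - 2 * l))\<^sup>2"
      proof -
        have 1: "(cmod a)\<^sup>2 \<le> (cmod l)\<^sup>2" using \<open>cmod a \<le> cmod l\<close> by simp
        have 2: "(cmod (a - l))\<^sup>2 > 0" using a by simp
        \<comment> \<open>The parallelogram law for \<open>a - l\<close> and
          \<open>l\<close>.\<close>
        have "(cmod (a - 2 * l))\<^sup>2 = 2 * (cmod (a - l))\<^sup>2 + 2 * (cmod l)\<^sup>2 - (cmod a)\<^sup>2"
          unfolding sq by (simp add: power2_eq_square algebra_simps)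
        then show ?thesis using 1 2 by linarith
      qed
      then show ?thesis by (simp add: power2_less_imp_less)
    qed
    ultimately show ?thesis using big by blast
  qed
  \<comment> \<open>Jacobi for \<open>e\<close>, \<open>f\<close>, \<open>w\<close> with
    \<open>[f, w] = 0\<close>: the eigenvalues of \<open>w\<close> under ad \<xi> and under ad f
    composed with ad e add up to zero.\<close>
  then have "br \<xi> w + br f (br e w) = 0" using jacobi[of e f w] ef by simp
  then have "(a - l) \<odot> w + a \<odot> w = 0"
    using Dw by (simp add: D_def ew br_scale_right w_def [symmetric])
  then have "(2 * a - l) \<odot> w = 0" by (simp add: scale_left_distrib [symmetric] algebra_simps)
  then have a_half: "l = 2 * a" using w0 by simp
  \<comment> \<open>With l = 2 a the vector \<open>w\<close> has eigenvalue \<open>- a\<close>, so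
    its dual \<open>v'\<close> lies in \<open>G a\<close> and \<open>[v', v]\<close> falls into the
    line \<open>G l\<close>.\<close>
  have "a + (a - l) = 0" by (simp add: a_half)
  then obtain v' where v': "v' \<in> G a" "B v' w = 1 / 1" using G_nondeg[OF wG _ w0, of a 1] by blast
  have wG': "w \<in> G (- a)" using wG by (simp add: a_half)
  have "B v w = 0"
  proof -
    have "B v (br f v) = - B v (br f v)"
      by (metis B_inv B_minus(1) B_sym br_anti)
    then show ?thesis unfolding w_def by simp
  qed
  then have vw: "br v w = 0"
    using br_G_opposite[OF vG wG'] v(2) by (simp add: B_scale_left)
  have v'w: "br v' w = a \<odot> \<xi>"
    using br_G_opposite[OF v'(1) wG'] v'(2) Dw
    by (simp add: B_D B_scale_right B_minus a_half)
  have "br v' v \<in> G l" using br_G[OF v'(1) vG] by (simp add: a_half)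
  then obtain c where c: "br v' v = c \<odot> e" using line by blast
  \<comment> \<open>Pairing with \<open>f\<close> and moving the bracket across by invariance gives
    \<open>- B v' w = - 1\<close>, hence c = - l.\<close>
  have "c * (1 / l) = B (br v' v) f" by (simp add: c B_scale_left Bef)
  also have "\<dots> = B v' (br v f)" by (rule B_inv)
  also have "\<dots> = - 1" unfolding br_anti[of v f] using v' by (simp add: w_def B_minus)
  finally have c': "c = - l" using l by (simp add: field_simps)
  have "0 = br (br v' v) w + br v (br v' w)" using jacobi[of v' v w] vw by simp
  also have "\<dots> = c \<odot> (a \<odot> v) + a \<odot> br v \<xi>"
    by (simp add: c br_scale_left ew v'w br_scale_right)
  also have "br v \<xi> = - (a \<odot> v)" using br_anti v(2) D_def by metis
  finally have "(c * a - a * a) \<odot> v = 0" by (simp add: scale_left_diff_distrib)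
  then have "c * a - a * a = 0" using v by simp
  \<comment> \<open>The Jacobi identity demands c = a, whereas c = - l = - 2 a.\<close>
  then show False using c' a_half a by simp
qed

text \<open>The vector \<open>x0\<close> guarantees a nonzero eigenvalue. Once only 0 and
  \<plusminus>l survive, the space is the sum of \<open>G 0\<close>, \<open>G l\<close> and
  \<open>G (- l)\<close>, each of which is a line.\<close>

theorem three_dimensional:
  assumes "\<And>c. x0 \<noteq> c \<odot> \<xi>"
  obtains e f where "\<And>x. \<exists>a b c. x = a \<odot> \<xi> + b \<odot> e + c \<odot> f"
proof -
  let ?E = "{a. \<exists>v. v \<noteq> 0 \<and> D v = a \<odot> v}"
  have nz: "\<exists>a\<in>?E. a \<noteq> 0"
  proof (rule ccontr)
    assume no: "\<not> ?thesis"
    then have "x = 0" if "x \<in> G a" "a \<noteq> 0" for x a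
      using that eigenvector_of_G by blast
    then have "\<exists>c. x = c \<odot> \<xi>" if "x \<in> G a" for x a
      using that G_0 by (cases "a = 0") (auto intro: exI[of _ 0])
    then have "(\<Union>a. G a) \<subseteq> span {\<xi>}" unfolding span_singleton by blast
    then have "span (\<Union>a. G a) \<subseteq> span {\<xi>}" by (simp add: span_minimal)
    then have "x0 \<in> span {\<xi>}" using span_G by blast
    then show False using assms by (auto simp: span_singleton)
  qed
  have fin: "finite (cmod ` ?E)" using finite_eigenvalues by blast
  have "Max (cmod ` ?E) \<in> cmod ` ?E" using fin nz by (intro Max_in) auto
  then obtain l where lE: "l \<in> ?E" "cmod l = Max (cmod ` ?E)" by force
  have max: "\<forall>a v. v \<noteq> 0 \<longrightarrow> D v = a \<odot> v \<longrightarrow> cmod a \<le> cmod l"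
  proof (intro allI impI)
    fix a v
    assume "v \<noteq> 0" "D v = a \<odot> v"
    then have "cmod a \<in> cmod ` ?E" by blast
    then show "cmod a \<le> cmod l" unfolding lE(2) using fin by (rule Max_ge [rotated])
  qed
  obtain a0 v0 where "a0 \<noteq> 0" "v0 \<noteq> 0" "D v0 = a0 \<odot> v0" using nz by blast
  then have l0: "l \<noteq> 0" using max by fastforce
  obtain f where f: "f \<noteq> 0" "D f = - l \<odot> f" using lE eigenvalue_uminus by blast
  obtain e where e: "e \<in> G l" "B e f = 1 / l"
    using G_nondeg[of f "- l" l l] eigenvector_in_G f by auto
  note M = G_max_line[OF max l0 e(1) f(2) e(2)]
  have De: "D e = l \<odot> e" by (rule M(3))
  have ef: "br e f = \<xi>" by (rule M(1))
  have line: "\<forall>v\<in>G l. \<exists>c. v = c \<odot> e" using M(2) by blast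
  \<comment> \<open>The triple is also used reversed: \<open>- f\<close> in the role of
    \<open>e\<close>, \<open>e\<close> in the role of \<open>f\<close>, and \<open>- l\<close> in
    the role of \<open>l\<close>. The sign keeps the bracket equal to \<xi>.\<close>
  have max': "\<forall>a v. v \<noteq> 0 \<longrightarrow> D v = a \<odot> v \<longrightarrow> cmod a \<le> cmod (- l)"
    using max by simp
  have l0': "- l \<noteq> 0" using l0 by simp
  have mfG: "- f \<in> G (- l)" using eigenvector_in_G f by (simp add: subspace_neg subspace_G)
  have Dee: "D e = - (- l) \<odot> e" using De by simp
  have Bfe: "B (- f) e = 1 / (- l)" using e(2) B_sym by (simp add: B_minus)
  note M' = G_max_line[OF max' l0' mfG Dee Bfe]
  have fe: "br (- f) e = \<xi>" by (rule M'(1))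
  have Df': "D (- f) = - l \<odot> (- f)" by (rule M'(3))
  have line': "\<forall>v\<in>G (- l). \<exists>c. v = c \<odot> (- f)" using M'(2) by blast
  have ev: "a = 0 \<or> a = l \<or> a = - l" if v: "v \<noteq> 0" "D v = a \<odot> v" for a v
  proof (rule ccontr)
    assume no: "\<not> ?thesis"
    \<comment> \<open>By the parallelogram law a nonzero \<open>a\<close> cannot leave both
      \<open>a + l\<close> and \<open>a - l\<close> within modulus \<open>cmod l\<close>; which one
      escapes decides between the triple and its reversal.\<close>
    have "cmod (a + l) > cmod l \<or> cmod (a - l) > cmod l"
    proof (rule ccontr)
      assume "\<not> ?thesis"
      then have "(cmod (a + l))\<^sup>2 \<le> (cmod l)\<^sup>2" "(cmod (a - l))\<^sup>2 \<le> (cmod l)\<^sup>2"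
        by (auto simp: not_less)
      moreover have "(cmod (a + l))\<^sup>2 + (cmod (a - l))\<^sup>2 = 2 * (cmod a)\<^sup>2 + 2 * (cmod l)\<^sup>2"
        unfolding cmod_power2 by (simp add: power2_eq_square algebra_simps)
      ultimately have "(cmod a)\<^sup>2 \<le> 0" by linarith
      then show False using no by simp
    qed
    then show False
    proof
      assume "cmod (a + l) > cmod l"
      then show False using eigenvalue_exclusion[OF max l0 De f(2) ef line e(2) v] no by blast
    next
      assume "cmod (a - l) > cmod l"
      then have "cmod (a + - l) > cmod (- l)" by simp
      then show False
        using eigenvalue_exclusion[OF max' l0' Df' Dee fe line' Bfe v] no by blast
    qed
  qed
  have "x \<in> span {\<xi>, e, f}" if "x \<in> G a" for x a
  proof (cases "x = 0")
    case False
    then have "a = 0 \<or> a = l \<or> a = - l" using ev that eigenvector_of_G by metis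
    then show ?thesis
    proof (elim disjE)
      assume "a = 0"
      then have "x \<in> G (0)" using that by simp
      then obtain c where "x = c \<odot> \<xi>" using G_0 by blast
      then show ?thesis by (simp add: span_base span_scale)
    next
      assume "a = l"
      then have "x \<in> G (l)" using that by simp
      then obtain c where "x = c \<odot> e" using line by blast
      then show ?thesis by (simp add: span_base span_scale)
    next
      assume "a = - l"
      then have "x \<in> G (- l)" using that by simp
      then obtain c where "x = c \<odot> (- f)" using line' by blast
      then show ?thesis by (simp add: span_base span_scale span_neg)
    qed
  qed (simp add: span_zero)
  then have "span (\<Union>a. G a) \<subseteq> span {\<xi>, e, f}" by (intro span_minimal) auto
  then have all: "x \<in> span {\<xi>, e, f}" for x using span_G by blast
  have "\<exists>a b c. x = a \<odot> \<xi> + b \<odot> e + c \<odot> f" for x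
  proof -
    obtain k1 where "x - k1 \<odot> \<xi> \<in> span {e, f}" using all[of x] span_breakdown_eq by blast
    then obtain k2 where "x - k1 \<odot> \<xi> - k2 \<odot> e \<in> span {f}" using span_breakdown_eq by blast
    then obtain k3 where "x - k1 \<odot> \<xi> - k2 \<odot> e = k3 \<odot> f" by (auto simp: span_singleton)
    then have "x = k1 \<odot> \<xi> + k2 \<odot> e + k3 \<odot> f" by (simp add: algebra_simps)
    then show ?thesis by blast
  qed
  then show ?thesis using that by blast
qed

end


section \<open>Three-dimensional real Lie algebras with an invariant form\<close>

context quadratic_lie_algebra
begin

definition poly_action :: "complex poly \<Rightarrow> 'v \<Rightarrow> 'v" where
  "poly_action p x = (\<Sum>i\<le>degree p. coeff p i \<odot> (D ^^ i) x)"

lemma poly_action_bound: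
  assumes "degree p \<le> n"
  shows "poly_action p x = (\<Sum>i\<le>n. coeff p i \<odot> (D ^^ i) x)"
  unfolding poly_action_def
  by (rule sum.mono_neutral_left) (use assms in \<open>auto simp: coeff_eq_0\<close>)

lemma Dpow_linear: "(D ^^ i) (x - y) = (D ^^ i) x - (D ^^ i) y" "(D ^^ i) (c \<odot> x) = c \<odot> (D ^^ i) x"
  by (induction i) (auto simp: D_diff D_scale)

lemma poly_action_root_factor: "poly_action ([:- r, 1:] * q) x = poly_action q (N r x)"
proof -
  let ?n = "degree q"
  have q: "[:- r, 1:] * q = pCons 0 q - smult r q" by simp
  have "degree (pCons 0 q) \<le> Suc ?n" "degree (smult r q) \<le> Suc ?n" by simp_all
  then have deg: "degree (pCons 0 q - smult r q) \<le> Suc ?n" by (rule degree_diff_le)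
  have "poly_action ([:- r, 1:] * q) x =
      (\<Sum>i\<le>Suc ?n. coeff (pCons 0 q) i \<odot> (D ^^ i) x) - (\<Sum>i\<le>Suc ?n. coeff (smult r q) i \<odot> (D ^^ i) x)"
    unfolding q poly_action_bound[OF deg] by (simp add: scale_left_diff_distrib sum_subtractf)
  also have "(\<Sum>i\<le>Suc ?n. coeff (pCons 0 q) i \<odot> (D ^^ i) x) = (\<Sum>i\<le>?n. coeff q i \<odot> (D ^^ i) (D x))"
    unfolding sum.atMost_Suc_shift by (simp add: funpow_swap1)
  also have "(\<Sum>i\<le>Suc ?n. coeff (smult r q) i \<odot> (D ^^ i) x) = (\<Sum>i\<le>?n. coeff q i \<odot> (D ^^ i) (r \<odot> x))"
    by (simp add: coeff_eq_0 Dpow_linear mult.commute)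
  finally show ?thesis
    by (simp add: poly_action_def N_def Dpow_linear scale_right_diff_distrib sum_subtractf)
qed

text \<open>The place where algebraic closedness is used: a polynomial relation is split off one
  root at a time.\<close>

lemma shift_prod_of_poly_action:
  assumes "p \<noteq> 0" "poly_action p x = 0"
  shows "\<exists>rs. shift_prod rs x = 0"
  using assms
proof (induction "degree p" arbitrary: p x rule: less_induct)
  case less
  show ?case
  proof (cases "degree p = 0")
    case True
    then obtain a where "p = [:a:]" by (rule degree_eq_zeroE)
    then have "x = 0" using less.prems by (simp add: poly_action_def)
    then show ?thesis by (intro exI[of _ "[]"]) simp
  next
    case False
    then have "\<not> constant (poly p)" by (simp add: constant_degree)
    then obtain r where "poly p r = 0" using fundamental_theorem_of_algebra by blast
    then obtain q where q: "p = [:- r, 1:] * q" by (auto simp: poly_eq_0_iff_dvd elim: dvdE)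
    then have "q \<noteq> 0" using less.prems by auto
    then have "degree q < degree p" unfolding q by (subst degree_mult_eq) auto
    moreover have "poly_action q (N r x) = 0" using less.prems q poly_action_root_factor by metis
    ultimately obtain rs where "shift_prod rs (N r x) = 0" using less.hyps \<open>q \<noteq> 0\<close> by blast
    then show ?thesis by (intro exI[of _ "r # rs"]) simp
  qed
qed

lemma shift_prod_of_relation:
  assumes "(\<Sum>i\<le>n. a i \<odot> (D ^^ i) x) = 0" "i \<le> n" "a i \<noteq> 0"
  shows "\<exists>rs. shift_prod rs x = 0"
proof -
  let ?p = "\<Sum>i\<le>n. monom (a i) i"
  have c: "coeff ?p k = (if k \<le> n then a k else 0)" for k
    by (simp add: coeff_sum)
  then have "?p \<noteq> 0" using assms by (metis coeff_0)
  moreover have "degree ?p \<le> n" by (intro degree_le) (simp add: c)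
  then have "poly_action ?p x = 0" using assms by (simp add: poly_action_bound c)
  ultimately show ?thesis by (rule shift_prod_of_poly_action)
qed

end

lemma ex_linear_relation:
  fixes f :: "nat \<Rightarrow> 'a::euclidean_space"
  shows "\<exists>a. (\<exists>i\<le>DIM('a). a i \<noteq> 0) \<and> (\<Sum>i\<le>DIM('a). a i *\<^sub>R f i) = 0"
proof (cases "inj_on f {..DIM('a)}")
  case True
  have "dependent (f ` {..DIM('a)})"
    using True by (intro dependent_biggerset) (auto simp: card_image)
  then obtain u where u: "\<exists>v\<in>f ` {..DIM('a)}. u v \<noteq> 0" "(\<Sum>v\<in>f ` {..DIM('a)}. u v *\<^sub>R v) = 0"
    by (auto simp: dependent_finite)
  then show ?thesis
    by (intro exI[of _ "\<lambda>i. u (f i)"]) (auto simp: sum.reindex[OF True])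
next
  case False
  \<comment> \<open>A repetition in the family is invisible to dependence of its image as a set; it
    supplies the relation \<open>f i - f k = 0\<close> directly.\<close>
  then obtain i k where ik: "i \<le> DIM('a)" "k \<le> DIM('a)" "i \<noteq> k" "f i = f k"
    by (auto simp: inj_on_def)
  define a where "a l = (if l = i then 1 else if l = k then - 1 else 0 :: real)" for l
  have "(\<Sum>l\<le>DIM('a). a l *\<^sub>R f l) = (\<Sum>l\<in>{i, k}. a l *\<^sub>R f l)"
    by (rule sum.mono_neutral_right) (use ik in \<open>auto simp: a_def\<close>)
  also have "\<dots> = 0" using ik by (simp add: a_def)
  finally show ?thesis using ik by (intro exI[of _ a]) (auto simp: a_def)
qed

text \<open>Complexification on pairs, with \<open>(x, y)\<close> standing for x + i y;
  \<open>cbracket\<close> and \<open>cform\<close> are the complex bilinear extensions.\<close>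

definition cscale :: "complex \<Rightarrow> 'a::real_vector \<times> 'a \<Rightarrow> 'a \<times> 'a" where
  "cscale c z = (Re c *\<^sub>R fst z - Im c *\<^sub>R snd z, Re c *\<^sub>R snd z + Im c *\<^sub>R fst z)"

definition cbracket :: "('a \<Rightarrow> 'a \<Rightarrow> 'a::real_vector) \<Rightarrow> 'a \<times> 'a \<Rightarrow> 'a \<times> 'a \<Rightarrow> 'a \<times> 'a" where
  "cbracket br x y =
     (br (fst x) (fst y) - br (snd x) (snd y), br (fst x) (snd y) + br (snd x) (fst y))"

definition cform :: "('a \<Rightarrow> 'a \<Rightarrow> real) \<Rightarrow> 'a \<times> 'a \<Rightarrow> 'a \<times> 'a \<Rightarrow> complex" where
  "cform B x y = Complex (B (fst x) (fst y) - B (snd x) (snd y)) (B (fst x) (snd y) + B (snd x) (fst y))"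

locale real_quadratic_lie_algebra =
  fixes br :: "'e::euclidean_space \<Rightarrow> 'e \<Rightarrow> 'e" and B :: "'e \<Rightarrow> 'e \<Rightarrow> real" and \<xi> :: 'e
  assumes br: "bilinear br" and br_self: "br x x = 0"
    and jacobi: "br x (br y z) = br (br x y) z + br y (br x z)"
    and B: "bilinear B" and B_sym: "B x y = B y x" and B_inv: "B (br x y) z = B x (br y z)"
    and B_nondeg: "(\<And>y. B x y = 0) \<Longrightarrow> x = 0"
    and B_xi: "B \<xi> \<xi> \<noteq> 0"
    and centralizer: "br \<xi> x = 0 \<Longrightarrow> \<exists>c. x = c *\<^sub>R \<xi>"
    and dim_ge: "DIM('e) \<ge> 3"
begin

lemmas br_simps = bilinear_ladd[OF br] bilinear_radd[OF br] bilinear_lmul[OF br] bilinear_rmul[OF br]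
  bilinear_lneg[OF br] bilinear_rneg[OF br] bilinear_lzero[OF br] bilinear_rzero[OF br]
  bilinear_lsub[OF br] bilinear_rsub[OF br]

lemmas B_simps = bilinear_ladd[OF B] bilinear_radd[OF B] bilinear_lmul[OF B] bilinear_rmul[OF B]
  bilinear_lneg[OF B] bilinear_rneg[OF B] bilinear_lzero[OF B] bilinear_rzero[OF B]
  bilinear_lsub[OF B] bilinear_rsub[OF B]

lemma br_anti: "br x y = - br y x"
proof -
  have "br (x + y) (x + y) = br x y + br y x"
    unfolding bilinear_ladd[OF br] bilinear_radd[OF br] by (simp add: br_self)
  then show ?thesis using br_self[of "x + y"] eq_neg_iff_add_eq_0 by metis
qed

text \<open>Dividing the form, rather than rescaling \<xi>, keeps \<xi> real also when
  \<open>B \<xi> \<xi>\<close> is negative.\<close>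

abbreviation "B' \<equiv> \<lambda>x y. B x y / B \<xi> \<xi>"

sublocale cx: quadratic_lie_algebra cscale "cbracket br" "cform B'" "(\<xi>, 0)"
proof
  fix a b :: complex and x y z :: "'e \<times> 'e"
  show "cscale a (x + y) = cscale a x + cscale a y"
    by (simp add: cscale_def algebra_simps)
  show "cscale (a + b) x = cscale a x + cscale b x"
    by (simp add: cscale_def algebra_simps)
  show "cscale a (cscale b x) = cscale (a * b) x"
    by (simp add: cscale_def algebra_simps)
  show "cscale 1 x = x" by (simp add: cscale_def)
  show "cbracket br (x + y) z = cbracket br x z + cbracket br y z"
    by (simp add: cbracket_def br_simps)
  show "cbracket br (cscale a x) z = cscale a (cbracket br x z)"
    by (simp add: cbracket_def cscale_def br_simps algebra_simps)
  show "cbracket br x x = 0"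
    using br_anti[of "fst x" "snd x"] by (simp add: cbracket_def br_self zero_prod_def)
  show "cbracket br z (x + y) = cbracket br z x + cbracket br z y"
    by (simp add: cbracket_def br_simps)
  show "cbracket br z (cscale a x) = cscale a (cbracket br z x)"
    by (simp add: cbracket_def cscale_def br_simps algebra_simps)
  show "cbracket br x (cbracket br y z) = cbracket br (cbracket br x y) z + cbracket br y (cbracket br x z)"
    unfolding cbracket_def
    by (simp add: br_simps jacobi[of "fst x"] jacobi[of "snd x"])
  show "cform B' (x + y) z = cform B' x z + cform B' y z"
    by (simp add: cform_def B_simps add_divide_distrib complex_eq_iff)
  show "cform B' (cscale a x) z = a * cform B' x z"
    by (simp add: cform_def cscale_def B_simps complex_eq_iff add_divide_distrib diff_divide_distrib algebra_simps)
  show "cform B' x y = cform B' y x"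
    by (simp add: cform_def B_sym)
  show "cform B' (cbracket br x y) z = cform B' x (cbracket br y z)"
    by (simp add: cform_def cbracket_def B_simps B_inv add_divide_distrib diff_divide_distrib)
  show "cform B' (\<xi>, 0) (\<xi>, 0) = 1"
    using B_xi by (simp add: cform_def B_simps complex_eq_iff)
  show "x = 0" if "\<And>y. cform B' x y = 0"
  proof -
    have "B (fst x) y = 0 \<and> B (snd x) y = 0" for y
      using that[of "(y, 0)"] B_xi by (simp add: cform_def B_simps complex_eq_iff)
    then have "fst x = 0" "snd x = 0" using B_nondeg by blast+
    then show ?thesis by (simp add: prod_eq_iff)
  qed
  show "\<exists>c. x = cscale c (\<xi>, 0)" if x: "cbracket br (\<xi>, 0) x = 0"
  proof -
    have "br \<xi> (fst x) = 0" "br \<xi> (snd x) = 0"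
      using x by (simp_all add: cbracket_def br_simps zero_prod_def)
    then obtain c d where "fst x = c *\<^sub>R \<xi>" "snd x = d *\<^sub>R \<xi>" using centralizer by blast
    then show ?thesis by (intro exI[of _ "Complex c d"]) (simp add: cscale_def prod_eq_iff)
  qed
qed

lemma cx_Dpow: "(cx.D ^^ i) (x, 0) = ((br \<xi> ^^ i) x, 0)"
proof (induction i)
  case (Suc i)
  have "cx.D (v, 0) = (br \<xi> v, 0)" for v
    unfolding cx.D_def by (simp add: cbracket_def br_simps)
  then show ?case using Suc by simp
qed simp

text \<open>The iterates of ad \<xi> on each basis vector are linearly related, which gives a list
  of roots for that vector; joining the lists over the finite basis annihilates everything.\<close>

sublocale cx: rank_one_quadratic_lie_algebra cscale "cbracket br" "cform B'" "(\<xi>, 0)"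
proof
  have "\<exists>rs. cx.shift_prod rs (b, 0) = 0" for b
  proof -
    obtain a i where a: "i \<le> DIM('e)" "a i \<noteq> 0"
      "(\<Sum>i\<le>DIM('e). a i *\<^sub>R (br \<xi> ^^ i) b) = 0"
      using ex_linear_relation[of "\<lambda>i. (br \<xi> ^^ i) b"] by blast
    have "(\<Sum>i\<le>DIM('e). cscale (complex_of_real (a i)) ((cx.D ^^ i) (b, 0))) =
        (\<Sum>i\<le>DIM('e). a i *\<^sub>R (br \<xi> ^^ i) b, 0)"
      by (simp add: cx_Dpow cscale_def prod_eq_iff fst_sum snd_sum)
    then show ?thesis
      using cx.shift_prod_of_relation[of "\<lambda>i. complex_of_real (a i)" "(b, 0)" "DIM('e)" i] a
      by (simp add: zero_prod_def)
  qed
  then obtain r where r: "\<And>b. cx.shift_prod (r b) (b, 0) = 0" by metis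
  have "\<exists>rs. \<forall>b\<in>S. cx.shift_prod rs (b, 0) = 0" if "finite S" for S :: "'e set"
    using that
  proof (induction S)
    case (insert b S)
    then obtain rs where rs: "\<forall>b\<in>S. cx.shift_prod rs (b, 0) = 0" by blast
    have "cx.shift_prod (r b @ rs) (c, 0) = 0" if "c \<in> insert b S" for c
    proof (cases "c = b")
      case True
      then show ?thesis by (simp add: cx.shift_prod_append r)
    next
      case False
      then have "cx.shift_prod rs (c, 0) = 0" using that rs by blast
      then show ?thesis
        unfolding cx.shift_prod_append cx.shift_prod_commute[of rs "r b"] by simp
    qed
    then show ?case by blast
  qed simp
  from this[OF finite_Basis] obtain rs where rs: "\<forall>b\<in>Basis. cx.shift_prod rs (b :: 'e, 0) = 0" by blast
  have real: "cx.shift_prod rs (x, 0) = 0" for x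
  proof -
    have "subspace {x. cx.shift_prod rs (x, 0) = 0}"
    proof (rule subspaceI)
      fix x y :: 'e and c :: real
      have add: "(x + y, 0) = (x, 0) + (y, 0 :: 'e)" by simp
      have scale: "(c *\<^sub>R x, 0) = cscale (complex_of_real c) (x, 0)" by (simp add: cscale_def)
      assume x: "x \<in> {x. cx.shift_prod rs (x, 0) = 0}"
      then show "c *\<^sub>R x \<in> {x. cx.shift_prod rs (x, 0) = 0}"
        unfolding mem_Collect_eq scale cx.shift_prod_linear by simp
      assume "y \<in> {x. cx.shift_prod rs (x, 0) = 0}"
      with x show "x + y \<in> {x. cx.shift_prod rs (x, 0) = 0}"
        unfolding mem_Collect_eq add cx.shift_prod_linear by simp
    qed (simp flip: zero_prod_def)
    then have "span Basis \<subseteq> {x. cx.shift_prod rs (x, 0) = 0}"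
      using rs by (intro span_minimal) auto
    then show ?thesis by auto
  qed
  have "cx.shift_prod rs z = 0" for z
  proof -
    have z: "z = (fst z, 0) + cscale \<i> (snd z, 0)" by (simp add: cscale_def prod_eq_iff)
    show ?thesis by (subst z) (simp only: cx.shift_prod_linear real cx.scale_zero_right add_0)
  qed
  then show "\<exists>rs. \<forall>x. cx.shift_prod rs x = 0" by blast
qed

text \<open>The complexification is spanned over the complex numbers by three vectors, so its real
  dimension 2 DIM('e) is at most 6.\<close>

lemma dim_eq: "DIM('e) = 3"
proof -
  have "\<exists>x. \<forall>c. x \<noteq> cscale c (\<xi>, 0)"
  proof (rule ccontr)
    assume "\<not> ?thesis"
    then have *: "\<exists>c. (x, 0) = cscale c (\<xi>, 0)" for x by blast
    have "x \<in> span {\<xi>}" for x using *[of x] by (auto simp: cscale_def span_singleton)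
    then have "dim (UNIV :: 'e set) \<le> card {\<xi>}" by (intro dim_le_card) auto
    then show False using dim_ge by simp
  qed
  then obtain x0 where "\<And>c. x0 \<noteq> cscale c (\<xi>, 0)" by blast
  then obtain e f where ef: "\<And>x. \<exists>a b c. x = cscale a (\<xi>, 0) + cscale b e + cscale c f"
    using cx.three_dimensional by metis
  \<comment> \<open>Adding the multiples by the imaginary unit turns the complex span into a real
    one.\<close>
  let ?S = "{(\<xi>, 0), cscale \<i> (\<xi>, 0), e, cscale \<i> e, f, cscale \<i> f}"
  have sp: "cscale a z \<in> span ?S" if "z \<in> ?S" "cscale \<i> z \<in> ?S" for a z
  proof -
    have "cscale a z = Re a *\<^sub>R z + Im a *\<^sub>R cscale \<i> z" by (simp add: cscale_def prod_eq_iff)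
    then show ?thesis using that by (simp add: span_add span_scale span_base)
  qed
  have "x \<in> span ?S" for x
  proof -
    obtain a b c where x: "x = cscale a (\<xi>, 0) + cscale b e + cscale c f" using ef by blast
    show ?thesis unfolding x by (intro span_add sp) simp_all
  qed
  then have "dim (UNIV :: ('e \<times> 'e) set) \<le> card ?S" by (intro dim_le_card) auto
  also have "card ?S \<le> 6" by (rule card_insert_le_m1) (auto intro!: card_insert_le_m1)
  finally show ?thesis using dim_ge by simp
qed

text \<open>\<xi>, \<open>x\<close> and \<open>y = [\<xi>, x]\<close> are orthogonal and non-null,
  so in dimension three a vector is determined by its pairings with them, and invariance computes
  those pairings for each bracket.\<close>

lemma cyclic_basis:
  obtains x y p q where "br \<xi> x = y" "br x y = p *\<^sub>R \<xi>" "br y \<xi> = q *\<^sub>R x" "p \<noteq> 0" "q \<noteq> 0"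
    "\<And>z. \<exists>a b c. z = a *\<^sub>R \<xi> + b *\<^sub>R x + c *\<^sub>R y"
proof -
  define \<pi> where "\<pi> z = z - (B z \<xi> / B \<xi> \<xi>) *\<^sub>R \<xi>" for z
  have \<pi>: "B (\<pi> z) \<xi> = 0" for z using B_xi by (simp add: \<pi>_def B_simps)
  have "\<exists>x. B x \<xi> = 0 \<and> B x x \<noteq> 0"
  proof (rule ccontr)
    assume no: "\<not> ?thesis"
    \<comment> \<open>Polarization: if all vectors orthogonal to \<xi> were null, \<open>B\<close>
      would vanish on that hyperplane, making it trivial by nondegeneracy and leaving only the line
      through \<xi>.\<close>
    have pol: "B x y = 0" if "B x \<xi> = 0" "B y \<xi> = 0" for x y
    proof -
      have "B (x + y) \<xi> = 0" using that by (simp add: B_simps)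
      then have "B (x + y) (x + y) = 0" "B x x = 0" "B y y = 0" using no that by blast+
      then show ?thesis using B_sym[of x y] by (simp add: B_simps)
    qed
    have "\<pi> z = 0" for z
    proof (rule B_nondeg)
      fix y
      have "B (\<pi> z) y = B (\<pi> z) (\<pi> y + (B y \<xi> / B \<xi> \<xi>) *\<^sub>R \<xi>)" by (simp add: \<pi>_def)
      then show "B (\<pi> z) y = 0" by (simp add: bilinear_radd[OF B] bilinear_rmul[OF B] \<pi> pol)
    qed
    then have "z \<in> span {\<xi>}" for z by (auto simp: \<pi>_def span_singleton)
    then have "dim (UNIV :: 'e set) \<le> card {\<xi>}" by (intro dim_le_card) auto
    then show False using dim_ge by simp
  qed
  then obtain x where x: "B x \<xi> = 0" "B x x \<noteq> 0" by blast
  define y where "y = br \<xi> x"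
  have yx: "B y x = 0" unfolding y_def by (simp add: B_inv br_self B_simps)
  have y\<xi>: "B y \<xi> = 0" unfolding y_def br_anti[of \<xi> x] by (simp add: B_inv br_self B_simps)
  have y0: "y \<noteq> 0"
  proof
    assume "y = 0"
    then obtain c where "x = c *\<^sub>R \<xi>" using centralizer y_def by auto
    then show False using x B_xi by (simp add: B_simps)
  qed
  have combo: "\<exists>a b c. z = a *\<^sub>R \<xi> + b *\<^sub>R x + c *\<^sub>R y" for z
  proof -
    have coeffs: "a = 0 \<and> b = 0 \<and> c = 0" if "a *\<^sub>R \<xi> + b *\<^sub>R x + c *\<^sub>R y = 0" for a b c
    proof -
      have "B (a *\<^sub>R \<xi> + b *\<^sub>R x + c *\<^sub>R y) \<xi> = 0" "B (a *\<^sub>R \<xi> + b *\<^sub>R x + c *\<^sub>R y) x = 0"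
        unfolding that by (simp_all add: B_simps)
      then have "a = 0" "b = 0" using x yx y\<xi> B_xi B_sym[of \<xi> x] by (auto simp: B_simps)
      then show ?thesis using that y0 by simp
    qed
    have ne: "\<xi> \<noteq> x" "\<xi> \<noteq> y" "x \<noteq> y" using x yx y\<xi> B_xi by auto
    have "independent {\<xi>, x, y}"
    proof (rule independent_if_scalars_zero)
      fix f v assume "(\<Sum>x\<in>{\<xi>, x, y}. f x *\<^sub>R x) = 0" "v \<in> {\<xi>, x, y}"
      then show "f v = 0" using coeffs[of "f \<xi>" "f x" "f y"] ne by (auto simp: add.assoc)
    qed simp
    then have "UNIV \<subseteq> span {\<xi>, x, y}"
      using ne dim_eq by (intro card_ge_dim_independent) auto
    then have "z \<in> span {\<xi>, x, y}" by blast
    then obtain a where "z - a *\<^sub>R \<xi> \<in> span {x, y}" using span_breakdown_eq by blast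
    then obtain b where "z - a *\<^sub>R \<xi> - b *\<^sub>R x \<in> span {y}" using span_breakdown_eq by blast
    then obtain c where "z - a *\<^sub>R \<xi> - b *\<^sub>R x = c *\<^sub>R y" by (auto simp: span_singleton)
    then have "z = a *\<^sub>R \<xi> + b *\<^sub>R x + c *\<^sub>R y" by (simp add: algebra_simps)
    then show ?thesis by blast
  qed
  have ext: "z = w" if "B z \<xi> = B w \<xi>" "B z x = B w x" "B z y = B w y" for z w
  proof -
    have "z - w = 0"
    proof (rule B_nondeg)
      fix v
      obtain a b c where "v = a *\<^sub>R \<xi> + b *\<^sub>R x + c *\<^sub>R y" using combo by blast
      then show "B (z - w) v = 0" using that by (simp add: B_simps)
    qed
    then show ?thesis by simp
  qed
  have yy: "B y y \<noteq> 0"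
  proof
    assume "B y y = 0"
    then have "y = 0" by (intro ext) (use yx y\<xi> in \<open>simp_all add: B_simps\<close>)
    then show False using y0 by simp
  qed
  \<comment> \<open>The coefficient comes from \<open>B [x, y] \<xi> = B y y\<close>; for
    \<open>[y, \<xi>]\<close> the pairing with \<open>x\<close> gives \<open>B y y\<close>
    likewise.\<close>
  have "br x y = (B y y / B \<xi> \<xi>) *\<^sub>R \<xi>"
  proof (rule ext)
    have "B (br x y) \<xi> = B \<xi> (br x y)" by (rule B_sym)
    also have "\<dots> = B y y" by (simp add: B_inv[symmetric] y_def)
    finally show "B (br x y) \<xi> = B ((B y y / B \<xi> \<xi>) *\<^sub>R \<xi>) \<xi>" using B_xi by (simp add: B_simps)
    show "B (br x y) x = B ((B y y / B \<xi> \<xi>) *\<^sub>R \<xi>) x"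
      unfolding br_anti[of x y] using x B_sym[of \<xi> x] by (simp add: B_simps B_inv br_self)
    show "B (br x y) y = B ((B y y / B \<xi> \<xi>) *\<^sub>R \<xi>) y"
      using y\<xi> B_sym[of \<xi> y] by (simp add: B_simps B_inv br_self)
  qed
  moreover have "br y \<xi> = (B y y / B x x) *\<^sub>R x"
  proof (rule ext)
    show "B (br y \<xi>) \<xi> = B ((B y y / B x x) *\<^sub>R x) \<xi>" using x by (simp add: B_simps B_inv br_self)
    show "B (br y \<xi>) x = B ((B y y / B x x) *\<^sub>R x) x" using x by (simp add: B_simps B_inv y_def[symmetric])
    have "B (br y \<xi>) y = - B (br \<xi> y) y" unfolding br_anti[of y \<xi>] by (simp add: B_simps)
    then show "B (br y \<xi>) y = B ((B y y / B x x) *\<^sub>R x) y"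
      using yx B_sym[of x y] by (simp add: B_simps B_inv br_self)
  qed
  moreover have "B y y / B \<xi> \<xi> \<noteq> 0" "B y y / B x x \<noteq> 0" using yy B_xi x by simp_all
  ultimately show ?thesis by (rule that[OF y_def[symmetric] _ _ _ _ combo])
qed

text \<open>Positive rescaling of the three basis vectors can give the structure constants any
  absolute values, so only their signs matter.\<close>

lemma model_isomorphism:
  assumes ab: "br a b = \<gamma> *\<^sub>R c" and bc: "br b c = \<alpha> *\<^sub>R a" and ca: "br c a = \<beta> *\<^sub>R b"
    and pos: "\<alpha> / A > 0" "\<beta> / A' > 0" "\<gamma> / C > 0"
    and span: "\<And>z. \<exists>k l m. z = k *\<^sub>R a + l *\<^sub>R b + m *\<^sub>R c"
  shows "\<exists>\<phi>. linear \<phi> \<and> bij \<phi> \<and> (\<forall>x y. br (\<phi> x) (\<phi> y) = \<phi> (scaled_cross A A' C x y))"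
proof -
  \<comment> \<open>The scales must satisfy \<open>s * t * \<alpha> = A * r\<close> and its two
    cyclic companions. Multiplying two of these leaves the square of one unknown, and the sign
    conditions make the roots real.\<close>
  define r where "r = 1 / sqrt (\<beta> / A' * (\<gamma> / C))"
  define s where "s = 1 / sqrt (\<alpha> / A * (\<gamma> / C))"
  define t where "t = 1 / sqrt (\<alpha> / A * (\<beta> / A'))"
  have ident: "1 / sqrt (u * w) * (1 / sqrt (u * v)) * u = 1 / sqrt (v * w)" if "u > 0" for u v w :: real
  proof -
    have "1 / (k * W) * (1 / (k * V)) * (k * k) = 1 / (V * W)" if "k \<noteq> 0" for k V W :: real
      using that by (simp add: divide_simps)
    from this[of "sqrt u" "sqrt w" "sqrt v"] show ?thesis using that by (simp add: real_sqrt_mult)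
  qed
  have ne: "A \<noteq> 0" "A' \<noteq> 0" "C \<noteq> 0" using pos by auto
  have pos': "r > 0" "s > 0" "t > 0" using pos by (simp_all only: r_def s_def t_def) (simp_all del: times_divide_eq_left times_divide_eq_right times_divide_times_eq)
  have "s * t * (\<alpha> / A) = r" "t * r * (\<beta> / A') = s" "r * s * (\<gamma> / C) = t"
    unfolding r_def s_def t_def
    using ident[OF pos(1), of "\<gamma> / C" "\<beta> / A'"] ident[OF pos(2), of "\<alpha> / A" "\<gamma> / C"]
      ident[OF pos(3), of "\<beta> / A'" "\<alpha> / A"]
    by (simp_all only: mult.commute)
  then have rst: "s * t * \<alpha> = A * r" "t * r * \<beta> = A' * s" "r * s * \<gamma> = C * t"
    using ne by (simp_all add: field_simps)
  define \<phi> where "\<phi> x = (x$1 * r) *\<^sub>R a + (x$2 * s) *\<^sub>R b + (x$3 * t) *\<^sub>R c" for x :: "real^3"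
  have lin: "linear \<phi>" by (auto simp: linear_iff \<phi>_def algebra_simps)
  have surj: "surj \<phi>"
    unfolding surj_def
  proof
    fix z
    obtain k l m where z: "z = k *\<^sub>R a + l *\<^sub>R b + m *\<^sub>R c" using span by blast
    show "\<exists>x. z = \<phi> x"
      by (rule exI[of _ "vector [k / r, l / s, m / t]"]) (use pos' in \<open>simp add: \<phi>_def z\<close>)
  qed
  have "dim (UNIV :: 'e set) = dim (UNIV :: (real^3) set)" using dim_eq by simp
  with lin surj have "inj \<phi>" by (rule linear_surjective_imp_injective)
  then have bij: "bij \<phi>" using surj by (simp add: bij_def)
  have "br (\<phi> x) (\<phi> y) = \<phi> (scaled_cross A A' C x y)" for x y
  proof -
    have "br (\<phi> x) (\<phi> y) =
      ((x$2 * y$3 - x$3 * y$2) * (s * t)) *\<^sub>R br b c + ((x$3 * y$1 - x$1 * y$3) * (t * r)) *\<^sub>R br c a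
        + ((x$1 * y$2 - x$2 * y$1) * (r * s)) *\<^sub>R br a b"
      unfolding \<phi>_def using br_anti[of c b] br_anti[of a c] br_anti[of b a]
      by (simp add: br_simps br_self algebra_simps)
    also have "\<dots> = ((x$2 * y$3 - x$3 * y$2) * (s * t * \<alpha>)) *\<^sub>R a + ((x$3 * y$1 - x$1 * y$3) * (t * r * \<beta>)) *\<^sub>R b
        + ((x$1 * y$2 - x$2 * y$1) * (r * s * \<gamma>)) *\<^sub>R c"
      by (simp add: ab bc ca mult.assoc)
    also have "\<dots> = \<phi> (scaled_cross A A' C x y)"
      unfolding rst by (simp add: \<phi>_def scaled_cross_def mult_ac)
    finally show ?thesis .
  qed
  then show ?thesis using lin bij by blast
qed

text \<open>In the basis \<xi>, \<open>x\<close>, \<open>y\<close> the constants have the signs of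
  p, q, 1. Equal signs give su(2). With mixed signs, cyclic rotation and, if needed, negation of the
  basis lead to two negative constants followed by a positive one, which is sl(2,R).\<close>

theorem classification:
  "(\<exists>\<phi>. linear \<phi> \<and> bij \<phi> \<and> (\<forall>x y. br (\<phi> x) (\<phi> y) = \<phi> (scaled_cross (- 2) (- 2) 2 x y))) \<or>
   (\<exists>\<phi>. linear \<phi> \<and> bij \<phi> \<and> (\<forall>x y. br (\<phi> x) (\<phi> y) = \<phi> (scaled_cross 2 2 2 x y)))"
proof -
  obtain x y p q where xy: "br \<xi> x = y" "br x y = p *\<^sub>R \<xi>" "br y \<xi> = q *\<^sub>R x" "p \<noteq> 0" "q \<noteq> 0"
    and span: "\<And>z. \<exists>a b c. z = a *\<^sub>R \<xi> + b *\<^sub>R x + c *\<^sub>R y"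
    by (rule cyclic_basis) blast
  have xy1: "br \<xi> x = 1 *\<^sub>R y" using xy by simp
  \<comment> \<open>Negating all basis vectors changes the sign of all three constants; it serves
    the cases with exactly one negative constant.\<close>
  have n1: "br (- \<xi>) (- x) = (- 1) *\<^sub>R (- y)" and n2: "br (- x) (- y) = (- p) *\<^sub>R (- \<xi>)"
    and n3: "br (- y) (- \<xi>) = (- q) *\<^sub>R (- x)" using xy by (simp_all add: br_simps)
  have span': "\<exists>a b c. z = a *\<^sub>R (- x) + b *\<^sub>R (- y) + c *\<^sub>R (- \<xi>)"
    "\<exists>a b c. z = a *\<^sub>R (- y) + b *\<^sub>R (- \<xi>) + c *\<^sub>R (- x)" for z
  proof -
    obtain a b c where "- z = a *\<^sub>R \<xi> + b *\<^sub>R x + c *\<^sub>R y" using span by blast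
    then have z: "z = - (a *\<^sub>R \<xi> + b *\<^sub>R x + c *\<^sub>R y)" by (metis minus_minus)
    show "\<exists>a b c. z = a *\<^sub>R (- x) + b *\<^sub>R (- y) + c *\<^sub>R (- \<xi>)"
      by (intro exI[of _ b] exI[of _ c] exI[of _ a]) (simp add: z)
    show "\<exists>a b c. z = a *\<^sub>R (- y) + b *\<^sub>R (- \<xi>) + c *\<^sub>R (- x)"
      by (intro exI[of _ c] exI[of _ a] exI[of _ b]) (simp add: z)
  qed
  consider "p > 0" "q > 0" | "p < 0" "q < 0" | "p > 0" "q < 0" | "p < 0" "q > 0"
    using xy(4,5) by linarith
  then show ?thesis
  proof cases
    case 1
    have pos: "p / 2 > 0" "q / 2 > 0" "1 / 2 > (0 :: real)" using 1 by simp_all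
    show ?thesis using model_isomorphism[OF xy1 xy(2,3) pos span] by (rule disjI2)
  next
    case 2
    have pos: "p / (- 2) > 0" "q / (- 2) > 0" "1 / 2 > (0 :: real)" using 2 by simp_all
    show ?thesis using model_isomorphism[OF xy1 xy(2,3) pos span] by (rule disjI1)
  next
    case 3
    have pos: "(- 1) / (- 2) > (0 :: real)" "- p / (- 2) > 0" "- q / 2 > 0" using 3 by simp_all
    show ?thesis using model_isomorphism[OF n3 n1 n2 pos span'(2)] by (rule disjI1)
  next
    case 4
    have pos: "- q / (- 2) > 0" "(- 1) / (- 2) > (0 :: real)" "- p / 2 > 0" using 4 by simp_all
    show ?thesis using model_isomorphism[OF n2 n3 n1 pos span'(1)] by (rule disjI1)
  qed
qed

end


section \<open>The classification\<close>

lemma linear_inv_of_bij: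
  assumes "linear f" "bij f"
  shows "linear (inv_into UNIV f)"
proof -
  have "f (inv_into UNIV f x) = x" "inv_into UNIV f (f y) = y" for x y
    using assms(2) by (simp_all add: bij_is_surj bij_is_inj surj_f_inv_f)
  then show ?thesis
    unfolding linear_iff using linear_add[OF assms(1)] linear_scale[OF assms(1)] by metis
qed

text \<open>The two isomorphisms point in opposite directions, \<phi> out of the model and
  \<open>P\<close> into it, so both are inverted in the composite.\<close>

lemma locally_isomorphic_via_model:
  fixes G :: "('a, 'c) monoid_scheme" and M :: "('a, 'e::euclidean_space) manifold"
    and H :: "('b, 'd) monoid_scheme" and N :: "('b, 'f::euclidean_space) manifold"
    and \<phi> :: "'m::euclidean_space \<Rightarrow> 'e" and P :: "'f \<Rightarrow> 'm"
  assumes \<phi>: "linear \<phi>" "bij \<phi>" "\<forall>x y. lie_bracket G M (\<phi> x) (\<phi> y) = \<phi> (K x y)"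
    and P: "linear P" "bij P" "\<And>u v. P (lie_bracket H N u v) = K (P u) (P v)"
  shows "locally_isomorphic G M H N"
proof -
  let ?\<Phi> = "inv_into UNIV P \<circ> inv_into UNIV \<phi>"
  have "linear (inv_into UNIV P)" "linear (inv_into UNIV \<phi>)"
    using \<phi> P by (auto intro: linear_inv_of_bij)
  then have "linear ?\<Phi>" by (rule linear_compose[rotated])
  moreover have "bij ?\<Phi>" using \<phi> P by (intro bij_comp bij_imp_bij_inv)
  moreover have "?\<Phi> (lie_bracket G M u v) = lie_bracket H N (?\<Phi> u) (?\<Phi> v)" for u v
  proof -
    let ?x = "inv_into UNIV \<phi> u" and ?y = "inv_into UNIV \<phi> v"
    have "\<phi> ?x = u" "\<phi> ?y = v" using \<phi>(2) by (simp_all add: bij_is_surj surj_f_inv_f)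
    then have "inv_into UNIV \<phi> (lie_bracket G M u v) = K ?x ?y"
      using \<phi>(2,3) by (metis bij_is_inj inv_f_f)
    also have "\<dots> = P (lie_bracket H N (inv_into UNIV P ?x) (inv_into UNIV P ?y))"
      using P(2,3) by (simp add: bij_is_surj surj_f_inv_f)
    finally show ?thesis using P(2) by (simp add: bij_is_inj inv_f_f)
  qed
  ultimately show ?thesis unfolding locally_isomorphic_def by blast
qed

theorem theorem1:
  fixes G :: "('a, 'c) monoid_scheme" and M :: "('a, 'e::euclidean_space) manifold"
  assumes "lie_group G M"
    and "\<exists>B. bi_invariant_metric G M B"
    and "\<exists>n \<eta>. n \<ge> 1 \<and> contact_form M n \<eta> \<and> left_invariant_form G M \<eta>"
  shows "locally_isomorphic G M SL2R SL2R_manifold \<or> locally_isomorphic G M SU2 SU2_manifold"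
proof -
  interpret smooth_lie_group G M by standard (rule assms(1))
  obtain B where B: "bi_invariant_metric G M B" using assms(2) by blast
  obtain n \<eta> where \<eta>: "n \<ge> 1" "contact_form M n \<eta>" "left_invariant_form G M \<eta>"
    using assms(3) by blast
  obtain \<xi> where \<xi>: "B \<one>\<^bsub>G\<^esub> \<xi> \<xi> \<noteq> 0"
    "\<And>x. lie_bracket G M \<xi> x = 0 \<Longrightarrow> \<exists>c. x = c *\<^sub>R \<xi>"
    using contact_vector[OF B \<eta>(2,3)] by blast
  have "\<one>\<^bsub>G\<^esub> \<in> topspace (mtop M)" using one_closed carrier by simp
  then have Bp: "bilinear (B \<one>\<^bsub>G\<^esub>)" "\<And>u v. B \<one>\<^bsub>G\<^esub> u v = B \<one>\<^bsub>G\<^esub> v u"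
    "\<And>u. (\<And>v. B \<one>\<^bsub>G\<^esub> u v = 0) \<Longrightarrow> u = 0"
    using B by (auto simp: bi_invariant_metric_def pseudo_riemannian_metric_def)
  have anti: "bracket u v = - bracket v u" for u v by (simp add: bracket_def)
  interpret real_quadratic_lie_algebra "lie_bracket G M" "B \<one>\<^bsub>G\<^esub>" \<xi>
  proof
    show "bilinear (lie_bracket G M)" using bilinear_bracket by (simp add: lie_bracket_eq_bracket)
    show "lie_bracket G M x x = 0" for x by (simp add: lie_bracket_eq_bracket bracket_def)
    show "lie_bracket G M x (lie_bracket G M y z) =
        lie_bracket G M (lie_bracket G M x y) z + lie_bracket G M y (lie_bracket G M x z)" for x y z
    proof -
      \<comment> \<open>The cyclic Jacobi identity is brought into the form saying that ad x is a
        derivation.\<close>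
      have "bracket y (bracket z x) = - bracket y (bracket x z)"
        using anti[of z x] bilinear_rneg[OF bilinear_bracket] by simp
      then show ?thesis
        using bracket_jacobi[of x y z] anti[of z "bracket x y"]
        by (simp add: lie_bracket_eq_bracket algebra_simps)
    qed
    show "B \<one>\<^bsub>G\<^esub> (lie_bracket G M x y) z = B \<one>\<^bsub>G\<^esub> x (lie_bracket G M y z)" for x y z
      using bi_invariant_metric_ad[OF B, of y x z] anti[of x y] bilinear_lneg[OF Bp(1)]
      by (simp add: lie_bracket_eq_bracket)
    \<comment> \<open>The dimension is 2 n + 1 with n \<ge> 1.\<close>
    show "DIM('e) \<ge> 3" using \<eta>(1,2) by (simp add: contact_form_def)
  qed (use Bp \<xi> in blast)+
  from classification show ?thesis
  proof
    assume "\<exists>\<phi>. linear \<phi> \<and> bij \<phi> \<and>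
      (\<forall>x y. lie_bracket G M (\<phi> x) (\<phi> y) = \<phi> (scaled_cross (- 2) (- 2) 2 x y))"
    then obtain \<phi> :: "real^3 \<Rightarrow> 'e" where \<phi>: "linear \<phi>" "bij \<phi>"
      "\<forall>x y. lie_bracket G M (\<phi> x) (\<phi> y) = \<phi> (scaled_cross (- 2) (- 2) 2 x y)" by blast
    obtain P :: "real^3 \<Rightarrow> real^3" where P: "linear P" "bij P"
      "\<And>u v. P (lie_bracket SL2R SL2R_manifold u v) = scaled_cross (- 2) (- 2) 2 (P u) (P v)"
      by (rule SL2R_lie_algebra) blast
    show ?thesis using locally_isomorphic_via_model[OF \<phi> P] by blast
  next
    assume "\<exists>\<phi>. linear \<phi> \<and> bij \<phi> \<and>
      (\<forall>x y. lie_bracket G M (\<phi> x) (\<phi> y) = \<phi> (scaled_cross 2 2 2 x y))"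
    then obtain \<phi> :: "real^3 \<Rightarrow> 'e" where \<phi>: "linear \<phi>" "bij \<phi>"
      "\<forall>x y. lie_bracket G M (\<phi> x) (\<phi> y) = \<phi> (scaled_cross 2 2 2 x y)" by blast
    obtain P :: "real^3 \<Rightarrow> real^3" where P: "linear P" "bij P"
      "\<And>u v. P (lie_bracket SU2 SU2_manifold u v) = scaled_cross 2 2 2 (P u) (P v)"
      by (rule SU2_lie_algebra) blast
    show ?thesis using locally_isomorphic_via_model[OF \<phi> P] by blast
  qed
qed

end
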